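(* Let $n \in \mathbb{N}$, $d \mid n$, $\lambda \vdash n/d$, $q$ a prime power, $f \in \mathcal{F}_d(q)$, $\mu \vdash n$, $g \in \mathcal{T}^\Box_\mu(q)$, and let $h_1,\ldots,h_{\ell(\mu)}$ be the distinct irreducible factors of the characteristic polynomial of $g$, ordered so that $\deg h_i = \mu_i$. If some part of $\mu$ is not divisible by $d$, then $\chi^{f\mapsto\lambda}(g) = 0$. Otherwise there is $\tilde\mu \vdash n/d$ with $\mu = d\tilde\mu$, and \[ \chi^{f\mapsto\lambda}(g) = (-1)^{\frac{n}{d}(d-1)}\, \chi^\lambda_{\tilde\mu} \prod_{i=1}^{\ell(\mu)} \frac{1}{\tilde\mu_i} \sum_{\substack{\beta_i \in \mathbb{F}_{q^{\mu_i}} \\ h_i(\beta_i)=0}} \theta(\beta_i)^{\ell_f [\tilde\mu_i]_{q^d}}. \]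
   Context: Notation. $q$ is a prime power; $[m]_q = 1+q+\cdots+q^{m-1}$. $\mathcal{F}(q)$ is the set of monic nonconstant irreducible polynomials in $\mathbb{F}_q[z]$ other than $z$, and $\mathcal{F}_d(q)$ those of degree $d$. Fix a generator $\varepsilon$ of the cyclic group $\mathbb{F}_{q^{n!}}^\times$ and the injective homomorphism $\theta:\mathbb{F}_{q^{n!}}^\times \to \mathbb{C}^\times$ with $\theta(\varepsilon)=e^{2\pi i/(q^{n!}-1)}$; for $1 \le d \le n$ put $\varepsilon_d = \varepsilon^{(q^{n!}-1)/(q^d-1)}$, a generator of $\mathbb{F}_{q^d}^\times \subset \mathbb{F}_{q^{n!}}^\times$. For $h \in \mathcal{F}_d(q)$, $\ell_h$ is a fixed integer with $h(\varepsilon_d^{\ell_h})=0$. For partitions: $\ell(\mu)$ is the number of nonzero parts, $m_i(\mu)$ the multiplicity of $i$, $z_\nu = \prod_i i^{m_i(\nu)}m_i(\nu)!$, $d\mu = (d\mu_1,d\mu_2,\ldots)$, and $\chi^\lambda_\nu$ is the value of the irreducible $S_{|\lambda|}$-character indexed by $\lambda$ on permutations of cycle type $\nu$. Cycle type and regular semisimple: the cycle type of $g \in \mathrm{GL}_n\mathbb{F}_q$ is the partition of $n$ formed by the degrees of the irreducible factors (with multiplicity) of its characteristic polynomial; $g$ is regular semisimple if its characteristic polynomial has no repeated irreducible factor; $\mathcal{T}^\Box_\mu(q)$ is the set of regular semisimple elements of cycle type $\mu$. Green's primary characters. For $g \in \mathrm{GL}_m\mathbb{F}_q$, say $g$ is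 primary with index $h \mapsto \rho$ ($h \in \mathcal{F}(q)$, $\rho$ a nonempty partition) if $\mathbb{F}_q^m$, made an $\mathbb{F}_q[z]$-module via $z \mapsto g$, is isomorphic to $\bigoplus_i \mathbb{F}_q[z]/(h^{\rho_i})$. For $b \in \mathbb{Z}$, $m \in \mathbb{N}$ define the class function $P_m^b$ on $\mathrm{GL}_m\mathbb{F}_q$ by $P_m^b(g) = \kappa(\rho, q^{\deg h}) \sum_{i=1}^{\deg h} \theta(\varepsilon_{\deg h}^{\ell_h})^{q^i b}$ if $g$ is primary with index $h \mapsto \rho$, and $0$ otherwise, where $\kappa(\rho,t) = \prod_{i=1}^{\ell(\rho)-1}(1-t^i)$. For a partition $\nu = (\nu_1,\ldots,\nu_\ell)$ of $N$, let $\mathcal{P}_\nu \subset \mathrm{GL}_N\mathbb{F}_q$ be the block upper triangular matrices with diagonal blocks of sizes $\nu_1,\ldots,\nu_\ell$, and $\pi_i^\nu$ the projection to the $i$-th diagonal block. For characters $\chi_i$ of $\mathrm{GL}_{\nu_i}\mathbb{F}_q$, the parabolic induction product is $(\bigodot_i \chi_i)(g) = \frac{1}{\#\mathcal{P}_\nu}\sum_{x \in \mathrm{GL}_N\mathbb{F}_q,\ xgx^{-1}\in\mathcal{P}_\nu} \prod_{i=1}^{\ell} \chi_i(\pi_i^\nu(xgx^{-1}))$. For $d \in \mathbb{N}$ let $\alpha_d : d\mathbb{Z} \to \mathbb{Z}$, $\alpha_d(m) = [m/d]_{q^d}$, and for a partition $\nu$ all of whose parts are divisible by $d$ and $\alpha: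 d\mathbb{Z}\to\mathbb{Z}$ set $B_\nu^\alpha = \bigodot_{i=1}^{\ell(\nu)} P_{\nu_i}^{\alpha(\nu_i)}$. Finally, for $f \in \mathcal{F}_d(q)$ and $\lambda \vdash n/d$, the primary irreducible character of $\mathrm{GL}_n\mathbb{F}_q$ is $\chi^{f\mapsto\lambda} = (-1)^{\frac{n}{d}(d-1)} \sum_{\nu \vdash n/d} \frac{1}{z_\nu}\chi^\lambda_\nu\, B^{\ell_f\alpha_d}_{d\nu}$. *)

theory Defs
  imports
    Complex_Main
    "HOL-Library.Function_Algebras"
    "HOL-Library.Multiset"
    "HOL-Library.Cardinality"
    "HOL-Combinatorics.Permutations"
    "HOL-Combinatorics.Orbits"
    "Jordan_Normal_Form.Char_Poly"
begin

subsection \<open>Partitions and blocks\<close>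

definition partitions :: "nat \<Rightarrow> nat list set" where
  "partitions n = {nu. sorted_wrt (\<ge>) nu \<and> (\<forall>k\<in>set nu. 0 < k) \<and> sum_list nu = n}"

definition z_part :: "nat list \<Rightarrow> nat" where
  "z_part nu = (\<Prod>i\<in>set nu. i ^ count_list nu i * fact (count_list nu i))"

definition qbracket :: "nat \<Rightarrow> nat \<Rightarrow> nat" where
  "qbracket q m = (\<Sum>i<m. q ^ i)"

text \<open>
  A list \<open>nu\<close> cuts \<open>{0..<sum_list nu}\<close> into consecutive blocks of sizes \<open>nu ! 0\<close>, \<open>nu ! 1\<close>, \<dots>.
  The same indexing serves block matrices and the standard numbering (row by row) of the
  cells of the Young diagram of \<open>nu\<close>.
\<close>

definition block_start :: "nat list \<Rightarrow> nat \<Rightarrow> nat" where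
  "block_start nu i = sum_list (take i nu)"

definition block_of :: "nat list \<Rightarrow> nat \<Rightarrow> nat" where
  "block_of nu k = (LEAST i. k < block_start nu (Suc i))"

definition offset_in_block :: "nat list \<Rightarrow> nat \<Rightarrow> nat" where
  "offset_in_block nu k = k - block_start nu (block_of nu k)"

subsection \<open>Irreducible characters of the symmetric groups\<close>

text \<open>
  The irreducible module indexed by \<open>lam\<close> is the left ideal of the group algebra of
  \<open>Sym {0..<N}\<close> over the complex numbers, \<open>N = sum_list lam\<close>, generated by the Young symmetrizer
  of the row-by-row tableau.  Elements of the group algebra are functions on permutations.
  In this convention a one-row partition indexes the trivial character and a one-column
  partition the sign character.
\<close>

definition cscale :: "complex \<Rightarrow> ('i \<Rightarrow> complex) \<Rightarrow> 'i \<Rightarrow> complex" where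
  "cscale c a = (\<lambda>x. c * a x)"

interpretation cfun: vector_space cscale
  by unfold_locales (auto simp: cscale_def fun_eq_iff algebra_simps)

text \<open>The trace of a linear map on an invariant finite-dimensional subspace \<open>V\<close>; it does not
  depend on the chosen basis.\<close>

definition trace_on :: "('i \<Rightarrow> complex) set \<Rightarrow> (('i \<Rightarrow> complex) \<Rightarrow> 'i \<Rightarrow> complex) \<Rightarrow> complex" where
  "trace_on V T =
    (let B = (SOME B. cfun.independent B \<and> cfun.span B = V)
     in \<Sum>b\<in>B. cfun.representation B (T b) b)"

definition row_group :: "nat list \<Rightarrow> (nat \<Rightarrow> nat) set" where
  "row_group lam = {p. p permutes {..<sum_list lam} \<and>
     (\<forall>k<sum_list lam. block_of lam (p k) = block_of lam k)}"

definition col_group :: "nat list \<Rightarrow> (nat \<Rightarrow> nat) set" where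
  "col_group lam = {p. p permutes {..<sum_list lam} \<and>
     (\<forall>k<sum_list lam. offset_in_block lam (p k) = offset_in_block lam k)}"

definition young_symmetrizer :: "nat list \<Rightarrow> (nat \<Rightarrow> nat) \<Rightarrow> complex" where
  "young_symmetrizer lam = (\<lambda>s. \<Sum>p\<in>row_group lam. \<Sum>r\<in>col_group lam.
     if s = p \<circ> r then of_int (sign r) else 0)"

definition left_translate ::
  "(nat \<Rightarrow> nat) \<Rightarrow> ((nat \<Rightarrow> nat) \<Rightarrow> complex) \<Rightarrow> (nat \<Rightarrow> nat) \<Rightarrow> complex" where
  "left_translate t a = (\<lambda>s. a (inv_into UNIV t \<circ> s))"

definition specht_module :: "nat list \<Rightarrow> ((nat \<Rightarrow> nat) \<Rightarrow> complex) set" where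
  "specht_module lam =
     cfun.span ((\<lambda>t. left_translate t (young_symmetrizer lam)) ` {t. t permutes {..<sum_list lam}})"

definition perm_cycle_type :: "nat \<Rightarrow> (nat \<Rightarrow> nat) \<Rightarrow> nat multiset" where
  "perm_cycle_type N s = image_mset card (mset_set (orbit s ` {..<N}))"

definition sym_char :: "nat list \<Rightarrow> nat list \<Rightarrow> complex" where
  "sym_char lam nu =
    (let s = (SOME s. s permutes {..<sum_list lam} \<and> perm_cycle_type (sum_list lam) s = mset nu)
     in trace_on (specht_module lam) (left_translate s))"

subsection \<open>General linear groups and parabolic induction\<close>

definition GL :: "nat \<Rightarrow> 'a::field mat set" where
  "GL n = Units (ring_mat TYPE('a) n ())"

definition conjugate_by :: "nat \<Rightarrow> 'a::field mat \<Rightarrow> 'a mat \<Rightarrow> 'a mat" where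
  "conjugate_by n x g = x * g * inv\<^bsub>ring_mat TYPE('a) n ()\<^esub> x"

definition parabolic :: "nat list \<Rightarrow> 'a::field mat set" where
  "parabolic nu = {g \<in> GL (sum_list nu).
     \<forall>r<sum_list nu. \<forall>c<sum_list nu. block_of nu c < block_of nu r \<longrightarrow> g $$ (r, c) = 0}"

definition diag_block :: "nat list \<Rightarrow> nat \<Rightarrow> 'a mat \<Rightarrow> 'a mat" where
  "diag_block nu i g =
     mat (nu ! i) (nu ! i) (\<lambda>(r, c). g $$ (block_start nu i + r, block_start nu i + c))"

definition parabolic_product ::
  "nat list \<Rightarrow> ('a::field mat \<Rightarrow> complex) list \<Rightarrow> 'a mat \<Rightarrow> complex" where
  "parabolic_product nu chis g =
     1 / of_nat (card (parabolic nu :: 'a mat set)) *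
     (\<Sum>x\<in>{x \<in> GL (sum_list nu). conjugate_by (sum_list nu) x g \<in> parabolic nu}.
        \<Prod>i<length nu. (chis ! i) (diag_block nu i (conjugate_by (sum_list nu) x g)))"

subsection \<open>Primary elements and regular semisimple elements\<close>

definition irr_polys :: "'a::field poly set" where
  "irr_polys = {h. irreducible h \<and> lead_coeff h = 1 \<and> h \<noteq> [:0, 1:]}"

text \<open>The module structure on column vectors over the polynomial ring in which the variable acts
  by \<open>g\<close>.\<close>

definition poly_act :: "nat \<Rightarrow> 'a::field mat \<Rightarrow> 'a poly \<Rightarrow> 'a vec \<Rightarrow> 'a vec" where
  "poly_act m g c v =
     finsum_vec TYPE('a) m (\<lambda>k. coeff c k \<cdot>\<^sub>v ((g ^\<^sub>m k) *\<^sub>v v)) {..degree c}"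

text \<open>The direct sum of the modules \<open>F[z] / (h ^ (rho ! i))\<close>, a residue class being represented by
  its remainder modulo \<open>h ^ (rho ! i)\<close>.\<close>

definition quot_sum :: "'a::field poly \<Rightarrow> nat list \<Rightarrow> 'a poly list set" where
  "quot_sum h rho = {ps. length ps = length rho \<and>
     (\<forall>i<length rho. ps ! i mod h ^ (rho ! i) = ps ! i)}"

definition quot_sum_act :: "'a::field poly \<Rightarrow> nat list \<Rightarrow> 'a poly \<Rightarrow> 'a poly list \<Rightarrow> 'a poly list" where
  "quot_sum_act h rho c ps = map2 (\<lambda>p r. (c * p) mod h ^ r) ps rho"

definition primary_with_index ::
  "nat \<Rightarrow> 'a::field mat \<Rightarrow> 'a poly \<Rightarrow> nat list \<Rightarrow> bool" where
  "primary_with_index m g h rho \<longleftrightarrow>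
     h \<in> irr_polys \<and> rho \<noteq> [] \<and> rho \<in> partitions (sum_list rho) \<and>
     (\<exists>phi. bij_betw phi (carrier_vec m) (quot_sum h rho) \<and>
        (\<forall>v\<in>carrier_vec m. \<forall>w\<in>carrier_vec m. phi (v + w) = map2 (+) (phi v) (phi w)) \<and>
        (\<forall>c. \<forall>v\<in>carrier_vec m. phi (poly_act m g c v) = quot_sum_act h rho c (phi v)))"

definition regular_semisimple :: "'a::field mat \<Rightarrow> bool" where
  "regular_semisimple g \<longleftrightarrow> (\<forall>h. irreducible h \<longrightarrow> \<not> h\<^sup>2 dvd char_poly g)"

definition has_cycle_type :: "'a::field mat \<Rightarrow> nat list \<Rightarrow> bool" where
  "has_cycle_type g mu \<longleftrightarrow> sorted_wrt (\<ge>) mu \<and>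
     (\<exists>hs. (\<forall>h\<in>set hs. irreducible h \<and> lead_coeff h = 1) \<and>
           prod_list hs = char_poly g \<and> map degree hs = mu)"

definition reg_semisimple_of_type :: "nat \<Rightarrow> nat list \<Rightarrow> 'a::field mat set" where
  "reg_semisimple_of_type n mu = {g \<in> GL n. regular_semisimple g \<and> has_cycle_type g mu}"

subsection \<open>Green's primary characters\<close>

text \<open>
  Throughout, \<open>'a\<close> is the field with \<open>q\<close> elements and \<open>'b\<close> the extension field with
  \<open>q ^ (n!)\<close> elements.  The subfield with \<open>q ^ d\<close> elements, for \<open>d\<close> dividing \<open>n!\<close>, is the fixed
  field of the \<open>d\<close>-th power of the Frobenius map.
\<close>

definition eps_sub :: "nat \<Rightarrow> 'b::{field,finite} \<Rightarrow> nat \<Rightarrow> 'b" where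
  "eps_sub q eps d = eps ^ ((CARD('b) - 1) div (q ^ d - 1))"

definition subfield_of_order_pow :: "nat \<Rightarrow> nat \<Rightarrow> 'b::{field,finite} set" where
  "subfield_of_order_pow q d = {x. x ^ (q ^ d) = x}"

definition kappa :: "nat list \<Rightarrow> int \<Rightarrow> int" where
  "kappa rho t = (\<Prod>i\<in>{1..<length rho}. 1 - t ^ i)"

text \<open>The index of a primary element is unique, so the choice in the next definition is
  immaterial.\<close>

definition primary_P ::
  "('b::{field,finite} \<Rightarrow> complex) \<Rightarrow> 'b \<Rightarrow> ('a::{field,finite} poly \<Rightarrow> int)
    \<Rightarrow> int \<Rightarrow> nat \<Rightarrow> 'a mat \<Rightarrow> complex" where
  "primary_P theta eps ell b m g =
     (if \<exists>h rho. primary_with_index m g h rho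
      then let (h, rho) = (SOME (h, rho). primary_with_index m g h rho); q = CARD('a) in
        of_int (kappa rho (int q ^ degree h)) *
        (\<Sum>i=1..degree h. theta (eps_sub q eps (degree h) powi ell h) powi (int q ^ i * b))
      else 0)"

definition basic_B ::
  "('b::{field,finite} \<Rightarrow> complex) \<Rightarrow> 'b \<Rightarrow> ('a::{field,finite} poly \<Rightarrow> int)
    \<Rightarrow> (nat \<Rightarrow> int) \<Rightarrow> nat list \<Rightarrow> 'a mat \<Rightarrow> complex" where
  "basic_B theta eps ell alpha nu =
     parabolic_product nu (map (\<lambda>k. primary_P theta eps ell (alpha k) k) nu)"

definition primary_char ::
  "('b::{field,finite} \<Rightarrow> complex) \<Rightarrow> 'b \<Rightarrow> ('a::{field,finite} poly \<Rightarrow> int)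
    \<Rightarrow> nat \<Rightarrow> 'a poly \<Rightarrow> nat list \<Rightarrow> 'a mat \<Rightarrow> complex" where
  "primary_char theta eps ell n f lam g =
    (let d = degree f in
      (- 1) ^ (n div d * (d - 1)) *
      (\<Sum>nu\<in>partitions (n div d). 1 / of_nat (z_part nu) * sym_char lam nu *
         basic_B theta eps ell (\<lambda>m. ell f * int (qbracket (CARD('a) ^ d) (m div d)))
           (map ((*) d) nu) g))"

end

theory Submission
  imports Defs "HOL-Algebra.Sylow"
begin

text \<open>
  Only the summand of the defining sum with \<open>d\<nu> = \<mu>\<close> survives.  If \<open>x g x\<inverse>\<close> is block upper triangular with
  blocks of sizes \<open>\<nu>\<^sub>i\<close>, the characteristic polynomials of its diagonal blocks multiply to the squarefree
  characteristic polynomial of \<open>g\<close>.  A block with squarefree characteristic polynomial is primary iff this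
  polynomial is irreducible, so a nonzero term forces the blocks to carry the polynomials \<open>h\<^sub>1, h\<^sub>2, \<dots>\<close>
  in some order \<open>\<sigma>\<close> with matching degrees.  For each such order the elements \<open>x\<close> form one coset of the
  parabolic subgroup: such an \<open>x\<close> exists since matrices with the same squarefree characteristic polynomial are
  similar, and a matrix intertwining two block triangular matrices with the same pairwise coprime
  diagonal characteristic polynomials is itself block triangular.  Hence the basic character is a product of
  primary values times the number \<open>\<Prod>\<^sub>i m\<^sub>i(\<nu>)!\<close> of orders, which turns \<open>1 / z\<^sub>\<nu>\<close> into \<open>\<Prod>\<^sub>i 1 / \<nu>\<^sub>i\<close>; the
  primary value is the sum over the roots because these form a single Frobenius orbit.
\<close>

subsection \<open>The polynomial ring acting on column vectors\<close>

text \<open>Similarity, \<open>primary_with_index\<close> and the rigidity of the block shape are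
  statements about the \<open>F[z]\<close>-module of a matrix, whereas only its characteristic
  polynomial is known. The bridge is that every irreducible factor \<open>h\<close> of the
  characteristic polynomial of \<open>A\<close> has a nonzero vector killed by \<open>h(A)\<close>.
  This is obtained over the ground field, from the characteristic matrix \<open>z I - A\<close>; the
  sum of such vectors for distinct factors is a cyclic vector, and a cyclic vector determines the
  matrix up to similarity. Squarefreeness is recorded throughout as
  \<open>char_poly A = \<Prod>H\<close> with a finite set \<open>H\<close> of monic irreducible
  polynomials, a form that passes to diagonal blocks by divisibility. The extension field enters
  only when a primary value is rewritten as a sum over roots. The polynomial \<open>z\<close> cannot
  be a factor because \<open>g\<close> is invertible; hence all roots are nonzero, which is what
  allows \<open>theta\<close> to turn Frobenius powers into powers. The value
  \<open>sym_char\<close> is carried along as a coefficient.\<close>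

lemma poly_act_closed [simp]:
  assumes "g \<in> carrier_mat m m" "v \<in> carrier_vec m"
  shows "poly_act m g c v \<in> carrier_vec m"
  unfolding poly_act_def using assms
  by (intro finsum_vec_closed) (auto intro!: smult_carrier_vec[THEN iffD2] mult_mat_vec_carrier pow_carrier_mat)

text \<open>The bound \<open>N\<close> may exceed the degree, so that several polynomials can be
  compared over one summation range.\<close>

lemma index_poly_act:
  assumes g: "g \<in> carrier_mat m m" "v \<in> carrier_vec m" and "i < m" "degree c \<le> N"
  shows "poly_act m g c v $ i = (\<Sum>k\<le>N. coeff c k * ((g ^\<^sub>m k *\<^sub>v v) $ i))"
proof -
  have cl: "g ^\<^sub>m k *\<^sub>v v \<in> carrier_vec m" for k
    using g by (auto intro!: mult_mat_vec_carrier pow_carrier_mat)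
  have "poly_act m g c v $ i = (\<Sum>k\<le>degree c. (coeff c k \<cdot>\<^sub>v (g ^\<^sub>m k *\<^sub>v v)) $ i)"
    unfolding poly_act_def
    by (rule index_finsum_vec) (use cl \<open>i < m\<close> in auto)
  also have "\<dots> = (\<Sum>k\<le>degree c. coeff c k * ((g ^\<^sub>m k *\<^sub>v v) $ i))"
    using cl \<open>i < m\<close> by (intro sum.cong refl index_smult_vec) (metis carrier_vecD)
  also have "\<dots> = (\<Sum>k\<le>N. coeff c k * ((g ^\<^sub>m k *\<^sub>v v) $ i))"
    using \<open>degree c \<le> N\<close> by (intro sum.mono_neutral_left) (auto simp: coeff_eq_0)
  finally show ?thesis .
qed

lemma dim_poly_act [simp]:
  assumes "g \<in> carrier_mat m m" "v \<in> carrier_vec m"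
  shows "dim_vec (poly_act m g c v) = m"
  using poly_act_closed[OF assms] by (rule carrier_vecD)

lemma poly_act_0 [simp]:
  assumes "g \<in> carrier_mat m m" "v \<in> carrier_vec m"
  shows "poly_act m g 0 v = 0\<^sub>v m"
  by (rule eq_vecI) (use assms in \<open>auto simp: index_poly_act[where N=0]\<close>)

text \<open>Horner's rule with the factor \<open>g\<close> moved onto the vector. It replaces the
  finite sum of the definition by induction on the polynomial with the vector arbitrary.\<close>

lemma poly_act_pCons:
  assumes g: "g \<in> carrier_mat m m" "v \<in> carrier_vec m"
  shows "poly_act m g (pCons a c) v = a \<cdot>\<^sub>v v + poly_act m g c (g *\<^sub>v v)"
proof (rule eq_vecI)
  have gv: "g *\<^sub>v v \<in> carrier_vec m" using g by auto
  fix i assume "i < dim_vec (a \<cdot>\<^sub>v v + poly_act m g c (g *\<^sub>v v))"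
  then have i: "i < m" using g gv by auto
  have shift: "g ^\<^sub>m Suc k *\<^sub>v v = g ^\<^sub>m k *\<^sub>v (g *\<^sub>v v)" for k
    using g by (simp add: assoc_mult_mat_vec[of _ m m _ m] pow_carrier_mat)
  have "poly_act m g (pCons a c) v $ i =
      (\<Sum>k\<le>Suc (degree c). coeff (pCons a c) k * ((g ^\<^sub>m k *\<^sub>v v) $ i))"
    by (rule index_poly_act) (use g i degree_pCons_le in auto)
  also have "\<dots> = a * v $ i + (\<Sum>k\<le>degree c. coeff c k * ((g ^\<^sub>m k *\<^sub>v (g *\<^sub>v v)) $ i))"
    unfolding sum.atMost_Suc_shift coeff_pCons_Suc shift using g by simp
  also have "\<dots> = (a \<cdot>\<^sub>v v + poly_act m g c (g *\<^sub>v v)) $ i"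
    using g gv i by (simp add: index_poly_act[OF g(1) gv i order_refl])
  finally show "poly_act m g (pCons a c) v $ i = (a \<cdot>\<^sub>v v + poly_act m g c (g *\<^sub>v v)) $ i" .
qed (use g in auto)

lemma poly_act_add_vec:
  assumes g: "g \<in> carrier_mat m m" and vw: "v \<in> carrier_vec m" "w \<in> carrier_vec m"
  shows "poly_act m g c (v + w) = poly_act m g c v + poly_act m g c w"
  using vw
proof (induction c arbitrary: v w)
  case 0
  then show ?case using g by simp
next
  case (pCons a c)
  have "g *\<^sub>v v \<in> carrier_vec m" "g *\<^sub>v w \<in> carrier_vec m" using g pCons.prems by auto
  then show ?case using g pCons.prems
    by (intro eq_vecI) (auto simp: poly_act_pCons pCons.IH mult_add_distrib_mat_vec[of _ m m] algebra_simps)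
qed

lemma poly_act_smult_vec:
  assumes g: "g \<in> carrier_mat m m" and v: "v \<in> carrier_vec m"
  shows "poly_act m g c (a \<cdot>\<^sub>v v) = a \<cdot>\<^sub>v poly_act m g c v"
  using v
proof (induction c arbitrary: v)
  case 0
  then show ?case using g by (auto intro!: eq_vecI)
next
  case (pCons b c)
  have "g *\<^sub>v v \<in> carrier_vec m" using g pCons.prems by auto
  then show ?case using g pCons.prems
    by (intro eq_vecI) (auto simp: poly_act_pCons pCons.IH mult_mat_vec[of _ m m] algebra_simps)
qed

lemma poly_act_zero_vec [simp]:
  assumes g: "g \<in> carrier_mat m m"
  shows "poly_act m g c (0\<^sub>v m) = 0\<^sub>v m"
proof -
  have "poly_act m g c (0 \<cdot>\<^sub>v 0\<^sub>v m) = 0 \<cdot>\<^sub>v poly_act m g c (0\<^sub>v m)"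
    by (rule poly_act_smult_vec) (use g in auto)
  moreover have "0 \<cdot>\<^sub>v 0\<^sub>v m = (0\<^sub>v m :: 'a vec)" by auto
  moreover have "0 \<cdot>\<^sub>v poly_act m g c (0\<^sub>v m) = 0\<^sub>v m" using g by (intro eq_vecI) auto
  ultimately show ?thesis by simp
qed

lemma poly_act_mult_mat_vec:
  assumes g: "g \<in> carrier_mat m m" "v \<in> carrier_vec m"
  shows "poly_act m g c (g *\<^sub>v v) = g *\<^sub>v poly_act m g c v"
  using g(2)
proof (induction c arbitrary: v)
  case 0
  then show ?case using g by (auto intro!: eq_vecI)
next
  case (pCons b c)
  have "g *\<^sub>v v \<in> carrier_vec m" using g pCons.prems by auto
  then show ?case using g pCons.prems
    by (simp add: poly_act_pCons pCons.IH mult_add_distrib_mat_vec[of _ m m] mult_mat_vec[of _ m m])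
qed

lemma poly_act_add:
  assumes g: "g \<in> carrier_mat m m" "v \<in> carrier_vec m"
  shows "poly_act m g (c + d) v = poly_act m g c v + poly_act m g d v"
proof (rule eq_vecI)
  let ?N = "max (degree c) (degree d)"
  fix i assume "i < dim_vec (poly_act m g c v + poly_act m g d v)"
  then have i: "i < m" using g by auto
  show "poly_act m g (c + d) v $ i = (poly_act m g c v + poly_act m g d v) $ i"
    using g i
    by (simp add: index_poly_act[OF g i, where N = ?N] degree_add_le sum.distrib algebra_simps)
qed (use g in auto)

lemma poly_act_smult:
  assumes g: "g \<in> carrier_mat m m" "v \<in> carrier_vec m"
  shows "poly_act m g (Polynomial.smult a c) v = a \<cdot>\<^sub>v poly_act m g c v"
proof (rule eq_vecI)
  fix i assume "i < dim_vec (a \<cdot>\<^sub>v poly_act m g c v)"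
  then have i: "i < m" using g by auto
  show "poly_act m g (Polynomial.smult a c) v $ i = (a \<cdot>\<^sub>v poly_act m g c v) $ i"
    using g i
    by (simp add: index_poly_act[OF g i, where N = "degree c"] degree_smult_le sum_distrib_left algebra_simps)
qed (use g in auto)

lemma poly_act_mult:
  assumes g: "g \<in> carrier_mat m m" "v \<in> carrier_vec m"
  shows "poly_act m g (c * d) v = poly_act m g c (poly_act m g d v)"
proof (induction c)
  case 0
  then show ?case using g by simp
next
  case (pCons a c)
  have "poly_act m g (pCons a c * d) v = a \<cdot>\<^sub>v poly_act m g d v + (0 \<cdot>\<^sub>v v + poly_act m g (c * d) (g *\<^sub>v v))"
    using g by (simp add: poly_act_add poly_act_smult poly_act_pCons)
  also have "0 \<cdot>\<^sub>v v + poly_act m g (c * d) (g *\<^sub>v v) = poly_act m g c (g *\<^sub>v poly_act m g d v)"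
    using g by (intro eq_vecI) (auto simp: poly_act_mult_mat_vec pCons.IH)
  finally show ?case using g by (simp add: poly_act_pCons)
qed

lemma poly_act_1 [simp]:
  assumes g: "g \<in> carrier_mat m m" "v \<in> carrier_vec m"
  shows "poly_act m g 1 v = v"
  unfolding one_pCons using g by (subst poly_act_pCons) auto

lemma poly_act_mult_eq_zero:
  assumes g: "g \<in> carrier_mat m m" "v \<in> carrier_vec m"
    and "poly_act m g c v = 0\<^sub>v m \<or> poly_act m g d v = 0\<^sub>v m"
  shows "poly_act m g (c * d) v = 0\<^sub>v m"
  using assms poly_act_mult[OF g, of c d] poly_act_mult[OF g, of d c] by (auto simp: mult.commute)

text \<open>Euclid's algorithm. The combination is only required to divide both arguments, so no
  normalised gcd is involved.\<close>

lemma bezout_poly: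
  fixes c d :: "'a::field poly"
  shows "\<exists>x y. x * c + y * d dvd c \<and> x * c + y * d dvd d"
\<comment> \<open>Zero ranks strictly below the nonzero constants: a remainder modulo a nonzero
  constant is zero, although its degree does not drop.\<close>
proof (induction "if d = 0 then 0 else Suc (degree d)" arbitrary: c d rule: less_induct)
  case less
  show ?case
  proof (cases "d = 0")
    case True
    then show ?thesis by (intro exI[of _ 1] exI[of _ 0]) simp
  next
    case False
    let ?r = "c mod d"
    have "(if ?r = 0 then 0 else Suc (degree ?r)) < (if d = 0 then 0 else Suc (degree d))"
      using False degree_mod_less[of d c] by auto
    from less[OF this] obtain x y where xy: "x * d + y * ?r dvd d" "x * d + y * ?r dvd ?r"
      by blast
    have eq: "x * d + y * ?r = y * c + (x - y * (c div d)) * d"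
      using div_mult_mod_eq[of c d] by (simp add: algebra_simps flip: minus_div_mult_eq_mod)
    have "x * d + y * ?r dvd c"
      using xy div_mult_mod_eq[of c d] by (metis dvd_add dvd_mult)
    with xy show ?thesis unfolding eq by blast
  qed
qed

section \<open>The characteristic matrix \<open>z I - A\<close>: Cayley-Hamilton and kernels of
  factors\<close>

definition poly_mat :: "nat \<Rightarrow> 'a::field mat \<Rightarrow> 'a poly \<Rightarrow> 'a mat" where
  "poly_mat m g c = mat m m (\<lambda>(i, j). \<Sum>k\<le>degree c. coeff c k * (g ^\<^sub>m k) $$ (i, j))"

lemma poly_mat_closed [simp]: "poly_mat m g c \<in> carrier_mat m m"
  by (simp add: poly_mat_def)

lemma poly_mat_mult_vec:
  assumes g: "g \<in> carrier_mat m m" "v \<in> carrier_vec m"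
  shows "poly_mat m g c *\<^sub>v v = poly_act m g c v"
proof (rule eq_vecI)
  fix i assume "i < dim_vec (poly_act m g c v)"
  then have i: "i < m" using g by simp
  have "(poly_mat m g c *\<^sub>v v) $ i
      = (\<Sum>j = 0..<m. (\<Sum>k\<le>degree c. coeff c k * (g ^\<^sub>m k) $$ (i, j)) * v $ j)"
    using g i by (simp add: poly_mat_def scalar_prod_def)
  also have "\<dots> = (\<Sum>k\<le>degree c. coeff c k * (\<Sum>j = 0..<m. (g ^\<^sub>m k) $$ (i, j) * v $ j))"
    by (simp add: sum_distrib_right sum_distrib_left mult.assoc) (rule sum.swap)
  also have "\<dots> = (\<Sum>k\<le>degree c. coeff c k * (g ^\<^sub>m k *\<^sub>v v) $ i)"
    using g i by (simp add: scalar_prod_def)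
  also have "\<dots> = poly_act m g c v $ i" using g i by (simp add: index_poly_act[OF g i order_refl])
  finally show "(poly_mat m g c *\<^sub>v v) $ i = poly_act m g c v $ i" .
qed (use g in \<open>simp add: poly_mat_def\<close>)

lemma eq_mat_by_mult_vec:
  fixes A B :: "'a::comm_ring_1 mat"
  assumes "A \<in> carrier_mat m n" "B \<in> carrier_mat m n"
    and "\<And>v. v \<in> carrier_vec n \<Longrightarrow> A *\<^sub>v v = B *\<^sub>v v"
  shows "A = B"
proof (rule eq_matI)
  fix i j assume "i < dim_row B" "j < dim_col B"
  then have ij: "i < m" "j < n" using assms by auto
  have "(M *\<^sub>v unit_vec n j) $ i = M $$ (i, j)" if "M \<in> carrier_mat m n" for M :: "'a mat"
    using that ij by (simp add: scalar_prod_right_unit)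
  from this[OF assms(1)] this[OF assms(2)] show "A $$ (i, j) = B $$ (i, j)"
    using assms(3)[of "unit_vec n j"] by simp
qed (use assms in auto)

lemma poly_mat_0: "g \<in> carrier_mat m m \<Longrightarrow> poly_mat m g 0 = 0\<^sub>m m m"
  by (rule eq_mat_by_mult_vec[of _ m m]) (auto simp: poly_mat_mult_vec)

lemma poly_mat_pCons:
  assumes g: "g \<in> carrier_mat m m"
  shows "poly_mat m g (pCons a c) = a \<cdot>\<^sub>m 1\<^sub>m m + g * poly_mat m g c"
proof (rule eq_mat_by_mult_vec[of _ m m])
  fix v :: "'a vec" assume v: "v \<in> carrier_vec m"
  have "(a \<cdot>\<^sub>m 1\<^sub>m m) *\<^sub>v v = a \<cdot>\<^sub>v v"
    using v by (intro eq_vecI) (simp_all add: row_smult smult_scalar_prod_distrib[OF unit_vec_carrier v])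
  then have "(a \<cdot>\<^sub>m 1\<^sub>m m + g * poly_mat m g c) *\<^sub>v v = a \<cdot>\<^sub>v v + g *\<^sub>v (poly_mat m g c *\<^sub>v v)"
    using g v by (simp add: add_mult_distrib_mat_vec[of _ m m] assoc_mult_mat_vec[of _ m m _ m])
  then show "poly_mat m g (pCons a c) *\<^sub>v v = (a \<cdot>\<^sub>m 1\<^sub>m m + g * poly_mat m g c) *\<^sub>v v"
    using g v by (simp add: poly_mat_mult_vec poly_act_pCons poly_act_mult_mat_vec)
qed (use g in auto)

abbreviation const_mat :: "'a::field mat \<Rightarrow> 'a poly mat" where
  "const_mat A \<equiv> map_mat (\<lambda>a. [:a:]) A"

text \<open>The noncommutative remainder theorem: \<open>z I - A\<close> is a left factor of
  \<open>p I - p(A)\<close>. Horner's rule supplies the quotient: if \<open>Q\<close> works for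
  \<open>p\<close>, then \<open>z Q + p(A)\<close> works for \<open>a + z p\<close>.\<close>

lemma char_poly_matrix_dvd:
  assumes A: "A \<in> carrier_mat m m"
  shows "\<exists>Q\<in>carrier_mat m m. p \<cdot>\<^sub>m 1\<^sub>m m - const_mat (poly_mat m A p) = char_poly_matrix A * Q"
proof (induction p)
  case 0
  have "0 \<cdot>\<^sub>m 1\<^sub>m m - const_mat (poly_mat m A 0) = char_poly_matrix A * 0\<^sub>m m m"
    using A by (auto simp: poly_mat_0 right_mult_zero_mat[of _ m m])
  then show ?case by (intro bexI) auto
next
  case (pCons a p)
  then obtain Q where Q: "Q \<in> carrier_mat m m"
    and eq: "p \<cdot>\<^sub>m 1\<^sub>m m - const_mat (poly_mat m A p) = char_poly_matrix A * Q" by blast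
  let ?P = "const_mat (poly_mat m A p)" and ?z = "[:0, 1:]" and ?X = "char_poly_matrix A"
  have P: "?P \<in> carrier_mat m m" and X: "?X \<in> carrier_mat m m" using A by auto
  have AP: "const_mat (A * poly_mat m A p) = const_mat A * ?P"
    using map_poly_mult(1)[OF A, of "poly_mat m A p" m] by simp
  have X_eq: "?X = ?z \<cdot>\<^sub>m 1\<^sub>m m - const_mat A"
    using A by (auto simp: char_poly_matrix_def intro!: eq_matI)
  have "?X * (?z \<cdot>\<^sub>m Q + ?P) = ?z \<cdot>\<^sub>m (?X * Q) + ?X * ?P"
    using mult_add_distrib_mat[OF X _ P, of "?z \<cdot>\<^sub>m Q"] mult_smult_distrib[OF X Q, of ?z] Q by simp
  also have "\<dots> = ?z \<cdot>\<^sub>m (p \<cdot>\<^sub>m 1\<^sub>m m - ?P) + (?z \<cdot>\<^sub>m 1\<^sub>m m - const_mat A) * ?P"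
    unfolding eq[symmetric] X_eq[symmetric] ..
  also have "(?z \<cdot>\<^sub>m 1\<^sub>m m - const_mat A) * ?P = ?z \<cdot>\<^sub>m ?P - const_mat (A * poly_mat m A p)"
    using A P unfolding AP
    by (simp add: minus_mult_distrib_mat[OF _ _ P, of "?z \<cdot>\<^sub>m 1\<^sub>m m" m] mult_smult_assoc_mat[OF one_carrier_mat P] left_mult_one_mat[OF P])
  also have "?z \<cdot>\<^sub>m (p \<cdot>\<^sub>m 1\<^sub>m m - ?P) + (?z \<cdot>\<^sub>m ?P - const_mat (A * poly_mat m A p))
      = pCons a p \<cdot>\<^sub>m 1\<^sub>m m - const_mat (poly_mat m A (pCons a p))"
  proof (rule eq_matI)
    fix i j assume "i < dim_row (pCons a p \<cdot>\<^sub>m 1\<^sub>m m - const_mat (poly_mat m A (pCons a p)))"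
      "j < dim_col (pCons a p \<cdot>\<^sub>m 1\<^sub>m m - const_mat (poly_mat m A (pCons a p)))"
    then have ij: "i < m" "j < m" by (auto simp: carrier_matD[OF poly_mat_closed])
    define b where "b = (A * poly_mat m A p) $$ (i, j)"
    define x where "x = poly_mat m A p $$ (i, j)"
    have [simp]: "poly_mat m A (pCons a p) $$ (i, j) = a * (if i = j then 1 else 0) + b"
      using A ij by (simp add: poly_mat_pCons b_def carrier_matD[OF poly_mat_closed])
    have "?z * (p * (if i = j then 1 else 0) - [:x:]) + (?z * [:x:] - [:b:]) =
        pCons a p * (if i = j then 1 else 0) - [:a * (if i = j then 1 else 0) + b:]"
      by (cases "i = j") (simp_all add: right_diff_distrib)
    then show "(?z \<cdot>\<^sub>m (p \<cdot>\<^sub>m 1\<^sub>m m - ?P) + (?z \<cdot>\<^sub>m ?P - const_mat (A * poly_mat m A p))) $$ (i, j)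
        = (pCons a p \<cdot>\<^sub>m 1\<^sub>m m - const_mat (poly_mat m A (pCons a p))) $$ (i, j)"
      using A ij by (simp add: carrier_matD[OF poly_mat_closed] flip: b_def x_def)
  qed (use A in \<open>auto simp: carrier_matD[OF poly_mat_closed]\<close>)
  finally show ?case
    by (intro bexI[of _ "?z \<cdot>\<^sub>m Q + ?P"]) (use Q P in auto)
qed

text \<open>Multiplication by \<open>z I - A\<close> raises the highest degree among the entries of
  a nonzero matrix by one, so the product cannot be constant.\<close>

lemma char_poly_matrix_mult_const_imp_zero:
  assumes A: "A \<in> carrier_mat m m" and R: "R \<in> carrier_mat m m" and B: "B \<in> carrier_mat m m"
    and eq: "char_poly_matrix A * R = const_mat B"
  shows "R = 0\<^sub>m m m"
proof (rule ccontr)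
  assume "R \<noteq> 0\<^sub>m m m"
  define S where "S = {(i, j). i < m \<and> j < m \<and> R $$ (i, j) \<noteq> 0}"
  have fin: "finite S" by (rule finite_subset[of _ "{..<m} \<times> {..<m}"]) (auto simp: S_def)
  have "S \<noteq> {}" using \<open>R \<noteq> 0\<^sub>m m m\<close> R by (auto simp: S_def intro!: eq_matI)
  then have "Max ((\<lambda>x. degree (R $$ x)) ` S) \<in> (\<lambda>x. degree (R $$ x)) ` S"
    using fin by (intro Max_in) auto
  then obtain i j where ij: "(i, j) \<in> S" and "Max ((\<lambda>x. degree (R $$ x)) ` S) = degree (R $$ (i, j))"
    by auto
  then have max: "degree (R $$ x) \<le> degree (R $$ (i, j))" if "x \<in> S" for x
    using Max_ge[of "(\<lambda>x. degree (R $$ x)) ` S" "degree (R $$ x)"] that fin by simp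
  let ?d = "degree (R $$ (i, j))"
  have i: "i < m" and j: "j < m" and nz: "R $$ (i, j) \<noteq> 0" using ij by (auto simp: S_def)
  have deg: "degree (R $$ (k, j)) \<le> ?d" if "k < m" for k
    using max[of "(k, j)"] that j by (cases "R $$ (k, j) = 0") (auto simp: S_def)
  have "char_poly_matrix A * R = [:0, 1:] \<cdot>\<^sub>m R - const_mat A * R"
  proof -
    have "char_poly_matrix A = [:0, 1:] \<cdot>\<^sub>m 1\<^sub>m m - const_mat A"
      using A by (auto simp: char_poly_matrix_def intro!: eq_matI)
    then show ?thesis using A R
      by (simp add: minus_mult_distrib_mat[OF _ _ R, of "[:0, 1:] \<cdot>\<^sub>m 1\<^sub>m m" m] mult_smult_assoc_mat[OF one_carrier_mat R])
  qed
  then have "[:B $$ (i, j):] = [:0, 1:] * R $$ (i, j) - (\<Sum>k = 0..<m. [:A $$ (i, k):] * R $$ (k, j))"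
    using eq A R B i j by (auto simp: scalar_prod_def dest!: arg_cong[where f="\<lambda>M. M $$ (i, j)"])
  \<comment> \<open>In degree \<open>Suc ?d\<close> the left side has no coefficient, and the
    entries multiplied by constants stop at degree \<open>?d\<close> by maximality; only the shifted
    leading coefficient is left.\<close>
  then have "coeff [:B $$ (i, j):] (Suc ?d)
      = coeff (R $$ (i, j)) ?d - (\<Sum>k = 0..<m. A $$ (i, k) * coeff (R $$ (k, j)) (Suc ?d))"
    by (simp add: coeff_sum)
  also have "(\<Sum>k = 0..<m. A $$ (i, k) * coeff (R $$ (k, j)) (Suc ?d)) = 0"
    by (rule sum.neutral) (use deg in \<open>auto simp: coeff_eq_0 le_imp_less_Suc\<close>)
  finally show False using nz by simp
qed

text \<open>With \<open>X = z I - A\<close>, the adjugate gives \<open>X adj = chi I\<close>, while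
  the remainder theorem gives \<open>X Q = chi I - chi(A)\<close>. The difference is a multiple of
  \<open>X\<close> that is constant, so \<open>adj = Q\<close> and
  \<open>chi(A) = 0\<close>.\<close>

lemma cayley_hamilton:
  fixes A :: "'a::field mat"
  assumes A: "A \<in> carrier_mat m m" "v \<in> carrier_vec m"
  shows "poly_act m A (char_poly A) v = 0\<^sub>v m"
proof -
  let ?X = "char_poly_matrix A" and ?p = "char_poly A"
  have X: "?X \<in> carrier_mat m m" using A by simp
  obtain Q where Q: "Q \<in> carrier_mat m m"
    and eq: "?p \<cdot>\<^sub>m 1\<^sub>m m - const_mat (poly_mat m A ?p) = ?X * Q"
    using char_poly_matrix_dvd[OF A(1)] by blast
  have adj: "?X * adj_mat ?X = ?p \<cdot>\<^sub>m 1\<^sub>m m" "adj_mat ?X \<in> carrier_mat m m"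
    using adj_mat[OF X] by (auto simp: char_poly_def)
  have eq2: "?X * (adj_mat ?X - Q) = const_mat (poly_mat m A ?p)"
  proof -
    have "?X * (adj_mat ?X - Q) = ?p \<cdot>\<^sub>m 1\<^sub>m m - (?p \<cdot>\<^sub>m 1\<^sub>m m - const_mat (poly_mat m A ?p))"
      using X Q adj by (simp add: mult_minus_distrib_mat[of _ m m] eq)
    also have "\<dots> = const_mat (poly_mat m A ?p)" by (intro eq_matI) auto
    finally show ?thesis .
  qed
  then have "adj_mat ?X - Q = 0\<^sub>m m m"
    by (rule char_poly_matrix_mult_const_imp_zero[OF A(1) minus_carrier_mat[OF Q] poly_mat_closed])
  then have z: "const_mat (poly_mat m A ?p) = 0\<^sub>m m m"
    using eq2 X by simp
  have "poly_mat m A ?p = 0\<^sub>m m m"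
  proof (rule eq_matI)
    fix i j assume "i < dim_row (0\<^sub>m m m :: 'a mat)" "j < dim_col (0\<^sub>m m m :: 'a mat)"
    then have ij: "i < m" "j < m" by auto
    have "const_mat (poly_mat m A ?p) $$ (i, j) = [:poly_mat m A ?p $$ (i, j):]"
      using ij by (simp add: carrier_matD[OF poly_mat_closed])
    then show "poly_mat m A ?p $$ (i, j) = 0\<^sub>m m m $$ (i, j)" using z ij by simp
  qed (auto simp: carrier_matD[OF poly_mat_closed])
  moreover have "0\<^sub>m m m *\<^sub>v v = 0\<^sub>v m" using A by (intro eq_vecI) auto
  ultimately show ?thesis using poly_mat_mult_vec[OF A, of ?p] by simp
qed

lemma dvd_prod_diff:
  fixes a b :: "'i \<Rightarrow> 'a::comm_ring_1"
  assumes "finite I" "\<And>i. i \<in> I \<Longrightarrow> p dvd a i - b i"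
  shows "p dvd prod a I - prod b I"
  using assms
proof (induction I rule: finite_induct)
  case (insert x I)
  have "prod a (insert x I) - prod b (insert x I) = a x * (prod a I - prod b I) + (a x - b x) * prod b I"
    using insert by (simp add: algebra_simps)
  then show ?case using insert by simp
qed simp

text \<open>The determinant is a polynomial in the entries, so congruence modulo \<open>p\<close>
  passes through it. It serves to compare \<open>p I - p(A)\<close> with
  \<open>- p(A)\<close>.\<close>

lemma dvd_det_diff:
  fixes X Y :: "'a::comm_ring_1 mat"
  assumes "X \<in> carrier_mat m m" "Y \<in> carrier_mat m m"
    and dvd: "\<And>i j. i < m \<Longrightarrow> j < m \<Longrightarrow> p dvd X $$ (i, j) - Y $$ (i, j)"
  shows "p dvd det X - det Y"
proof -
  have "det X - det Y = (\<Sum>s\<in>{s. s permutes {0..<m}}.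
      signof s * ((\<Prod>i = 0..<m. X $$ (i, s i)) - (\<Prod>i = 0..<m. Y $$ (i, s i))))"
    using assms by (simp add: det_def' sum_subtractf algebra_simps)
  also have "p dvd \<dots>"
    by (intro dvd_sum dvd_mult dvd_prod_diff dvd) (auto simp: permutes_nat_less)
  finally show ?thesis .
qed

text \<open>Take determinants in \<open>p I - p(A) = (z I - A) Q\<close> modulo \<open>p\<close>.
  The right side becomes a multiple of \<open>char_poly A\<close>, hence of \<open>p\<close>, so
  \<open>p\<close> divides the constant \<open>det (- p(A))\<close>. As \<open>p\<close> is not
  constant, this determinant is zero. No root of \<open>p\<close> has to be adjoined.\<close>

lemma poly_act_kernel_of_dvd_char_poly:
  fixes A :: "'a::field mat"
  assumes A: "A \<in> carrier_mat m m" and p: "p dvd char_poly A" "0 < degree p"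
  obtains v where "v \<in> carrier_vec m" "v \<noteq> 0\<^sub>v m" "poly_act m A p v = 0\<^sub>v m"
proof -
  interpret const: comm_ring_hom "\<lambda>a::'a. [:a:]"
    by unfold_locales (auto simp: one_pCons)
  let ?X = "char_poly_matrix A" and ?N = "- poly_mat m A p"
  obtain Q where Q: "Q \<in> carrier_mat m m"
    and eq: "p \<cdot>\<^sub>m 1\<^sub>m m - const_mat (poly_mat m A p) = ?X * Q"
    using char_poly_matrix_dvd[OF A] by blast
  have N: "?N \<in> carrier_mat m m" by simp
  have cancel: "x - [:a:] - [:- a:] = x" for x and a :: 'a
    by (rule poly_eqI) (simp add: coeff_pCons split: nat.split)
  have "p dvd det (?X * Q) - det (const_mat ?N)"
    unfolding eq[symmetric]
    by (rule dvd_det_diff[of _ m]) (auto simp: carrier_matD[OF poly_mat_closed] cancel)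
  moreover have "p dvd det (?X * Q)"
    using p A Q by (simp add: det_mult[of _ m] char_poly_def)
  ultimately have "p dvd det (?X * Q) - (det (?X * Q) - det (const_mat ?N))"
    by (rule dvd_diff[rotated])
  then have "p dvd [:det ?N:]"
    unfolding const.hom_det by (simp add: algebra_simps)
  then have "det ?N = 0" using p(2) dvd_imp_degree_le[of p "[:det ?N:]"]
    by (cases "det ?N = 0") simp_all
  then have "det (poly_mat m A p) = 0" using det_0_negate[of "poly_mat m A p" m] by simp
  then show ?thesis
    using that A by (auto simp: det_0_iff_vec_prod_zero_field[of _ m] poly_mat_mult_vec)
qed

subsection \<open>Irreducible polynomials and cyclic vectors\<close>

lemma irreducible_bezout:
  fixes h c :: "'a::field poly"
  assumes "irreducible h" "\<not> h dvd c"
  obtains x y where "x * h + y * c = 1"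
proof -
  obtain x y where xy: "x * h + y * c dvd h" "x * h + y * c dvd c" using bezout_poly by blast
  have "is_unit (x * h + y * c)"
  proof (rule ccontr)
    assume "\<not> is_unit (x * h + y * c)"
    then have "h dvd x * h + y * c" using irreducibleD'[OF assms(1) xy(1)] by blast
    then show False using xy(2) assms(2) dvd_trans by blast
  qed
  then obtain u where "1 = (x * h + y * c) * u" by (rule dvdE)
  then have "(u * x) * h + (u * y) * c = 1" by (simp add: algebra_simps)
  then show ?thesis by (rule that)
qed

lemma irreducible_dvd_mult:
  fixes h :: "'a::field poly"
  assumes "irreducible h" "h dvd a * b" "\<not> h dvd a"
  shows "h dvd b"
proof -
  obtain x y where "x * h + y * a = 1" using irreducible_bezout assms by blast
  then have "b = (x * h + y * a) * b" by simp
  also have "\<dots> = h * (x * b) + y * (a * b)" by (simp add: algebra_simps)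
  finally show ?thesis using assms(2) dvd_add[OF dvd_triv_left dvd_mult[OF assms(2), of y]] by metis
qed

lemma irreducible_poly_degree_pos:
  fixes h :: "'a::field poly"
  assumes "irreducible h"
  shows "0 < degree h"
  using assms is_unit_iff_degree[of h] by (auto simp: irreducible_def)

lemma irreducible_monic_dvd_eq:
  fixes h k :: "'a::field poly"
  assumes "irreducible h" "irreducible k" "lead_coeff h = 1" "lead_coeff k = 1" "h dvd k"
  shows "h = k"
proof -
  obtain u where u: "k = h * u" using assms by blast
  then have "is_unit u" using irreducibleD[OF assms(2) u] assms(1) irreducible_not_unit by blast
  then obtain c where "u = [:c:]" using is_unit_polyE by blast
  then show ?thesis using u assms by (auto simp: lead_coeff_mult)
qed

lemma irreducible_dvd_prod:
  fixes h :: "'a::field poly"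
  assumes "finite I" "irreducible h" "h dvd prod f I"
  obtains i where "i \<in> I" "h dvd f i"
  using assms(1,3)
proof (induction I arbitrary: thesis rule: finite_induct)
  case empty
  then have "is_unit h" by simp
  then show ?case using irreducible_not_unit[OF assms(2)] by blast
next
  case (insert i I)
  then have dvd: "h dvd f i * prod f I" by simp
  show ?case
  proof (cases "h dvd f i")
    case False
    then have "h dvd prod f I" using irreducible_dvd_mult[OF assms(2) dvd] by blast
    then obtain j where "j \<in> I" "h dvd f j" using insert.IH by blast
    then show ?thesis by (intro insert.prems(1)) auto
  qed (use insert.prems in auto)
qed

lemma irreducible_mult_dvd:
  fixes h :: "'a::field poly"
  assumes "irreducible h" "\<not> h dvd a" "h dvd c" "a dvd h * c"
  shows "h * a dvd c"
proof -
  obtain x y where xy: "x * h + y * a = 1" using irreducible_bezout assms by blast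
  \<comment> \<open>Used twice: for \<open>c\<close>, to extract \<open>a dvd c\<close> from
    \<open>a dvd h * c\<close>, and for the cofactor \<open>u\<close> with \<open>c = h * u\<close>,
    to extract \<open>a dvd u\<close>.\<close>
  have split: "b = x * (h * b) + a * (y * b)" for b
  proof -
    have "b = (x * h + y * a) * b" by (simp add: xy)
    then show ?thesis by (simp add: algebra_simps)
  qed
  obtain u where u: "c = h * u" using assms(3) by (rule dvdE)
  have "a dvd x * (h * c) + a * (y * c)" using assms(4) by (rule dvd_add[OF dvd_mult dvd_triv_left])
  then have "a dvd h * u" using split[of c] u by simp
  then have "a dvd x * (h * u) + a * (y * u)" by (rule dvd_add[OF dvd_mult dvd_triv_left])
  then show ?thesis using split[of u] u by simp
qed

text \<open>Otherwise Bezout writes 1 as a combination of \<open>h\<close> and \<open>c\<close>,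
  both of which annihilate \<open>v\<close>.\<close>

lemma poly_act_irreducible_dvd:
  fixes h :: "'a::field poly"
  assumes A: "A \<in> carrier_mat m m" "v \<in> carrier_vec m" and h: "irreducible h"
    and "poly_act m A h v = 0\<^sub>v m" "poly_act m A c v = 0\<^sub>v m" "v \<noteq> 0\<^sub>v m"
  shows "h dvd c"
proof (rule ccontr)
  assume "\<not> h dvd c"
  then obtain x y where xy: "x * h + y * c = 1" using irreducible_bezout h by blast
  have "v = poly_act m A (x * h + y * c) v" using A by (simp add: xy)
  also have "\<dots> = 0\<^sub>v m" using assms by (simp add: poly_act_add poly_act_mult)
  finally show False using assms by blast
qed

text \<open>Add one kernel vector for each factor: the annihilators of the summands are pairwise
  coprime, so that of the sum is their product.\<close>

lemma exists_vector_with_annihilator: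
  fixes A :: "'a::field mat"
  assumes A: "A \<in> carrier_mat m m" and "finite H"
    and H: "\<And>h. h \<in> H \<Longrightarrow> irreducible h \<and> lead_coeff h = 1 \<and> h dvd char_poly A"
  shows "\<exists>e\<in>carrier_vec m. poly_act m A (\<Prod>H) e = 0\<^sub>v m \<and>
    (\<forall>c. poly_act m A c e = 0\<^sub>v m \<longrightarrow> \<Prod>H dvd c)"
  using assms(2,3)
proof (induction H rule: finite_induct)
  case empty
  then show ?case using A by (intro bexI[of _ "0\<^sub>v m"]) auto
next
  case (insert h H)
  let ?P = "\<Prod>H"
  obtain e where e: "e \<in> carrier_vec m" "poly_act m A ?P e = 0\<^sub>v m"
    and e_min: "\<And>c. poly_act m A c e = 0\<^sub>v m \<Longrightarrow> ?P dvd c"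
    using insert.IH insert.prems by auto
  have h: "irreducible h" "lead_coeff h = 1" "h dvd char_poly A" using insert.prems by auto
  obtain v where v: "v \<in> carrier_vec m" "v \<noteq> 0\<^sub>v m" "poly_act m A h v = 0\<^sub>v m"
    using poly_act_kernel_of_dvd_char_poly[OF A h(3) irreducible_poly_degree_pos[OF h(1)]] .
  have ndvd: "\<not> h dvd ?P"
  proof
    assume "h dvd ?P"
    then obtain k where "k \<in> H" "h dvd k"
      using irreducible_dvd_prod insert.hyps(1) h(1) by blast
    then have "h = k" using irreducible_monic_dvd_eq[of h k] insert.prems by auto
    then show False using \<open>k \<in> H\<close> insert.hyps by blast
  qed
  have "poly_act m A (h * ?P) (e + v) = 0\<^sub>v m"
    using A e v poly_act_mult_eq_zero[OF A e(1), of h ?P] poly_act_mult_eq_zero[OF A v(1), of h ?P]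
    by (simp add: poly_act_add_vec)
  moreover have "h * ?P dvd c" if c: "poly_act m A c (e + v) = 0\<^sub>v m" for c
  proof (rule irreducible_mult_dvd[OF h(1) ndvd])
    \<comment> \<open>Multiplication by \<open>?P\<close> removes \<open>e\<close> and isolates
      \<open>v\<close>; multiplication by \<open>h\<close>, further down, removes \<open>v\<close>
      and isolates \<open>e\<close>.\<close>
    have "poly_act m A (?P * c) (e + v) = 0\<^sub>v m"
      using A e(1) v(1) c by (intro poly_act_mult_eq_zero) auto
    moreover have "poly_act m A (?P * c) e = 0\<^sub>v m"
      using A e by (intro poly_act_mult_eq_zero) auto
    ultimately have "poly_act m A (?P * c) v = 0\<^sub>v m"
      using A e v by (simp add: poly_act_add_vec)
    then have "h dvd ?P * c"
      using poly_act_irreducible_dvd A v h(1) by blast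
    then show "h dvd c" using irreducible_dvd_mult h(1) ndvd by blast
    have "poly_act m A (h * c) (e + v) = 0\<^sub>v m"
      using A e(1) v(1) c by (intro poly_act_mult_eq_zero) auto
    moreover have "poly_act m A (h * c) v = 0\<^sub>v m"
      using A v by (intro poly_act_mult_eq_zero) auto
    ultimately have "poly_act m A (h * c) e = 0\<^sub>v m"
      using A e v by (simp add: poly_act_add_vec)
    then show "?P dvd h * c" by (rule e_min)
  qed
  ultimately show ?case using insert.hyps e v by (intro bexI[of _ "e + v"]) auto
qed

section \<open>Cyclic vectors, Krylov matrices and the companion form\<close>

definition cyclic_vector :: "nat \<Rightarrow> 'a::field mat \<Rightarrow> 'a vec \<Rightarrow> bool" where
  "cyclic_vector m A e \<longleftrightarrow> e \<in> carrier_vec m \<and>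
     (\<forall>c. degree c < m \<longrightarrow> poly_act m A c e = 0\<^sub>v m \<longrightarrow> c = 0)"

text \<open>Some vector has only multiples of the characteristic polynomial as annihilators, and
  that polynomial has degree \<open>m\<close>.\<close>

lemma cyclic_vector_exists:
  fixes A :: "'a::field mat"
  assumes A: "A \<in> carrier_mat m m" and "finite H"
    and H: "\<And>h. h \<in> H \<Longrightarrow> irreducible h \<and> lead_coeff h = 1" and eq: "char_poly A = \<Prod>H"
  shows "\<exists>e. cyclic_vector m A e"
proof -
  have "h dvd char_poly A" if "h \<in> H" for h using dvd_prodI[OF assms(2) that, of "\<lambda>x. x"] by (simp add: eq)
  then obtain e where e: "e \<in> carrier_vec m" "\<And>c. poly_act m A c e = 0\<^sub>v m \<Longrightarrow> \<Prod>H dvd c"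
    using exists_vector_with_annihilator[OF A assms(2)] H by blast
  have "c = 0" if "degree c < m" "poly_act m A c e = 0\<^sub>v m" for c
    using dvd_imp_degree_le[OF e(2)[OF that(2)]] degree_monic_char_poly[OF A] that eq by auto
  with e show ?thesis unfolding cyclic_vector_def by blast
qed

text \<open>The columns are \<open>e, A e, ..., A^(m-1) e\<close>. Applied to a coefficient vector,
  the matrix evaluates the corresponding polynomial on \<open>e\<close>; inverting it solves for the
  polynomial.\<close>

definition krylov_mat :: "nat \<Rightarrow> 'a::field mat \<Rightarrow> 'a vec \<Rightarrow> 'a mat" where
  "krylov_mat m A e = mat m m (\<lambda>(i, j). (A ^\<^sub>m j *\<^sub>v e) $ i)"

lemma krylov_mat_closed [simp]: "krylov_mat m A e \<in> carrier_mat m m"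
  by (simp add: krylov_mat_def)

lemma coeff_Poly_list_of_vec: "coeff (Poly (list_of_vec v)) k = (if k < dim_vec v then v $ k else 0)"
  by (simp add: nth_default_def list_of_vec_index)

lemma degree_Poly_list_of_vec:
  assumes "v \<in> carrier_vec m" "0 < m"
  shows "degree (Poly (list_of_vec v)) < m"
  using assms by (intro degree_lessI) (auto simp: nth_default_def)

lemma krylov_mat_mult_vec:
  assumes A: "A \<in> carrier_mat m m" "e \<in> carrier_vec m" and v: "v \<in> carrier_vec m"
  shows "krylov_mat m A e *\<^sub>v v = poly_act m A (Poly (list_of_vec v)) e"
proof (rule eq_vecI)
  fix i assume "i < dim_vec (poly_act m A (Poly (list_of_vec v)) e)"
  then have i: "i < m" using A by simp
  have deg: "degree (Poly (list_of_vec v)) \<le> m - 1"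
    using degree_Poly_list_of_vec[OF v] i by simp
  have m: "{..m - 1} = {0..<m}" using i by auto
  show "(krylov_mat m A e *\<^sub>v v) $ i = poly_act m A (Poly (list_of_vec v)) e $ i"
    unfolding index_poly_act[OF A i deg] m
    using i v by (simp add: krylov_mat_def scalar_prod_def coeff_Poly_list_of_vec nth_default_def mult.commute)
qed (use A in \<open>auto simp: carrier_matD[OF krylov_mat_closed]\<close>)

lemma poly_act_diff_zero:
  assumes A: "A \<in> carrier_mat m m" "e \<in> carrier_vec m" and "poly_act m A c e = poly_act m A d e"
  shows "poly_act m A (c - d) e = 0\<^sub>v m"
proof -
  have "c - d = c + Polynomial.smult (- 1) d" by simp
  then have "poly_act m A (c - d) e = poly_act m A d e + - 1 \<cdot>\<^sub>v poly_act m A d e"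
    using A by (simp only: poly_act_add poly_act_smult assms(3))
  then show ?thesis using A by (intro eq_vecI) auto
qed

lemma krylov_mat_invertible:
  assumes A: "A \<in> carrier_mat m m" and e: "cyclic_vector m A e"
  obtains K where "K \<in> carrier_mat m m" "krylov_mat m A e * K = 1\<^sub>m m" "K * krylov_mat m A e = 1\<^sub>m m"
proof -
  have "v = 0\<^sub>v m" if v: "v \<in> carrier_vec m" "krylov_mat m A e *\<^sub>v v = 0\<^sub>v m" for v
  proof (cases "m = 0")
    case False
    with v e A have "Poly (list_of_vec v) = 0"
      using degree_Poly_list_of_vec[OF v(1)] by (auto simp: cyclic_vector_def krylov_mat_mult_vec)
    then have "v $ k = 0" if "k < m" for k
      using coeff_Poly_list_of_vec[of v k] that v(1) by simp
    then show ?thesis using v(1) by (intro eq_vecI) auto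
  qed (use v in auto)
  then have "det (krylov_mat m A e) \<noteq> 0"
    using det_0_iff_vec_prod_zero_field[OF krylov_mat_closed] by blast
  then have "krylov_mat m A e \<in> Units (ring_mat TYPE('a) m ())"
    by (rule det_non_zero_imp_unit[OF krylov_mat_closed])
  then show ?thesis using that by (auto simp: Units_def ring_mat_def)
qed

text \<open>This is the isomorphism of \<open>F[z]/(chi)\<close> with the column space, on
  remainders. Injectivity is cyclicity applied to a difference; surjectivity comes from the inverse
  Krylov matrix.\<close>

lemma cyclic_vector_bij_betw:
  assumes A: "A \<in> carrier_mat m m" and e: "cyclic_vector m A e" and "0 < m"
  shows "bij_betw (\<lambda>c. poly_act m A c e) {c. degree c < m} (carrier_vec m)"
proof -
  have ec: "e \<in> carrier_vec m" using e by (simp add: cyclic_vector_def)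
  have "inj_on (\<lambda>c. poly_act m A c e) {c. degree c < m}"
  proof (rule inj_onI)
    fix c d assume cd: "c \<in> {c. degree c < m}" "d \<in> {c. degree c < m}" "poly_act m A c e = poly_act m A d e"
    then have "poly_act m A (c - d) e = 0\<^sub>v m" using poly_act_diff_zero A ec by blast
    moreover have "degree (c - d) < m" using cd by (auto intro: degree_diff_less)
    ultimately show "c = d" using e by (auto simp: cyclic_vector_def)
  qed
  moreover have "v \<in> (\<lambda>c. poly_act m A c e) ` {c. degree c < m}" if v: "v \<in> carrier_vec m" for v
  proof -
    obtain K where K: "K \<in> carrier_mat m m" "krylov_mat m A e * K = 1\<^sub>m m"
      using krylov_mat_invertible[OF A e] by metis
    have Kv: "K *\<^sub>v v \<in> carrier_vec m" using K v by auto
    have "v = (krylov_mat m A e * K) *\<^sub>v v" using K v by simp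
    also have "\<dots> = krylov_mat m A e *\<^sub>v (K *\<^sub>v v)"
      using K(1) v by (rule assoc_mult_mat_vec[OF krylov_mat_closed])
    also have "\<dots> = poly_act m A (Poly (list_of_vec (K *\<^sub>v v))) e"
      using A ec Kv by (rule krylov_mat_mult_vec)
    finally show ?thesis using degree_Poly_list_of_vec[OF Kv assms(3)] by blast
  qed
  ultimately show ?thesis using A ec unfolding bij_betw_def by auto
qed

text \<open>For monic \<open>c\<close> of degree \<open>m\<close> this is multiplication by
  \<open>z\<close> on \<open>F[z]/(c)\<close> in the basis \<open>1, z, ..., z^(m-1)\<close>; the
  last column holds the reduction of \<open>z^m\<close>.\<close>

definition companion :: "nat \<Rightarrow> 'a::field poly \<Rightarrow> 'a mat" where
  "companion m c = mat m m (\<lambda>(i, j). if Suc j = m then - coeff c i else if i = Suc j then 1 else 0)"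

lemma companion_closed [simp]: "companion m c \<in> carrier_mat m m"
  by (simp add: companion_def)

lemma pow_mat_Suc_mult_vec:
  assumes A: "A \<in> carrier_mat m m" "e \<in> carrier_vec m"
  shows "A ^\<^sub>m Suc k *\<^sub>v e = A *\<^sub>v (A ^\<^sub>m k *\<^sub>v e)"
proof -
  have pow: "A ^\<^sub>m k \<in> carrier_mat m m" for k using A by (simp add: pow_carrier_mat)
  have "A ^\<^sub>m Suc k = A * A ^\<^sub>m k"
  proof (induction k)
    case (Suc k)
    have "A ^\<^sub>m Suc (Suc k) = (A * A ^\<^sub>m k) * A" using Suc by simp
    also have "\<dots> = A * A ^\<^sub>m Suc k" using assoc_mult_mat[OF A(1) pow A(1)] by simp
    finally show ?case .
  qed (use A in simp)
  then show ?thesis using assoc_mult_mat_vec[OF A(1) pow A(2)] by simp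
qed

lemma krylov_mat_companion:
  assumes A: "A \<in> carrier_mat m m" "e \<in> carrier_vec m"
    and c: "degree c = m" "lead_coeff c = 1" "poly_act m A c e = 0\<^sub>v m"
  shows "A * krylov_mat m A e = krylov_mat m A e * companion m c"
proof (rule eq_matI)
  let ?K = "krylov_mat m A e"
  fix i j assume "i < dim_row (?K * companion m c)" "j < dim_col (?K * companion m c)"
  then have i: "i < m" and j: "j < m"
    by (auto simp: carrier_matD[OF companion_closed] carrier_matD[OF krylov_mat_closed])
  have pow: "A ^\<^sub>m k \<in> carrier_mat m m" for k using A by (simp add: pow_carrier_mat)
  have "col ?K j = A ^\<^sub>m j *\<^sub>v e"
    by (rule eq_vecI) (use j pow[of j] in \<open>auto simp: krylov_mat_def\<close>)
  moreover have "A *\<^sub>v (A ^\<^sub>m j *\<^sub>v e) = A ^\<^sub>m Suc j *\<^sub>v e"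
    by (rule pow_mat_Suc_mult_vec[OF A, symmetric])
  moreover have "(A * ?K) $$ (i, j) = (A *\<^sub>v col ?K j) $ i"
    using A i j by (simp add: carrier_matD[OF krylov_mat_closed])
  ultimately have lhs: "(A * ?K) $$ (i, j) = (A ^\<^sub>m Suc j *\<^sub>v e) $ i" by simp
  have rhs: "(?K * companion m c) $$ (i, j) = (\<Sum>k = 0..<m. (A ^\<^sub>m k *\<^sub>v e) $ i * companion m c $$ (k, j))"
    using i j by (simp add: scalar_prod_def carrier_matD[OF companion_closed] carrier_matD[OF krylov_mat_closed])
      (simp add: krylov_mat_def)
  show "(A * ?K) $$ (i, j) = (?K * companion m c) $$ (i, j)"
  proof (cases "Suc j = m")
    case True
    \<comment> \<open>The last column of the product is \<open>A^m e\<close>; since \<open>c\<close>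
      is monic, \<open>c(A) e = 0\<close> rewrites it through the lower powers.\<close>
    have "0 = (\<Sum>k\<le>m. coeff c k * (A ^\<^sub>m k *\<^sub>v e) $ i)"
      using index_poly_act[OF A i, of c m] c i by simp
    also have "\<dots> = (\<Sum>k = 0..<m. coeff c k * (A ^\<^sub>m k *\<^sub>v e) $ i) + (A ^\<^sub>m m *\<^sub>v e) $ i"
      using c by (simp add: atLeast0LessThan flip: lessThan_Suc_atMost)
    finally have "(A ^\<^sub>m m *\<^sub>v e) $ i = - (\<Sum>k = 0..<m. coeff c k * (A ^\<^sub>m k *\<^sub>v e) $ i)"
      by (simp add: eq_neg_iff_add_eq_0 add.commute)
    then show ?thesis unfolding lhs rhs True using True
      by (simp add: companion_def sum_negf mult.commute)
  next
    case False
    have "(\<Sum>k = 0..<m. (A ^\<^sub>m k *\<^sub>v e) $ i * companion m c $$ (k, j))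
        = (\<Sum>k = 0..<m. if k = Suc j then (A ^\<^sub>m k *\<^sub>v e) $ i else 0)"
      by (rule sum.cong) (use False j in \<open>auto simp: companion_def\<close>)
    then show ?thesis unfolding lhs rhs using False j by simp
  qed
qed (use A in \<open>auto simp: carrier_matD[OF companion_closed] carrier_matD[OF krylov_mat_closed]\<close>)

lemma companion_pow_unit_vec:
  assumes "k < m"
  shows "companion m c ^\<^sub>m k *\<^sub>v unit_vec m 0 = unit_vec m k"
  using assms
proof (induction k)
  case 0
  then show ?case by (simp add: one_mult_mat_vec[of _ m] carrier_matD[OF companion_closed])
next
  case (Suc k)
  let ?C = "companion m c"
  have "?C ^\<^sub>m Suc k *\<^sub>v unit_vec m 0 = ?C *\<^sub>v (?C ^\<^sub>m k *\<^sub>v unit_vec m 0)"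
    by (rule pow_mat_Suc_mult_vec[OF companion_closed unit_vec_carrier])
  also have "\<dots> = ?C *\<^sub>v unit_vec m k" using Suc by simp
  also have "\<dots> = unit_vec m (Suc k)"
    by (rule eq_vecI) (use Suc.prems in \<open>auto simp: companion_def scalar_prod_right_unit\<close>)
  finally show ?case .
qed

text \<open>The first unit vector is cyclic, and it is annihilated by \<open>c\<close> as well as by
  the characteristic polynomial. Both are monic of degree \<open>m\<close>, so their difference has
  smaller degree and must vanish.\<close>

lemma char_poly_companion:
  assumes c: "degree c = m" "lead_coeff c = 1" and "0 < m"
  shows "char_poly (companion m c) = c"
proof -
  let ?C = "companion m c" and ?e = "unit_vec m 0"
  have C: "?C \<in> carrier_mat m m" by simp
  have cv: "cyclic_vector m ?C ?e"
    unfolding cyclic_vector_def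
  proof (intro conjI allI impI)
    fix p assume p: "degree p < m" "poly_act m ?C p ?e = 0\<^sub>v m"
    show "p = 0"
    proof (rule poly_eqI)
      fix i
      show "coeff p i = coeff 0 i"
      proof (cases "i < m")
        case True
        have "0 = (\<Sum>k\<le>m - 1. coeff p k * (?C ^\<^sub>m k *\<^sub>v ?e) $ i)"
          using index_poly_act[OF C unit_vec_carrier True, of p "m - 1" 0] p True by simp
        also have "\<dots> = (\<Sum>k\<le>m - 1. if k = i then coeff p k else 0)"
          by (rule sum.cong) (use True in \<open>auto simp: companion_pow_unit_vec\<close>)
        finally show ?thesis using True by (simp split: if_splits)
      qed (use p in \<open>simp add: coeff_eq_0\<close>)
    qed
  qed simp
  have "poly_act m ?C c ?e = 0\<^sub>v m"
  proof (rule eq_vecI)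
    fix i assume "i < dim_vec (0\<^sub>v m :: 'a vec)"
    then have i: "i < m" by simp
    have "?C ^\<^sub>m m *\<^sub>v ?e = ?C *\<^sub>v (?C ^\<^sub>m (m - 1) *\<^sub>v ?e)"
      using pow_mat_Suc_mult_vec[OF C unit_vec_carrier, of "m - 1" 0] \<open>0 < m\<close> by simp
    then have last: "(?C ^\<^sub>m m *\<^sub>v ?e) $ i = - coeff c i"
      using i by (simp add: companion_pow_unit_vec carrier_matD[OF companion_closed] scalar_prod_right_unit)
        (simp add: companion_def)
    have "poly_act m ?C c ?e $ i = (\<Sum>k\<le>m. coeff c k * (?C ^\<^sub>m k *\<^sub>v ?e) $ i)"
      using index_poly_act[OF C unit_vec_carrier i, of c m] c by simp
    also have "\<dots> = (\<Sum>k<m. coeff c k * (?C ^\<^sub>m k *\<^sub>v ?e) $ i) + (?C ^\<^sub>m m *\<^sub>v ?e) $ i"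
      using c by (simp flip: lessThan_Suc_atMost)
    also have "(\<Sum>k<m. coeff c k * (?C ^\<^sub>m k *\<^sub>v ?e) $ i) = (\<Sum>k<m. if k = i then coeff c k else 0)"
      by (rule sum.cong) (use i in \<open>auto simp: companion_pow_unit_vec\<close>)
    finally show "poly_act m ?C c ?e $ i = 0\<^sub>v m $ i" using i last by simp
  qed (simp add: dim_poly_act[OF C])
  moreover have "poly_act m ?C (char_poly ?C) ?e = 0\<^sub>v m" by (rule cayley_hamilton) auto
  ultimately have "poly_act m ?C (char_poly ?C - c) ?e = 0\<^sub>v m"
    by (intro poly_act_diff_zero) auto
  moreover have "degree (char_poly ?C - c) < m"
    using degree_monic_char_poly[OF C] c \<open>0 < m\<close>
    by (intro degree_lessI) (auto simp: coeff_eq_0 le_less)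
  ultimately show ?thesis using cv by (auto simp: cyclic_vector_def)
qed

lemma similar_companion:
  fixes A :: "'a::field mat"
  assumes A: "A \<in> carrier_mat m m" and e: "cyclic_vector m A e"
  shows "similar_mat A (companion m (char_poly A))"
proof -
  let ?K = "krylov_mat m A e" and ?C = "companion m (char_poly A)"
  have ec: "e \<in> carrier_vec m" using e by (simp add: cyclic_vector_def)
  obtain K' where K': "K' \<in> carrier_mat m m" "?K * K' = 1\<^sub>m m" "K' * ?K = 1\<^sub>m m"
    using krylov_mat_invertible[OF A e] .
  have "A * ?K = ?K * ?C"
    using degree_monic_char_poly[OF A] cayley_hamilton[OF A ec] by (intro krylov_mat_companion A ec) auto
  then have "?K * ?C * K' = A * ?K * K'" by simp
  also have "\<dots> = A * (?K * K')" using A K'(1) by (intro assoc_mult_mat) auto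
  also have "\<dots> = A" using A K' by simp
  finally show ?thesis
    using A K' by (intro similar_matI[of A ?C ?K K' m]) auto
qed

text \<open>A product of distinct monic irreducibles guarantees cyclic vectors, so both matrices are
  similar to the same companion matrix.\<close>

lemma similar_of_char_poly_eq:
  fixes A B :: "'a::field mat"
  assumes AB: "A \<in> carrier_mat m m" "B \<in> carrier_mat m m"
    and H: "finite H" "\<And>h. h \<in> H \<Longrightarrow> irreducible h \<and> lead_coeff h = 1"
    and "char_poly A = \<Prod>H" "char_poly B = \<Prod>H"
  shows "similar_mat A B"
proof -
  obtain e e' where "cyclic_vector m A e" "cyclic_vector m B e'"
    using cyclic_vector_exists[of _ m H] assms by metis
  then have "similar_mat A (companion m (\<Prod>H))" "similar_mat B (companion m (\<Prod>H))"
    using similar_companion AB assms(5,6) by metis+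
  then show ?thesis using similar_mat_trans similar_mat_sym by blast
qed

section \<open>Primary matrices with squarefree characteristic polynomial\<close>

lemma primary_with_index_of_irreducible:
  fixes B :: "'a::field mat"
  assumes B: "B \<in> carrier_mat m m" and "char_poly B \<in> irr_polys"
  shows "primary_with_index m B (char_poly B) [1]"
proof -
  let ?h = "char_poly B"
  have irr: "irreducible ?h" using assms by (simp add: irr_polys_def)
  have deg: "degree ?h = m" and mon: "lead_coeff ?h = 1" using degree_monic_char_poly[OF B] by auto
  have m: "0 < m" using irreducible_poly_degree_pos[OF irr] deg by simp
  obtain e where e: "cyclic_vector m B e"
    using cyclic_vector_exists[OF B, of "{?h}"] irr mon by auto
  have ec: "e \<in> carrier_vec m" using e by (simp add: cyclic_vector_def)
  let ?psi = "\<lambda>c. poly_act m B c e" and ?D = "{c :: 'a poly. degree c < m}"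
  have bij: "bij_betw ?psi ?D (carrier_vec m)" by (rule cyclic_vector_bij_betw[OF B e m])
  \<comment> \<open>Evaluation at a cyclic vector sends remainders modulo \<open>?h\<close> to
    vectors; the isomorphism asked for by \<open>primary_with_index\<close> is its inverse.\<close>
  define phi where "phi = inv_into ?D ?psi"
  have phi: "phi v \<in> ?D" "?psi (phi v) = v" if "v \<in> carrier_vec m" for v
    using bij that inv_into_into[of v ?psi ?D] f_inv_into_f[of v ?psi ?D]
    unfolding phi_def bij_betw_def by blast+
  have phi_eq: "phi v = c" if "c \<in> ?D" "v = ?psi c" for v c
    using bij that unfolding phi_def bij_betw_def by (auto intro: inv_into_f_f)
  have D_iff: "c \<in> ?D \<longleftrightarrow> c mod ?h = c" for c
  proof -
    have "?h \<noteq> 0" using irr by auto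
    then show ?thesis using degree_mod_less[of ?h c] dvd_imp_degree_le[of ?h c] deg m by (cases "c = 0") (auto simp: mod_poly_less)
  qed
  have psi_mod: "?psi (c mod ?h) = ?psi c" for c
  proof -
    have "?psi c = ?psi (c div ?h * ?h + c mod ?h)" by simp
    also have "\<dots> = ?psi (c div ?h * ?h) + ?psi (c mod ?h)" using B ec by (intro poly_act_add)
    also have "?psi (c div ?h * ?h) = 0\<^sub>v m"
      using B ec cayley_hamilton[OF B ec] by (intro poly_act_mult_eq_zero) auto
    finally show ?thesis using B ec by simp
  qed
  have Q: "quot_sum ?h [1] = (\<lambda>c. [c]) ` ?D"
  proof (rule Set.set_eqI)
    fix ps :: "'a poly list"
    have "ps \<in> quot_sum ?h [1] \<longleftrightarrow> (\<exists>c. ps = [c] \<and> c mod ?h = c)"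
      by (cases ps) (auto simp: quot_sum_def)
    also have "\<dots> \<longleftrightarrow> (\<exists>c. ps = [c] \<and> c \<in> ?D)" using D_iff by iprover
    also have "\<dots> \<longleftrightarrow> ps \<in> (\<lambda>c. [c]) ` ?D" by blast
    finally show "ps \<in> quot_sum ?h [1] \<longleftrightarrow> ps \<in> (\<lambda>c. [c]) ` ?D" .
  qed
  have "bij_betw ((\<lambda>c. [c]) \<circ> phi) (carrier_vec m) (quot_sum ?h [1])"
    unfolding Q phi_def
    by (rule bij_betw_trans[OF bij_betw_inv_into[OF bij]]) (auto simp: bij_betw_def inj_on_def)
  moreover have "phi (v + w) = phi v + phi w" if "v \<in> carrier_vec m" "w \<in> carrier_vec m" for v w
    using phi[OF that(1)] phi[OF that(2)] B ec by (intro phi_eq) (auto simp: poly_act_add degree_add_less)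
  moreover have "phi (poly_act m B c v) = (c * phi v) mod ?h" if "v \<in> carrier_vec m" for c v
  proof (rule phi_eq)
    show "(c * phi v) mod ?h \<in> ?D" unfolding D_iff by simp
    show "poly_act m B c v = ?psi ((c * phi v) mod ?h)"
      unfolding psi_mod using phi[OF that] B ec by (simp add: poly_act_mult)
  qed
  ultimately show ?thesis
    unfolding primary_with_index_def using assms(2)
    by (intro conjI exI[of _ "(\<lambda>c. [c]) \<circ> phi"]) (auto simp: partitions_def quot_sum_act_def)
qed


lemma irreducible_dvd_power:
  fixes h :: "'a::field poly"
  assumes "irreducible h" "h dvd a ^ n"
  shows "h dvd a"
  using assms(2)
proof (induction n)
  case 0
  then have "is_unit h" by simp
  then show ?case using irreducible_not_unit[OF assms(1)] by blast
next
  case (Suc n)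
  then have "h dvd a * a ^ n" by simp
  then show ?case using irreducible_dvd_mult[OF assms(1)] Suc.IH by blast
qed

text \<open>A power of \<open>h\<close> kills the whole space, so every factor of the characteristic
  polynomial is \<open>h\<close>, and by squarefreeness it is \<open>h\<close> itself. By
  Cayley-Hamilton \<open>h\<close> then kills the space, which leaves no exponent above 1. Now every
  nonzero vector is cyclic, which excludes a second summand.\<close>

lemma primary_with_index_squarefree:
  fixes B :: "'a::field mat"
  assumes B: "B \<in> carrier_mat m m" and m: "0 < m"
    and H: "finite H" "\<And>p. p \<in> H \<Longrightarrow> irreducible p \<and> lead_coeff p = 1" "char_poly B = \<Prod>H"
    and prim: "primary_with_index m B h rho"
  shows "char_poly B = h \<and> rho = [1]"
proof -
  from prim obtain phi where bij: "bij_betw phi (carrier_vec m) (quot_sum h rho)"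
    and add: "\<And>v w. v \<in> carrier_vec m \<Longrightarrow> w \<in> carrier_vec m \<Longrightarrow> phi (v + w) = map2 (+) (phi v) (phi w)"
    and act: "\<And>c v. v \<in> carrier_vec m \<Longrightarrow> phi (poly_act m B c v) = quot_sum_act h rho c (phi v)"
    unfolding primary_with_index_def by blast
  from prim have h: "irreducible h" "lead_coeff h = 1" and rho: "rho \<noteq> []" "\<And>r. r \<in> set rho \<Longrightarrow> 0 < r"
    unfolding primary_with_index_def irr_polys_def partitions_def by auto
  have deg_h: "0 < degree h" using irreducible_poly_degree_pos h(1) .
  then have h0: "h \<noteq> 0" by auto
  have phi: "length (phi v) = length rho" if "v \<in> carrier_vec m" for v
    using bij_betwE[OF bij] that by (auto simp: quot_sum_def)
  have act_nth: "phi (poly_act m B c v) ! i = (c * phi v ! i) mod h ^ (rho ! i)"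
    if "v \<in> carrier_vec m" "i < length rho" for c v i
    using that phi[OF that(1)] by (simp add: act quot_sum_act_def)
  have zero: "phi (0\<^sub>v m) ! i = 0" if "i < length rho" for i
  proof -
    have "phi (0\<^sub>v m) ! i + phi (0\<^sub>v m) ! i = phi (0\<^sub>v m) ! i + 0"
      using arg_cong[OF add[of "0\<^sub>v m" "0\<^sub>v m"], of "\<lambda>xs. xs ! i"] phi[of "0\<^sub>v m"] that by simp
    then show ?thesis by (rule add_left_imp_eq)
  qed
  have eq_zero: "v = 0\<^sub>v m" if v: "v \<in> carrier_vec m" "\<And>i. i < length rho \<Longrightarrow> phi v ! i = 0" for v
  proof -
    have "phi v = phi (0\<^sub>v m)" using v zero phi by (intro nth_equalityI) auto
    then show ?thesis using bij v(1) by (auto simp: bij_betw_def dest: inj_onD)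
  qed
  \<comment> \<open>The exponent \<open>sum_list rho\<close> is merely a convenient upper bound for
    all parts.\<close>
  have kill: "poly_act m B (h ^ sum_list rho) v = 0\<^sub>v m" if v: "v \<in> carrier_vec m" for v
  proof (rule eq_zero)
    fix i assume i: "i < length rho"
    then have "rho ! i \<le> sum_list rho" by (simp add: elem_le_sum_list)
    then show "phi (poly_act m B (h ^ sum_list rho) v) ! i = 0"
      unfolding act_nth[OF v i] by (simp add: le_imp_power_dvd)
  qed (use B v in simp)
  have "p = h" if "p \<in> H" for p
  proof -
    have p: "irreducible p" "lead_coeff p = 1" using H that by auto
    have "p dvd char_poly B" using dvd_prodI[OF H(1) that, of "\<lambda>x. x"] H by simp
    then obtain v where v: "v \<in> carrier_vec m" "v \<noteq> 0\<^sub>v m" "poly_act m B p v = 0\<^sub>v m"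
      using poly_act_kernel_of_dvd_char_poly[OF B _ irreducible_poly_degree_pos[OF p(1)]] by blast
    then have "p dvd h ^ sum_list rho"
      using poly_act_irreducible_dvd[OF B v(1) p(1) v(3) kill] by blast
    then show ?thesis
      using irreducible_dvd_power[OF p(1)] irreducible_monic_dvd_eq[OF p(1) h(1) p(2) h(2)] by blast
  qed
  moreover have "H \<noteq> {}" using H(3) degree_monic_char_poly[OF B] m by auto
  ultimately have "H = {h}" by blast
  then have char: "char_poly B = h" using H by simp
  then have deg: "degree h = m" using degree_monic_char_poly[OF B] by simp
  have one_mod: "1 mod h ^ (rho ! i) = 1" if "i < length rho" for i
  proof -
    have "0 < rho ! i" using rho(2) that by simp
    then have "0 < degree (h ^ (rho ! i))" using deg_h h0 by (simp add: degree_power_eq)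
    then show ?thesis by (simp add: mod_poly_less)
  qed
  have rho_1: "rho ! i = 1" if i: "i < length rho" for i
  proof -
    \<comment> \<open>The vector with all components 1 is killed by \<open>h\<close>, which says
      that \<open>h\<close> vanishes modulo each \<open>h ^ (rho ! i)\<close>.\<close>
    have "replicate (length rho) 1 \<in> quot_sum h rho" using one_mod by (simp add: quot_sum_def)
    then obtain v where v: "v \<in> carrier_vec m" "phi v = replicate (length rho) 1"
      using bij unfolding bij_betw_def by (metis imageE)
    have "poly_act m B h v = 0\<^sub>v m" using cayley_hamilton[OF B v(1)] char by simp
    then have "h mod h ^ (rho ! i) = 0" using act_nth[OF v(1) i, of h] zero[OF i] v(2) i by simp
    then have "h ^ (rho ! i) dvd h" by auto
    then have "rho ! i * degree h \<le> degree h" using dvd_imp_degree_le[of "h ^ (rho ! i)" h] h0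
      by (simp add: degree_power_eq)
    moreover have "0 < rho ! i" using rho(2) i by simp
    ultimately show ?thesis using deg_h by simp
  qed
  have "length rho = 1"
  proof (rule ccontr)
    assume "length rho \<noteq> 1"
    with rho(1) have len: "1 < length rho" by (cases rho) auto
    have len0: "0 < length rho" using rho(1) by simp
    have basis: "(replicate (length rho) 0)[i := 1] \<in> quot_sum h rho" if "i < length rho" for i
      using one_mod that by (auto simp: quot_sum_def nth_list_update)
    obtain e where e: "e \<in> carrier_vec m" "phi e = (replicate (length rho) 0)[0 := 1]"
      using bij basis[OF len0] unfolding bij_betw_def by (metis imageE)
    obtain w where w: "w \<in> carrier_vec m" "phi w = (replicate (length rho) 0)[1 := 1]"
      using bij basis[OF len] unfolding bij_betw_def by (metis imageE)
    have "e \<noteq> 0\<^sub>v m" using e(2) zero[of 0] len by (metis length_greater_0_conv length_replicate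
        nth_list_update_eq rho(1) zero_neq_one)
    have "cyclic_vector m B e"
      unfolding cyclic_vector_def
    proof (intro conjI allI impI e)
      fix c assume c: "degree c < m" "poly_act m B c e = 0\<^sub>v m"
      have "poly_act m B h e = 0\<^sub>v m" using cayley_hamilton[OF B e(1)] char by simp
      then have "h dvd c" using poly_act_irreducible_dvd[OF B e(1) h(1) _ c(2)] \<open>e \<noteq> 0\<^sub>v m\<close> by blast
      then show "c = 0" using dvd_imp_degree_le[of h c] c(1) deg by auto
    qed
    then obtain c where "w = poly_act m B c e"
      using cyclic_vector_bij_betw[OF B _ m] w(1) unfolding bij_betw_def by blast
    \<comment> \<open>The action is componentwise, so whatever is reached from \<open>e\<close>
      stays in the first summand, whereas \<open>w\<close> was chosen in the second.\<close>
    then have "phi w ! 1 = 0" using act_nth[OF e(1) len, of c] e(2) len by simp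
    then show False using w(2) len by simp
  qed
  then have "rho = [1]" using rho_1[of 0] by (cases rho) auto
  with char show ?thesis by simp
qed

text \<open>The pair selected by \<open>SOME\<close> is forced, and \<open>kappa\<close> at
  \<open>[1]\<close> is an empty product, so only the sum of powers survives.\<close>

lemma primary_P_squarefree:
  fixes B :: "'a::{field,finite} mat" and eps :: "'b::{field,finite}"
  assumes B: "B \<in> carrier_mat m m" and m: "0 < m"
    and H: "finite H" "\<And>p. p \<in> H \<Longrightarrow> irreducible p \<and> lead_coeff p = 1" "char_poly B = \<Prod>H"
  shows "primary_P theta eps ell b m B =
    (if char_poly B \<in> irr_polys then
       \<Sum>i=1..m. theta (eps_sub (CARD('a)) eps m powi ell (char_poly B)) powi (int (CARD('a)) ^ i * b)
     else 0)"
proof -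
  have iff: "primary_with_index m B h rho \<longleftrightarrow> char_poly B \<in> irr_polys \<and> h = char_poly B \<and> rho = [1]" for h rho
  proof
    assume P: "primary_with_index m B h rho"
    then have "h \<in> irr_polys" by (simp add: primary_with_index_def)
    then show "char_poly B \<in> irr_polys \<and> h = char_poly B \<and> rho = [1]"
      using primary_with_index_squarefree[OF B m H P] by auto
  qed (use primary_with_index_of_irreducible[OF B] in auto)
  have "(SOME (h, rho). h = char_poly B \<and> rho = [1 :: nat]) = (char_poly B, [1])"
    by (rule some_equality) auto
  then show ?thesis
    unfolding primary_P_def iff using degree_monic_char_poly[OF B] by (auto simp: kappa_def Let_def simp del: One_nat_def)
qed

subsection \<open>Block upper triangular matrices\<close>

lemma block_start_Cons [simp]:
  "block_start (a # nu) 0 = 0" "block_start (a # nu) (Suc i) = a + block_start nu i"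
  by (simp_all add: block_start_def)

text \<open>Peeling off the first block turns the \<open>LEAST\<close> of the definition into a
  recursion on the list. The bound on \<open>k\<close> guarantees that some block contains
  it.\<close>

lemma block_of_Cons:
  assumes "k < a + sum_list nu"
  shows "block_of (a # nu) k = (if k < a then 0 else Suc (block_of nu (k - a)))"
proof (cases "k < a")
  case True
  then show ?thesis unfolding block_of_def by (intro Least_equality) (auto simp: block_start_def)
next
  case False
  have ex: "k - a < block_start nu (Suc (length nu))" using assms False by (simp add: block_start_def)
  have "(LEAST i. k < block_start (a # nu) (Suc i))
      = Suc (LEAST i. k < block_start (a # nu) (Suc (Suc i)))"
    by (rule Least_Suc[of _ "Suc (length nu)"]) (use ex False in \<open>auto simp: block_start_def\<close>)
  also have "(LEAST i. k < block_start (a # nu) (Suc (Suc i))) = block_of nu (k - a)"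
    unfolding block_of_def block_start_Cons(2)[of a nu "Suc _"]
    by (rule arg_cong[of _ _ Least]) (use False in auto)
  finally show ?thesis using False by (simp add: block_of_def)
qed

text \<open>The shape condition of \<open>parabolic\<close> separated from invertibility, because
  inductions over the blocks apply it to corners that are not known to be invertible.\<close>

definition block_upper :: "nat list \<Rightarrow> 'a::zero mat \<Rightarrow> bool" where
  "block_upper nu g \<longleftrightarrow> (\<forall>r<sum_list nu. \<forall>c<sum_list nu.
     block_of nu c < block_of nu r \<longrightarrow> g $$ (r, c) = 0)"

lemma parabolic_eq: "parabolic nu = {g \<in> GL (sum_list nu). block_upper nu g}"
  by (simp add: parabolic_def block_upper_def)

definition lower_right :: "nat \<Rightarrow> 'a mat \<Rightarrow> 'a mat" where
  "lower_right a A = mat (dim_row A - a) (dim_col A - a) (\<lambda>(i, j). A $$ (a + i, a + j))"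

lemma lower_right_closed [simp]:
  "A \<in> carrier_mat (a + n) (a + n) \<Longrightarrow> lower_right a A \<in> carrier_mat n n"
  by (auto simp: lower_right_def)

lemma lower_right_four_block [simp]:
  assumes "A1 \<in> carrier_mat a a" "A4 \<in> carrier_mat n n"
  shows "lower_right a (four_block_mat A1 A2 A3 A4) = A4"
  by (rule eq_matI) (use assms in \<open>auto simp: lower_right_def\<close>)

lemma block_upper_Cons:
  assumes A: "A \<in> carrier_mat (a + sum_list nu) (a + sum_list nu)"
  shows "block_upper (a # nu) A \<longleftrightarrow>
    (\<forall>r c. a \<le> r \<longrightarrow> r < a + sum_list nu \<longrightarrow> c < a \<longrightarrow> A $$ (r, c) = 0) \<and> block_upper nu (lower_right a A)"
  (is "?L \<longleftrightarrow> ?Z \<and> ?R")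
proof
  assume L: ?L
  have ?Z
  proof (intro allI impI)
    fix r c assume "a \<le> r" "r < a + sum_list nu" "c < a"
    then show "A $$ (r, c) = 0" using L
      by (auto simp: block_upper_def block_of_Cons)
  qed
  moreover have ?R unfolding block_upper_def
  proof (intro allI impI)
    fix r c assume "r < sum_list nu" "c < sum_list nu" "block_of nu c < block_of nu r"
    moreover from this have "block_of (a # nu) (a + c) < block_of (a # nu) (a + r)"
      by (simp add: block_of_Cons)
    ultimately show "lower_right a A $$ (r, c) = 0" using L A
      by (simp add: block_upper_def lower_right_def)
  qed
  ultimately show "?Z \<and> ?R" ..
next
  assume R: "?Z \<and> ?R"
  show ?L unfolding block_upper_def
  proof (intro allI impI)
    fix r c assume rc: "r < sum_list (a # nu)" "c < sum_list (a # nu)"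
      and less: "block_of (a # nu) c < block_of (a # nu) r"
    then have "a \<le> r" by (auto simp: block_of_Cons split: if_splits)
    show "A $$ (r, c) = 0"
    proof (cases "c < a")
      case True
      then show ?thesis using R rc \<open>a \<le> r\<close> by auto
    next
      case False
      then have "block_of nu (c - a) < block_of nu (r - a)"
        using less rc \<open>a \<le> r\<close> by (auto simp: block_of_Cons split: if_splits)
      then have "lower_right a A $$ (r - a, c - a) = 0"
        using R rc False \<open>a \<le> r\<close> by (auto simp: block_upper_def)
      then show ?thesis using A rc False \<open>a \<le> r\<close> by (auto simp: lower_right_def)
    qed
  qed
qed

lemma diag_block_Cons_Suc:
  assumes "A \<in> carrier_mat (a + sum_list nu) (a + sum_list nu)" "i < length nu"
  shows "diag_block (a # nu) (Suc i) A = diag_block nu i (lower_right a A)"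
proof -
  have "block_start nu i + nu ! i = block_start nu (Suc i)"
    using assms(2) by (simp add: block_start_def take_Suc_conv_app_nth)
  also have "\<dots> \<le> sum_list nu"
    unfolding block_start_def by (metis append_take_drop_id le_add1 sum_list_append)
  finally show ?thesis using assms
    by (intro eq_matI) (auto simp: diag_block_def lower_right_def add.assoc)
qed

lemma diag_block_closed [simp]: "diag_block nu i A \<in> carrier_mat (nu ! i) (nu ! i)"
  by (simp add: diag_block_def)

lemma diag_block_four_block:
  assumes "A1 \<in> carrier_mat a a"
  shows "diag_block (a # nu) 0 (four_block_mat A1 A2 A3 A4) = A1"
  by (rule eq_matI) (use assms in \<open>auto simp: diag_block_def\<close>)

lemma diag_block_Cons_four_block:
  assumes "A1 \<in> carrier_mat a a" "A4 \<in> carrier_mat (sum_list nu) (sum_list nu)" "i < length nu"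
  shows "diag_block (a # nu) (Suc i) (four_block_mat A1 A2 A3 A4) = diag_block nu i A4"
  using assms by (subst diag_block_Cons_Suc) auto

lemma block_upper_Cons_four_block:
  assumes "A1 \<in> carrier_mat a a" "A4 \<in> carrier_mat (sum_list nu) (sum_list nu)"
    "A3 \<in> carrier_mat (sum_list nu) a"
  shows "block_upper (a # nu) (four_block_mat A1 A2 A3 A4) \<longleftrightarrow>
    A3 = 0\<^sub>m (sum_list nu) a \<and> block_upper nu A4"
proof -
  let ?M = "four_block_mat A1 A2 A3 A4"
  have "(\<forall>r c. a \<le> r \<longrightarrow> r < a + sum_list nu \<longrightarrow> c < a \<longrightarrow> ?M $$ (r, c) = 0) \<longleftrightarrow>
      A3 = 0\<^sub>m (sum_list nu) a" (is "?L \<longleftrightarrow> _")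
  proof
    assume L: ?L
    show "A3 = 0\<^sub>m (sum_list nu) a"
    proof (rule eq_matI)
      fix i j assume "i < dim_row (0\<^sub>m (sum_list nu) a :: 'a mat)" "j < dim_col (0\<^sub>m (sum_list nu) a :: 'a mat)"
      then show "A3 $$ (i, j) = 0\<^sub>m (sum_list nu) a $$ (i, j)"
        using L[rule_format, of "a + i" j] assms by auto
    qed (use assms in auto)
  qed (use assms in auto)
  then show ?thesis using assms by (subst block_upper_Cons) auto
qed

lemma split_four_block:
  assumes "A \<in> carrier_mat (a + n) (a + n)"
  obtains A1 A2 A3 A4 where "A = four_block_mat A1 A2 A3 A4"
    "A1 \<in> carrier_mat a a" "A2 \<in> carrier_mat a n" "A3 \<in> carrier_mat n a" "A4 \<in> carrier_mat n n"
proof -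
  obtain A1 A2 A3 A4 where s: "split_block A a a = (A1, A2, A3, A4)" by (cases "split_block A a a")
  show ?thesis using that split_block[OF s, of n n] assms by auto
qed

lemma block_upper_split:
  assumes "A \<in> carrier_mat (a + sum_list nu) (a + sum_list nu)" "block_upper (a # nu) A"
  obtains A1 A2 A4 where "A = four_block_mat A1 A2 (0\<^sub>m (sum_list nu) a) A4"
    "A1 \<in> carrier_mat a a" "A2 \<in> carrier_mat a (sum_list nu)"
    "A4 \<in> carrier_mat (sum_list nu) (sum_list nu)" "block_upper nu A4"
  using assms by (elim split_four_block) (auto simp: block_upper_Cons_four_block)

lemma char_poly_four_block_lower_left_zero:
  fixes A1 :: "'a::field mat"
  assumes A: "A1 \<in> carrier_mat a a" "A2 \<in> carrier_mat a n" "A4 \<in> carrier_mat n n"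
  shows "char_poly (four_block_mat A1 A2 (0\<^sub>m n a) A4) = char_poly A1 * char_poly A4"
proof -
  let ?c = "map_mat (\<lambda>x. [:- x:])"
  have "char_poly_matrix (four_block_mat A1 A2 (0\<^sub>m n a) A4) =
      four_block_mat (char_poly_matrix A1) (?c A2) (0\<^sub>m n a) (char_poly_matrix A4)"
    by (rule eq_matI) (use A in \<open>auto simp: char_poly_matrix_def\<close>)
  then show ?thesis unfolding char_poly_def
    using A by (simp add: det_four_block_mat_lower_left_zero[of _ a _ n])
qed

lemma char_poly_block_upper:
  fixes A :: "'a::field mat"
  assumes "A \<in> carrier_mat (sum_list nu) (sum_list nu)" "block_upper nu A"
  shows "char_poly A = (\<Prod>i<length nu. char_poly (diag_block nu i A))"
  using assms
proof (induction nu arbitrary: A)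
  case Nil
  then have "char_poly A = 1" using degree_monic_char_poly[of A 0]
    by (metis degree_0_id one_pCons sum_list.Nil)
  then show ?case by simp
next
  case (Cons a nu)
  obtain A1 A2 A4 where A: "A = four_block_mat A1 A2 (0\<^sub>m (sum_list nu) a) A4"
    "A1 \<in> carrier_mat a a" "A2 \<in> carrier_mat a (sum_list nu)"
    "A4 \<in> carrier_mat (sum_list nu) (sum_list nu)" "block_upper nu A4"
    using Cons.prems by (auto elim: block_upper_split)
  have "char_poly A = char_poly A1 * (\<Prod>i<length nu. char_poly (diag_block nu i A4))"
    using A Cons.IH[OF A(4,5)] by (simp add: char_poly_four_block_lower_left_zero)
  also have "\<dots> = (\<Prod>i<length (a # nu). char_poly (diag_block (a # nu) i A))"
    using A by (simp add: prod.lessThan_Suc_shift diag_block_four_block diag_block_Cons_four_block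
        del: prod.lessThan_Suc)
  finally show ?case .
qed

lemma block_upper_mult:
  fixes A B :: "'a::field mat"
  assumes "A \<in> carrier_mat (sum_list nu) (sum_list nu)" "block_upper nu A"
    "B \<in> carrier_mat (sum_list nu) (sum_list nu)" "block_upper nu B"
  shows "block_upper nu (A * B) \<and>
    (\<forall>i<length nu. diag_block nu i (A * B) = diag_block nu i A * diag_block nu i B)"
  using assms
proof (induction nu arbitrary: A B)
  case Nil
  then show ?case by (simp add: block_upper_def)
next
  case (Cons a nu)
  let ?n = "sum_list nu"
  obtain A1 A2 A4 where A: "A = four_block_mat A1 A2 (0\<^sub>m ?n a) A4"
    "A1 \<in> carrier_mat a a" "A2 \<in> carrier_mat a ?n" "A4 \<in> carrier_mat ?n ?n" "block_upper nu A4"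
    using Cons.prems(1,2) by (auto elim: block_upper_split)
  obtain B1 B2 B4 where B: "B = four_block_mat B1 B2 (0\<^sub>m ?n a) B4"
    "B1 \<in> carrier_mat a a" "B2 \<in> carrier_mat a ?n" "B4 \<in> carrier_mat ?n ?n" "block_upper nu B4"
    using Cons.prems(3,4) by (auto elim: block_upper_split)
  have AB: "A * B = four_block_mat (A1 * B1) (A1 * B2 + A2 * B4) (0\<^sub>m ?n a) (A4 * B4)"
    unfolding A(1) B(1) using A(2-4) B(2-4)
    by (subst mult_four_block_mat[of _ a a _ ?n _ ?n _ _ a _ ?n]) auto
  have IH: "block_upper nu (A4 * B4)"
    "\<And>i. i < length nu \<Longrightarrow> diag_block nu i (A4 * B4) = diag_block nu i A4 * diag_block nu i B4"
    using Cons.IH A B by auto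
  have "block_upper (a # nu) (A * B)"
    unfolding AB using A B IH by (subst block_upper_Cons_four_block) auto
  moreover have "diag_block (a # nu) i (A * B) = diag_block (a # nu) i A * diag_block (a # nu) i B"
    if "i < length (a # nu)" for i
    unfolding AB unfolding A(1) B(1)
    by (cases i) (use that A(2-4) B(2-4) IH in \<open>auto simp: diag_block_four_block diag_block_Cons_four_block\<close>)
  ultimately show ?case by blast
qed

lemma diag_block_one:
  assumes "i < length nu"
  shows "diag_block nu i (1\<^sub>m (sum_list nu)) = 1\<^sub>m (nu ! i)"
proof -
  have "block_start nu i + nu ! i = block_start nu (Suc i)"
    using assms by (simp add: block_start_def take_Suc_conv_app_nth)
  also have "\<dots> \<le> sum_list nu"
    unfolding block_start_def by (metis append_take_drop_id le_add1 sum_list_append)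
  finally show ?thesis by (intro eq_matI) (auto simp: diag_block_def)
qed

lemma block_upper_one: "block_upper nu (1\<^sub>m (sum_list nu))"
  by (auto simp: block_upper_def)

section \<open>Matrices intertwining two block triangular matrices\<close>

lemma intertwiner_poly_act:
  assumes A: "A \<in> carrier_mat a a" and B: "B \<in> carrier_mat b b" and M: "M \<in> carrier_mat b a"
    and eq: "M * A = B * M" and v: "v \<in> carrier_vec a"
  shows "M *\<^sub>v poly_act a A c v = poly_act b B c (M *\<^sub>v v)"
  using v
proof (induction c arbitrary: v)
  case 0
  have Mv: "M *\<^sub>v v \<in> carrier_vec b" using M 0 by auto
  have "M *\<^sub>v 0\<^sub>v a = 0\<^sub>v b" using M by (intro eq_vecI) auto
  then show ?case using A B 0 Mv by simp
next
  case (pCons x c)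
  have Mv: "M *\<^sub>v v \<in> carrier_vec b" and Av: "A *\<^sub>v v \<in> carrier_vec a" using M A pCons.prems by auto
  have "M *\<^sub>v (A *\<^sub>v v) = (M * A) *\<^sub>v v" using assoc_mult_mat_vec[OF M A pCons.prems] by simp
  also have "\<dots> = B *\<^sub>v (M *\<^sub>v v)" unfolding eq using assoc_mult_mat_vec[OF B M pCons.prems] .
  finally have swap: "M *\<^sub>v (A *\<^sub>v v) = B *\<^sub>v (M *\<^sub>v v)" .
  have "M *\<^sub>v (x \<cdot>\<^sub>v v + poly_act a A c (A *\<^sub>v v)) = x \<cdot>\<^sub>v (M *\<^sub>v v) + M *\<^sub>v poly_act a A c (A *\<^sub>v v)"
    using M A pCons.prems Av by (simp add: mult_add_distrib_mat_vec[OF M] mult_mat_vec[OF M])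
  then show ?case using A B pCons.prems Mv pCons.IH[OF Av] by (simp add: poly_act_pCons swap)
qed

text \<open>Every vector in the image of \<open>M\<close> is annihilated by both characteristic
  polynomials. If one were nonzero, the irreducible polynomial would divide the other.\<close>

lemma intertwiner_eq_zero:
  fixes M :: "'a::field mat"
  assumes A: "A \<in> carrier_mat a a" and B: "B \<in> carrier_mat b b" and M: "M \<in> carrier_mat b a"
    and eq: "M * A = B * M"
    and irr: "irreducible (char_poly A)" "\<not> char_poly A dvd char_poly B"
  shows "M = 0\<^sub>m b a"
proof (rule eq_mat_by_mult_vec[of _ b a])
  fix v :: "'a vec" assume v: "v \<in> carrier_vec a"
  have Mv: "M *\<^sub>v v \<in> carrier_vec b" using M v by auto
  have "poly_act b B (char_poly A) (M *\<^sub>v v) = M *\<^sub>v 0\<^sub>v a"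
    using intertwiner_poly_act[OF A B M eq v, of "char_poly A"] cayley_hamilton[OF A v] by simp
  also have "\<dots> = 0\<^sub>v b" using M by (intro eq_vecI) auto
  finally have "M *\<^sub>v v = 0\<^sub>v b"
    using poly_act_irreducible_dvd[OF B Mv irr(1) _ cayley_hamilton[OF B Mv]] irr(2) by blast
  then show "M *\<^sub>v v = 0\<^sub>m b a *\<^sub>v v" using v by (intro eq_vecI) auto
qed (use M in auto)

lemma four_block_mat_lower_inject:
  assumes "four_block_mat A1 A2 A3 A4 = four_block_mat B1 B2 B3 B4"
    "A1 \<in> carrier_mat a a" "A3 \<in> carrier_mat n a" "A4 \<in> carrier_mat n n"
    "B1 \<in> carrier_mat a a" "B3 \<in> carrier_mat n a" "B4 \<in> carrier_mat n n"
  shows "A3 = B3 \<and> A4 = B4"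
proof
  show "A4 = B4" using arg_cong[OF assms(1), of "lower_right a"] assms(2-) by simp
  have "A3 $$ (i, j) = B3 $$ (i, j)" if "i < n" "j < a" for i j
    using arg_cong[OF assms(1), of "\<lambda>M. M $$ (a + i, j)"] assms(2-) that by simp
  then show "A3 = B3" using assms(2-) by (intro eq_matI) auto
qed

text \<open>The lower left corner of \<open>Z\<close> intertwines the first block of
  \<open>A\<close> with the remaining part of \<open>B\<close>; their characteristic polynomials are
  coprime, so the corner vanishes. With it gone, the lower right corner intertwines the remaining
  parts, and the induction applies.\<close>

lemma block_upper_intertwiner:
  fixes A B Z :: "'a::field mat"
  assumes "A \<in> carrier_mat (sum_list nu) (sum_list nu)" "block_upper nu A"
    "B \<in> carrier_mat (sum_list nu) (sum_list nu)" "block_upper nu B"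
    "Z \<in> carrier_mat (sum_list nu) (sum_list nu)" "Z * A = B * Z"
    and "\<And>i. i < length nu \<Longrightarrow> irreducible (ks ! i) \<and> lead_coeff (ks ! i) = 1"
    and "distinct ks" "length ks = length nu"
    and "\<And>i. i < length nu \<Longrightarrow> char_poly (diag_block nu i A) = ks ! i"
    and "\<And>i. i < length nu \<Longrightarrow> char_poly (diag_block nu i B) = ks ! i"
  shows "block_upper nu Z"
  using assms
proof (induction nu arbitrary: A B Z ks)
  case Nil
  then show ?case by (simp add: block_upper_def)
next
  case (Cons a nu)
  let ?n = "sum_list nu"
  obtain A1 A2 A4 where A: "A = four_block_mat A1 A2 (0\<^sub>m ?n a) A4"
    "A1 \<in> carrier_mat a a" "A2 \<in> carrier_mat a ?n" "A4 \<in> carrier_mat ?n ?n" "block_upper nu A4"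
    using Cons.prems(1,2) by (auto elim: block_upper_split)
  obtain B1 B2 B4 where B: "B = four_block_mat B1 B2 (0\<^sub>m ?n a) B4"
    "B1 \<in> carrier_mat a a" "B2 \<in> carrier_mat a ?n" "B4 \<in> carrier_mat ?n ?n" "block_upper nu B4"
    using Cons.prems(3,4) by (auto elim: block_upper_split)
  obtain Z1 Z2 Z3 Z4 where Z: "Z = four_block_mat Z1 Z2 Z3 Z4"
    "Z1 \<in> carrier_mat a a" "Z2 \<in> carrier_mat a ?n" "Z3 \<in> carrier_mat ?n a" "Z4 \<in> carrier_mat ?n ?n"
    using Cons.prems(5) by (auto elim: split_four_block)
  obtain k ks' where ks: "ks = k # ks'" "length ks' = length nu"
    using Cons.prems(9) by (cases ks) auto
  have ZA: "Z * A = four_block_mat (Z1 * A1) (Z1 * A2 + Z2 * A4) (Z3 * A1) (Z3 * A2 + Z4 * A4)"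
    unfolding A(1) Z(1) using A(2-4) Z(2-5)
    by (subst mult_four_block_mat[of _ a a _ ?n _ ?n _ _ a _ ?n]) auto
  have BZ: "B * Z = four_block_mat (B1 * Z1 + B2 * Z3) (B1 * Z2 + B2 * Z4) (B4 * Z3) (B4 * Z4)"
    unfolding B(1) Z(1) using B(2-4) Z(2-5)
    by (subst mult_four_block_mat[of _ a a _ ?n _ ?n _ _ a _ ?n]) auto
  have "Z3 * A1 = B4 * Z3 \<and> Z3 * A2 + Z4 * A4 = B4 * Z4"
    by (rule four_block_mat_lower_inject[OF Cons.prems(6)[unfolded ZA BZ], of a ?n])
      (use A(2-4) B(2-4) Z(2-5) in auto)
  then have eq: "Z3 * A1 = B4 * Z3" "Z3 * A2 + Z4 * A4 = B4 * Z4" by auto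
  have diag: "char_poly A1 = k"
    "\<And>i. i < length nu \<Longrightarrow> char_poly (diag_block nu i A4) = ks' ! i"
    "\<And>i. i < length nu \<Longrightarrow> char_poly (diag_block nu i B4) = ks' ! i"
    using Cons.prems(10)[of 0] Cons.prems(10)[of "Suc _"] Cons.prems(11)[of "Suc _"] A B ks
    by (auto simp: diag_block_four_block diag_block_Cons_four_block)
  have irr: "irreducible k" "lead_coeff k = 1"
    "\<And>i. i < length nu \<Longrightarrow> irreducible (ks' ! i) \<and> lead_coeff (ks' ! i) = 1"
    using Cons.prems(7)[of 0] Cons.prems(7)[of "Suc _"] ks by auto
  \<comment> \<open>The factors of \<open>char_poly B4\<close> are the entries of
    \<open>ks'\<close>, and distinctness keeps \<open>k\<close> out of that list.\<close>
  have ndvd: "\<not> k dvd char_poly B4"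
  proof
    assume "k dvd char_poly B4"
    then have "k dvd (\<Prod>i<length nu. ks' ! i)"
      using char_poly_block_upper[OF B(4,5)] diag(3) by simp
    then obtain i where "i < length nu" "k dvd ks' ! i"
      using irreducible_dvd_prod[of "{..<length nu}" k] irr(1) by blast
    then have "k = ks' ! i" using irreducible_monic_dvd_eq[of k "ks' ! i"] irr by blast
    then show False using Cons.prems(8) ks \<open>i < length nu\<close> nth_mem[of i ks'] by simp
  qed
  have Z3: "Z3 = 0\<^sub>m ?n a"
    by (rule intertwiner_eq_zero[OF A(2) B(4) Z(4) eq(1)]) (use diag irr ndvd in auto)
  have "Z3 * A2 = 0\<^sub>m ?n ?n" unfolding Z3 using A(3) by simp
  then have "Z4 * A4 = B4 * Z4" using eq(2) A(4) Z(5) by simp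
  then have "block_upper nu Z4"
    using Cons.IH[OF A(4,5) B(4,5) Z(5) _ irr(3) _ ks(2) diag(2,3)] Cons.prems(8) ks by simp
  then show ?case unfolding Z(1) using Z Z3 by (subst block_upper_Cons_four_block) auto
qed

section \<open>Finiteness, inverses and the general linear group\<close>

lemma finite_carrier_mat [simp]: "finite (carrier_mat n m :: 'a::finite mat set)"
proof -
  have "finite (PiE ({..<n} \<times> {..<m}) (\<lambda>_. UNIV :: 'a set))" by (intro finite_PiE) auto
  then have "finite (mat n m ` PiE ({..<n} \<times> {..<m}) (\<lambda>_. UNIV :: 'a set))" by (rule finite_imageI)
  moreover have "carrier_mat n m \<subseteq> mat n m ` PiE ({..<n} \<times> {..<m}) (\<lambda>_. UNIV :: 'a set)"
  proof
    fix A :: "'a mat" assume A: "A \<in> carrier_mat n m"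
    have "A = mat n m (restrict (\<lambda>x. A $$ x) ({..<n} \<times> {..<m}))"
      using A by (intro eq_matI) auto
    then show "A \<in> mat n m ` PiE ({..<n} \<times> {..<m}) (\<lambda>_. UNIV)"
      by (rule image_eqI[of _ "mat n m"]) simp
  qed
  ultimately show ?thesis by (rule finite_subset[rotated])
qed

text \<open>Finiteness replaces a block inversion formula: left multiplication by \<open>p\<close>
  is injective on the finite set of block triangular matrices, hence onto. The identity thus has a
  block triangular preimage, which must be \<open>q\<close>.\<close>

lemma block_upper_inverse:
  fixes p q :: "'a::{field,finite} mat"
  assumes p: "p \<in> carrier_mat (sum_list nu) (sum_list nu)" "block_upper nu p"
    and q: "q \<in> carrier_mat (sum_list nu) (sum_list nu)" "q * p = 1\<^sub>m (sum_list nu)"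
  shows "block_upper nu q"
proof -
  let ?n = "sum_list nu"
  let ?S = "{X :: 'a mat. X \<in> carrier_mat ?n ?n \<and> block_upper nu X}"
  have cancel: "X = q * (p * X)" if "X \<in> carrier_mat ?n ?n" for X
    using that q assoc_mult_mat[OF q(1) p(1) that] by simp
  have "finite ?S" by (rule finite_subset[of _ "carrier_mat ?n ?n"]) auto
  moreover have "(*) p ` ?S \<subseteq> ?S" using p block_upper_mult by auto
  moreover have "inj_on ((*) p) ?S"
  proof (rule inj_onI)
    fix X Y assume "X \<in> ?S" "Y \<in> ?S" and eq: "p * X = p * Y"
    then have "X = q * (p * X)" "Y = q * (p * Y)" using cancel by blast+
    then show "X = Y" using eq by simp
  qed
  ultimately have "(*) p ` ?S = ?S" by (rule endo_inj_surj)
  moreover have "1\<^sub>m ?n \<in> ?S" using block_upper_one by auto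
  ultimately have "1\<^sub>m ?n \<in> (*) p ` ?S" by (simp only:)
  then obtain X where X: "X \<in> carrier_mat ?n ?n" "block_upper nu X" "p * X = 1\<^sub>m ?n" by auto
  then have "X = q" using cancel[OF X(1)] right_mult_one_mat[OF q(1)] by simp
  then show ?thesis using X by simp
qed

lemma GL_iff:
  "g \<in> GL n \<longleftrightarrow> g \<in> carrier_mat n n \<and> (\<exists>h\<in>carrier_mat n n. h * g = 1\<^sub>m n \<and> g * h = 1\<^sub>m n)"
  by (auto simp: GL_def Units_def ring_mat_def)

lemma conjugate_by_eq:
  assumes "x \<in> carrier_mat n n" "y \<in> carrier_mat n n" "x * y = 1\<^sub>m n" "y * x = 1\<^sub>m n"
  shows "conjugate_by n x g = x * g * y"
proof -
  interpret R: ring "ring_mat TYPE('a) n ()" by (rule ring_mat)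
  have "inv\<^bsub>ring_mat TYPE('a) n ()\<^esub> x = y"
    using R.inv_unique'[of x y] assms by (simp add: ring_mat_simps)
  then show ?thesis by (simp add: conjugate_by_def)
qed

lemma GL_mult: "g \<in> GL n \<Longrightarrow> h \<in> GL n \<Longrightarrow> g * h \<in> GL n"
proof -
  interpret R: ring "ring_mat TYPE('a) n ()" by (rule ring_mat)
  assume "g \<in> GL n" "h \<in> GL n"
  then show ?thesis using R.Units_m_closed[of g h] by (simp add: GL_def ring_mat_simps)
qed

subsection \<open>Counting conjugators into a parabolic subgroup\<close>

text \<open>The model to which \<open>g\<close> is conjugated in order to realise a prescribed order
  of its factors.\<close>

lemma block_diagonal_companions:
  fixes ks :: "'a::field poly list"
  defines "C \<equiv> \<lambda>ks :: 'a poly list. diag_block_mat (map (\<lambda>k. companion (degree k) k) ks)"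
  shows "C ks \<in> carrier_mat (sum_list (map degree ks)) (sum_list (map degree ks)) \<and>
    block_upper (map degree ks) (C ks) \<and>
    (\<forall>i<length ks. diag_block (map degree ks) i (C ks) = companion (degree (ks ! i)) (ks ! i))"
proof (induction ks)
  case Nil
  then show ?case by (simp add: C_def block_upper_def)
next
  case (Cons k ks)
  let ?a = "degree k" and ?n = "sum_list (map degree ks)"
  have IH: "C ks \<in> carrier_mat ?n ?n" "block_upper (map degree ks) (C ks)"
    "\<And>i. i < length ks \<Longrightarrow> diag_block (map degree ks) i (C ks) = companion (degree (ks ! i)) (ks ! i)"
    using Cons by auto
  have eq: "C (k # ks) = four_block_mat (companion ?a k) (0\<^sub>m ?a ?n) (0\<^sub>m ?n ?a) (C ks)"
    using IH(1) by (simp add: C_def Let_def carrier_matD[OF companion_closed])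
  have "diag_block (map degree (k # ks)) i (C (k # ks)) = companion (degree ((k # ks) ! i)) ((k # ks) ! i)"
    if "i < length (k # ks)" for i
    unfolding eq using that IH
    by (cases i) (auto simp: diag_block_four_block diag_block_Cons_four_block)
  moreover have "block_upper (map degree (k # ks)) (C (k # ks))"
    unfolding eq using IH by (simp add: block_upper_Cons_four_block)
  moreover have "C (k # ks) \<in> carrier_mat (?a + ?n) (?a + ?n)"
    unfolding eq using IH by (intro four_block_carrier_mat) auto
  ultimately show ?case by simp
qed

text \<open>An order of the factors is encoded as the list of polynomials itself; the block sizes
  are recovered as degrees.\<close>

definition block_char_polys :: "nat list \<Rightarrow> 'a::field mat \<Rightarrow> 'a poly list" where
  "block_char_polys nu A = map (\<lambda>i. char_poly (diag_block nu i A)) [0..<length nu]"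

lemma length_block_char_polys [simp]: "length (block_char_polys nu A) = length nu"
  by (simp add: block_char_polys_def)

lemma nth_block_char_polys [simp]:
  "i < length nu \<Longrightarrow> block_char_polys nu A ! i = char_poly (diag_block nu i A)"
  by (simp add: block_char_polys_def)

lemma map_degree_block_char_polys [simp]: "map degree (block_char_polys nu A) = nu"
  by (rule nth_equalityI) (auto simp: degree_monic_char_poly[OF diag_block_closed])

lemma char_poly_block_char_polys:
  assumes "A \<in> carrier_mat (sum_list nu) (sum_list nu)" "block_upper nu A"
  shows "char_poly A = prod_list (block_char_polys nu A)"
  unfolding char_poly_block_upper[OF assms] block_char_polys_def
  using prod.distinct_set_conv_list[of "[0..<length nu]" "\<lambda>i. char_poly (diag_block nu i A)"]
  by (simp add: atLeast0LessThan)

text \<open>Taking diagonal blocks is multiplicative on block triangular matrices, so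
  \<open>p\<close> conjugates each diagonal block separately. Hence the order of the factors is
  constant on the coset of a conjugator under the parabolic subgroup.\<close>

lemma block_char_polys_conjugate:
  fixes p A :: "'a::{field,finite} mat"
  assumes p: "p \<in> carrier_mat (sum_list nu) (sum_list nu)" "block_upper nu p"
    and A: "A \<in> carrier_mat (sum_list nu) (sum_list nu)" "block_upper nu A"
    and q: "q \<in> carrier_mat (sum_list nu) (sum_list nu)" "p * q = 1\<^sub>m (sum_list nu)" "q * p = 1\<^sub>m (sum_list nu)"
  shows "block_upper nu (p * A * q) \<and> block_char_polys nu (p * A * q) = block_char_polys nu A"
proof -
  let ?n = "sum_list nu"
  have uq: "block_upper nu q" using block_upper_inverse[OF p q(1,3)] .
  have pA: "p * A \<in> carrier_mat ?n ?n" "block_upper nu (p * A)"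
    using p A block_upper_mult[OF p A] by auto
  have "char_poly (diag_block nu i (p * A * q)) = char_poly (diag_block nu i A)" if i: "i < length nu" for i
  proof (rule char_poly_similar)
    let ?d = "\<lambda>X. diag_block nu i X"
    have "?d p * ?d q = ?d (p * q)" "?d q * ?d p = ?d (q * p)"
      using block_upper_mult[OF p q(1) uq] block_upper_mult[OF q(1) uq p] i by auto
    then have "?d p * ?d q = 1\<^sub>m (nu ! i)" "?d q * ?d p = 1\<^sub>m (nu ! i)"
      using diag_block_one[OF i] q by simp_all
    moreover have "?d (p * A * q) = ?d p * ?d A * ?d q"
      using block_upper_mult[OF p A] block_upper_mult[OF pA q(1) uq] i by simp
    ultimately show "similar_mat (?d (p * A * q)) (?d A)"
      by (intro similar_matI[of _ _ "?d p" "?d q" "nu ! i"])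
        (auto intro!: mult_carrier_mat simp: carrier_matD[OF diag_block_closed])
  qed
  then have "block_char_polys nu (p * A * q) = block_char_polys nu A"
    by (intro nth_equalityI) auto
  then show ?thesis using block_upper_mult[OF pA q(1) uq] by blast
qed

lemma GL_closed: "g \<in> GL n \<Longrightarrow> g \<in> carrier_mat n n"
  by (simp add: GL_iff)

lemma GL_inverse:
  assumes "g \<in> GL n"
  obtains h where "h \<in> GL n" "h \<in> carrier_mat n n" "g * h = 1\<^sub>m n" "h * g = 1\<^sub>m n"
  using assms that unfolding GL_iff by blast

lemma conjugate_by_closed:
  assumes "x \<in> GL n" "g \<in> GL n"
  shows "conjugate_by n x g \<in> GL n"
proof -
  obtain y where y: "y \<in> GL n" "y \<in> carrier_mat n n" "x * y = 1\<^sub>m n" "y * x = 1\<^sub>m n"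
    using assms(1) by (rule GL_inverse)
  have "conjugate_by n x g = x * g * y"
    using GL_closed[OF assms(1)] y(2-4) by (rule conjugate_by_eq)
  then show ?thesis using assms y(1) by (simp add: GL_mult)
qed

lemma finite_GL [simp]: "finite (GL n :: 'a::{field,finite} mat set)"
  by (rule finite_subset[of _ "carrier_mat n n"]) (auto simp: GL_closed)

lemma card_parabolic_pos: "0 < card (parabolic nu :: 'a::{field,finite} mat set)"
proof -
  have "1\<^sub>m (sum_list nu) \<in> (parabolic nu :: 'a mat set)"
    by (auto simp: parabolic_eq block_upper_one GL_iff intro!: bexI[of _ "1\<^sub>m (sum_list nu)"])
  moreover have "finite (parabolic nu :: 'a mat set)" by (simp add: parabolic_eq)
  ultimately show ?thesis by (auto simp: card_gt_0_iff)
qed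

lemma char_poly_conjugate_by:
  assumes "x \<in> GL n" "g \<in> GL n"
  shows "char_poly (conjugate_by n x g) = char_poly g"
proof -
  obtain y where y: "y \<in> carrier_mat n n" "x * y = 1\<^sub>m n" "y * x = 1\<^sub>m n"
    using assms GL_inverse by metis
  have x: "x \<in> carrier_mat n n" and g: "g \<in> carrier_mat n n" using assms by (auto intro: GL_closed)
  have "conjugate_by n x g = x * g * y" using x y by (rule conjugate_by_eq)
  then have "similar_mat (conjugate_by n x g) g"
    using mult_carrier_mat[OF mult_carrier_mat[OF x g] y(1)] x g y
    by (intro similar_matI[of _ _ x y n]) auto
  then show ?thesis by (rule char_poly_similar)
qed

text \<open>The conjugating elements form a single coset of the parabolic subgroup, because a
  \<open>g\<close>-stable flag is determined by the characteristic polynomials on its successive quotients.\<close>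

lemma card_conjugators:
  fixes g :: "'a::{field,finite} mat"
  assumes g: "g \<in> GL (sum_list nu)" and nu: "map degree ks = nu"
    and ks: "distinct ks" "\<And>k. k \<in> set ks \<Longrightarrow> irreducible k \<and> lead_coeff k = 1"
    and char: "char_poly g = prod_list ks"
  shows "card {x \<in> GL (sum_list nu). conjugate_by (sum_list nu) x g \<in> parabolic nu \<and>
      block_char_polys nu (conjugate_by (sum_list nu) x g) = ks} = card (parabolic nu :: 'a mat set)"
    (is "card ?X = _")
proof -
  let ?n = "sum_list nu"
  let ?C = "diag_block_mat (map (\<lambda>k. companion (degree k) k) ks)"
  have gc: "g \<in> carrier_mat ?n ?n" using g by (rule GL_closed)
  have C: "?C \<in> carrier_mat ?n ?n" "block_upper nu ?C"
    "\<And>i. i < length ks \<Longrightarrow> diag_block nu i ?C = companion (degree (ks ! i)) (ks ! i)"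
    using block_diagonal_companions[of ks] nu by auto
  have len: "length nu = length ks" using nu by auto
  have bC: "block_char_polys nu ?C = ks"
  proof (rule nth_equalityI)
    fix i assume "i < length (block_char_polys nu ?C)"
    then have i: "i < length ks" using len by simp
    then have "irreducible (ks ! i)" "lead_coeff (ks ! i) = 1" using ks(2) by auto
    then show "block_char_polys nu ?C ! i = ks ! i"
      using i len C(3)[OF i] char_poly_companion[OF refl, of "ks ! i"] irreducible_poly_degree_pos[of "ks ! i"]
      by simp
  qed (use len in simp)
  have "char_poly ?C = char_poly g"
    using char_poly_block_char_polys[OF C(1,2)] bC char by simp
  moreover have "char_poly g = \<Prod>(set ks)"
    using char ks(1) prod.distinct_set_conv_list[of ks "\<lambda>x. x"] by simp
  ultimately have "similar_mat ?C g"
    using ks(2) C gc by (intro similar_of_char_poly_eq[of _ ?n _ "set ks"]) auto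
  \<comment> \<open>The base point of the coset: \<open>x0\<close> conjugates \<open>g\<close> to
    the model \<open>?C\<close>, whose blocks carry \<open>ks\<close> in the right order.\<close>
  then obtain x0 y0 where x0: "x0 \<in> carrier_mat ?n ?n" "y0 \<in> carrier_mat ?n ?n"
    "x0 * y0 = 1\<^sub>m ?n" "y0 * x0 = 1\<^sub>m ?n" "?C = x0 * g * y0"
    using similar_matD[of ?C g] C(1) by (smt (verit) carrier_matD(1) insert_subset)
  have x0_GL: "x0 \<in> GL ?n" "y0 \<in> GL ?n" using x0 by (auto simp: GL_iff)
  have conj_x0: "conjugate_by ?n x0 g = ?C" using x0 conjugate_by_eq by metis
  have conj_mult: "conjugate_by ?n (p * x0) g = p * ?C * q"
    if "p \<in> carrier_mat ?n ?n" "q \<in> carrier_mat ?n ?n" "p * q = 1\<^sub>m ?n" "q * p = 1\<^sub>m ?n" for p q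
  proof -
    have a: "A * B * D = A * (B * D)" if "A \<in> carrier_mat ?n ?n" "B \<in> carrier_mat ?n ?n" "D \<in> carrier_mat ?n ?n"
      for A B D :: "'a mat" using that by (rule assoc_mult_mat)
    have "(p * x0) * (y0 * q) = p * ((x0 * y0) * q)" using that(1,2) x0(1,2) by (simp add: a)
    also have "\<dots> = 1\<^sub>m ?n" using that x0 by simp
    finally have 1: "(p * x0) * (y0 * q) = 1\<^sub>m ?n" .
    have "(y0 * q) * (p * x0) = y0 * ((q * p) * x0)" using that(1,2) x0(1,2) by (simp add: a)
    also have "\<dots> = 1\<^sub>m ?n" using that x0 by simp
    finally have 2: "(y0 * q) * (p * x0) = 1\<^sub>m ?n" .
    have "conjugate_by ?n (p * x0) g = (p * x0) * g * (y0 * q)"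
      using 1 2 that x0(1,2) by (intro conjugate_by_eq) auto
    also have "\<dots> = p * (x0 * g * y0) * q" using that(1,2) x0(1,2) gc by (simp add: a)
    finally show ?thesis unfolding x0(5)[symmetric] .
  qed
  have "bij_betw (\<lambda>p. p * x0) (parabolic nu) ?X"
  proof (rule bij_betwI[where g = "\<lambda>x. x * y0"])
    show "(\<lambda>p. p * x0) \<in> parabolic nu \<rightarrow> ?X"
    proof
      fix p :: "'a mat" assume p: "p \<in> parabolic nu"
      then obtain q where q: "q \<in> carrier_mat ?n ?n" "p * q = 1\<^sub>m ?n" "q * p = 1\<^sub>m ?n"
        by (auto simp: parabolic_eq elim: GL_inverse)
      have pc: "p \<in> carrier_mat ?n ?n" "block_upper nu p" and pGL: "p \<in> GL ?n"
        using p by (auto simp: parabolic_eq GL_closed)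
      have "p * x0 \<in> GL ?n" using pGL x0_GL by (intro GL_mult)
      then show "p * x0 \<in> ?X"
        using conj_mult[OF pc(1) q] block_char_polys_conjugate[OF pc C(1,2) q] bC
          conjugate_by_closed[OF _ g, of "p * x0"] by (simp add: parabolic_eq)
    qed
    show "(\<lambda>x. x * y0) \<in> ?X \<rightarrow> parabolic nu"
    proof
      fix x assume x: "x \<in> ?X"
      let ?A = "conjugate_by ?n x g" and ?z = "x * y0"
      have xGL: "x \<in> GL ?n" using x by simp
      then have xc: "x \<in> carrier_mat ?n ?n" by (rule GL_closed)
      obtain y where y: "y \<in> carrier_mat ?n ?n" "x * y = 1\<^sub>m ?n" "y * x = 1\<^sub>m ?n"
        using xGL by (rule GL_inverse)
      have A_eq: "?A = x * g * y" using xc y conjugate_by_eq by metis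
      have Ac: "?A \<in> carrier_mat ?n ?n" "block_upper nu ?A"
        using x by (auto simp: parabolic_eq GL_closed)
      have a: "A * B * D = A * (B * D)" if "A \<in> carrier_mat ?n ?n" "B \<in> carrier_mat ?n ?n" "D \<in> carrier_mat ?n ?n"
        for A B D :: "'a mat" using that by (rule assoc_mult_mat)
      \<comment> \<open>As \<open>x\<close> conjugates \<open>g\<close> to \<open>?A\<close> and
        \<open>x0\<close> conjugates it to \<open>?C\<close>, the quotient \<open>?z\<close>
        intertwines the two, so it inherits the block shape.\<close>
      have "?z * ?C = x * ((y0 * x0) * (g * y0))" unfolding x0(5) using xc x0(1,2) gc by (simp add: a)
      also have "\<dots> = x * g * ((y * x) * y0)" using xc x0 gc y by (simp add: a)
      also have "\<dots> = ?A * ?z" unfolding A_eq using xc x0(1,2) gc y(1) by (simp add: a)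
      finally have comm: "?z * ?C = ?A * ?z" .
      have zGL: "?z \<in> GL ?n" using xGL x0_GL by (intro GL_mult)
      have "block_upper nu ?z"
      proof (rule block_upper_intertwiner[OF C(1,2) Ac _ comm])
        show "distinct ks" "length ks = length nu" using ks len by auto
        show "irreducible (ks ! i) \<and> lead_coeff (ks ! i) = 1" if "i < length nu" for i
          using that ks(2) len by simp
        show "char_poly (diag_block nu i ?C) = ks ! i" if "i < length nu" for i
          using that bC nth_block_char_polys by metis
        show "char_poly (diag_block nu i ?A) = ks ! i" if "i < length nu" for i
          using that x nth_block_char_polys[OF that, of ?A] by simp
      qed (use zGL GL_closed in blast)
      then show "?z \<in> parabolic nu" using zGL by (simp add: parabolic_eq)
    qed
    show "p * x0 * y0 = p" if "p \<in> parabolic nu" for p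
    proof -
      have "p \<in> carrier_mat ?n ?n" using that by (simp add: parabolic_eq GL_closed)
      then show ?thesis using x0 assoc_mult_mat[of p ?n ?n x0 ?n y0 ?n] by simp
    qed
    show "x * y0 * x0 = x" if "x \<in> ?X" for x
    proof -
      have "x \<in> carrier_mat ?n ?n" using that by (simp add: GL_closed)
      then show ?thesis using x0 assoc_mult_mat[of x ?n ?n y0 ?n x0 ?n] by simp
    qed
  qed
  then show ?thesis by (simp add: bij_betw_same_card)
qed

subsection \<open>Roots of irreducible polynomials in an extension\<close>

text \<open>Multiplication by a nonzero \<open>x\<close> permutes the nonzero elements and therefore
  preserves their product.\<close>

lemma finite_field_power_CARD:
  fixes x :: "'a::{field,finite}"
  shows "x ^ CARD('a) = x"
proof (cases "x = 0")
  case False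
  have card: "Suc (card (UNIV - {0 :: 'a})) = CARD('a)"
    by (simp add: card_Diff_singleton Suc_diff_Suc)
  have "(\<Prod>y\<in>UNIV - {0}. x * y) = (\<Prod>y\<in>UNIV - {0}. y)"
    by (rule prod.reindex_bij_witness[of _ "\<lambda>y. y / x" "\<lambda>y. x * y"]) (use False in auto)
  then have "x ^ card (UNIV - {0 :: 'a}) * \<Prod>(UNIV - {0}) = 1 * \<Prod>(UNIV - {0 :: 'a})"
    by (simp add: prod.distrib)
  moreover have "\<Prod>(UNIV - {0 :: 'a}) \<noteq> 0" by simp
  ultimately have "x ^ card (UNIV - {0 :: 'a}) = 1" by (metis mult_right_cancel)
  then have "x * x ^ card (UNIV - {0 :: 'a}) = x" by (simp only: mult_1_right)
  then have "x ^ Suc (card (UNIV - {0 :: 'a})) = x" by (simp only: power_Suc)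
  then show ?thesis by (simp only: card)
qed (simp add: power_0_left)

text \<open>It suffices that every prime divisor \<open>r\<close> of the order equals the
  characteristic. The additive group has a subgroup of order \<open>r\<close>, and \<open>r\<close>
  annihilates a nonzero element of it.\<close>

lemma CARD_finite_field:
  obtains e where "CARD('a::{field,finite}) = CHAR('a) ^ e"
proof -
  let ?G = "\<lparr>carrier = UNIV :: 'a set, mult = (+), one = 0\<rparr>"
  have G: "group ?G"
    by (rule groupI) (auto simp: add.assoc intro: exI[of _ "- _"] left_minus)
  have p: "prime CHAR('a)"
    using prime_CHAR_semidom finite_imp_CHAR_pos[where 'a = 'a] by auto
  have only: "r = CHAR('a)" if r: "prime r" "r dvd CARD('a)" for r
  proof -
    \<comment> \<open>The exponent 1 reduces Sylow's theorem to Cauchy's; \<open>r\<close> may still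
      divide \<open>m\<close>.\<close>
    obtain m where "CARD('a) = r ^ 1 * m" using r(2) by auto
    then have "order ?G = r ^ 1 * m" by (simp add: order_def)
    then obtain H where H: "subgroup H ?G" "card H = r"
      using sylow_thm[OF r(1) G, of 1 m] by auto
    have "H \<noteq> {0}" using H(2) prime_gt_1_nat[OF r(1)] by auto
    moreover have "0 \<in> H" using subgroup.one_closed[OF H(1)] by simp
    ultimately obtain x where x: "x \<in> H" "x \<noteq> 0" by auto
    \<comment> \<open>Translation by \<open>x\<close> permutes \<open>H\<close>, so comparing the
      sum over \<open>H\<close> before and after translation gives \<open>r x = 0\<close>.\<close>
    have "(+) x ` H = H"
    proof (rule endo_inj_surj)
      show "(+) x ` H \<subseteq> H" using subgroup.m_closed[OF H(1) x(1)] by auto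
    qed auto
    then have "\<Sum>H = (\<Sum>y\<in>(+) x ` H. y)" by simp
    also have "\<dots> = of_nat r * x + \<Sum>H" using H(2) by (simp add: sum.reindex sum.distrib)
    finally have "of_nat r = (0 :: 'a)" using x(2) by simp
    then have "CHAR('a) dvd r" by (simp add: of_nat_eq_0_iff_char_dvd)
    then show ?thesis using primes_dvd_imp_eq[of "CHAR('a)" r] p r(1) by simp
  qed
  have "CARD('a) \<noteq> 0" by simp
  then obtain m where m: "CARD('a) = CHAR('a) ^ multiplicity CHAR('a) CARD('a) * m" "\<not> CHAR('a) dvd m"
    using multiplicity_decompose'[of "CARD('a)" "CHAR('a)"] p by (metis not_prime_unit)
  have "m = 1"
  proof (rule ccontr)
    assume "m \<noteq> 1"
    then obtain r where "prime r" "r dvd m" using prime_factor_nat by blast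
    then have "r = CHAR('a)" using only[of r] m(1) by (metis dvd_mult)
    then show False using m(2) \<open>r dvd m\<close> by blast
  qed
  with m that show ?thesis by simp
qed

locale finite_field_extension = field_hom iota
  for iota :: "'a::{field,finite} \<Rightarrow> 'b::{field,finite}" +
  fixes q :: nat
  assumes q: "CARD('a) = q"
begin

lemma q_gt_1: "1 < q"
proof -
  have "card {0, 1 :: 'a} \<le> CARD('a)" by (rule card_mono) auto
  then show ?thesis using q by simp
qed

text \<open>The embedding forces both fields to have the same characteristic, so \<open>q\<close> is
  a power of the characteristic of the extension.\<close>

lemma frobenius_add: "(x + y :: 'b) ^ q = x ^ q + y ^ q"
proof -
  obtain e where e: "CARD('a) = CHAR('a) ^ e" by (rule CARD_finite_field)
  have pa: "prime CHAR('a)" and pb: "prime CHAR('b)"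
    using prime_CHAR_semidom finite_imp_CHAR_pos[where 'a = 'a] finite_imp_CHAR_pos[where 'a = 'b] by auto
  have "of_nat CHAR('a) = iota (of_nat CHAR('a))" by (simp only: hom_of_nat)
  also have "\<dots> = 0" by simp
  finally have "CHAR('b) dvd CHAR('a)" by (simp only: of_nat_eq_0_iff_char_dvd)
  then have "CHAR('b) = CHAR('a)" using pa pb by (simp add: primes_dvd_imp_eq)
  then show ?thesis using freshmans_dream'[OF pb, of q e] e q by simp
qed

lemma frobenius_inj: "x ^ q = y ^ q \<Longrightarrow> x = (y :: 'b)"
  using frobenius_add[of y "x - y"] q_gt_1 by auto

lemma frobenius_pow_inj: "x ^ q ^ i = y ^ q ^ i \<Longrightarrow> x = (y :: 'b)"
  by (induction i) (auto simp: power_mult mult.commute[of q] dest: frobenius_inj)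

lemma frobenius_iota: "iota a ^ q = iota a"
  using finite_field_power_CARD[of a] q by (metis hom_power)

lemma frobenius_poly: "poly (map_poly iota p) (x ^ q) = poly (map_poly iota p) x ^ q"
  by (induction p) (use q_gt_1 in \<open>auto simp: frobenius_add frobenius_iota power_mult_distrib map_poly_pCons\<close>)

lemma map_poly_iota_add: "map_poly iota (p + r) = map_poly iota p + map_poly iota r"
  by (rule poly_eqI) (simp add: coeff_map_poly hom_add)

lemma map_poly_iota_mult: "map_poly iota (p * r) = map_poly iota p * map_poly iota r"
  by (rule poly_eqI) (simp add: coeff_map_poly coeff_mult hom_sum hom_mult)

text \<open>The polynomial \<open>z^q - z\<close> has at most \<open>q\<close> roots, and the image
  of \<open>iota\<close> already provides \<open>q\<close> of them.\<close>

lemma frobenius_fixed_iff: "x ^ q = x \<longleftrightarrow> x \<in> range iota"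
proof -
  define p where "p = monom (1 :: 'b) q - [:0, 1:]"
  have deg: "degree p = q" unfolding p_def using q_gt_1
    unfolding diff_conv_add_uminus by (subst degree_add_eq_left) (auto simp: degree_monom_eq)
  then have "p \<noteq> 0" using q_gt_1 by auto
  have roots: "{x. poly p x = 0} = {x. x ^ q = x}" by (auto simp: p_def poly_monom)
  have "card {x :: 'b. x ^ q = x} \<le> q"
    using card_poly_roots_bound[OF \<open>p \<noteq> 0\<close>] deg roots by simp
  moreover have "card (range iota) = q" using card_image[of iota UNIV] inj_f q by simp
  ultimately have "range iota = {x. x ^ q = x}"
    using card_seteq[of "{x :: 'b. x ^ q = x}" "range iota"] frobenius_iota by auto
  then show ?thesis by auto
qed

text \<open>The monic polynomial with the orbit as its set of simple roots is fixed by Frobenius, so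
  it comes from the ground field and is a multiple of \<open>h\<close>. Thus the degree of
  \<open>h\<close> is at most the size of the orbit, which is at most the number of roots, which is
  at most the degree; separability of \<open>h\<close> falls out of this chain.\<close>

lemma root_orbit:
  assumes h: "irreducible h" and \<beta>: "poly (map_poly iota h) \<beta> = 0"
  shows "{x. poly (map_poly iota h) x = 0} = range (\<lambda>i. \<beta> ^ q ^ i)"
    and "card (range (\<lambda>i. \<beta> ^ q ^ i)) = degree h"
proof -
  let ?O = "range (\<lambda>i. \<beta> ^ q ^ i)" and ?Z = "{x. poly (map_poly iota h) x = 0}"
  have "h \<noteq> 0" using h by auto
  then have h0: "map_poly iota h \<noteq> 0" by simp
  have "poly (map_poly iota h) (\<beta> ^ q ^ i) = 0" for i
  proof (induction i)
    case (Suc i)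
    then show ?case using frobenius_poly[of h "\<beta> ^ q ^ i"] q_gt_1 by (simp add: mult.commute[of q] power_mult)
  qed (use \<beta> in simp)
  then have sub: "?O \<subseteq> ?Z" by auto
  have cardZ: "card ?Z \<le> degree h"
    using card_poly_roots_bound[OF h0] by simp
  \<comment> \<open>An injective self-map of a finite set is onto, so Frobenius permutes the orbit
    and the coefficients of \<open>R\<close> are fixed.\<close>
  have frobO: "(\<lambda>x. x ^ q) ` ?O = ?O"
  proof (rule endo_inj_surj)
    show "(\<lambda>x. x ^ q) ` ?O \<subseteq> ?O"
    proof safe
      fix i show "(\<beta> ^ q ^ i) ^ q \<in> ?O"
        by (rule range_eqI[of _ _ "Suc i"]) (simp add: mult.commute[of q] power_mult)
    qed
  qed (auto intro: inj_onI frobenius_inj)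
  define R where "R = (\<Prod>x\<in>?O. [:- x, 1:])"
  have degR: "degree R = card ?O" unfolding R_def by (subst degree_prod_eq_sum_degree) auto
  have "\<exists>r. R = map_poly iota r"
  proof -
    interpret F: comm_ring_hom "\<lambda>x :: 'b. x ^ q"
      by unfold_locales (use q_gt_1 in \<open>auto simp: frobenius_add power_mult_distrib\<close>)
    interpret FP: map_poly_comm_ring_hom "\<lambda>x :: 'b. x ^ q" ..
    have neg: "(- x) ^ q = - (x ^ q)" for x :: 'b by (rule F.hom_uminus)
    have "map_poly (\<lambda>x. x ^ q) R = (\<Prod>x\<in>?O. [:- (x ^ q), 1:])"
      unfolding R_def FP.hom_prod using q_gt_1 by (simp add: map_poly_pCons neg)
    also have "\<dots> = (\<Prod>x\<in>(\<lambda>x. x ^ q) ` ?O. [:- x, 1:])"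
      by (subst prod.reindex) (auto intro: inj_onI frobenius_inj)
    also have "\<dots> = R" unfolding frobO R_def ..
    finally have fix_R: "map_poly (\<lambda>x. x ^ q) R = R" .
    have "coeff R i ^ q = coeff R i" for i
      using arg_cong[OF fix_R, of "\<lambda>p. coeff p i"] q_gt_1 by (simp add: coeff_map_poly)
    then have range: "coeff R i \<in> range iota" for i using frobenius_fixed_iff by blast
    have inv0: "inv_into UNIV iota 0 = 0" using inv_f_f[of 0] by simp
    have "R = map_poly iota (map_poly (inv_into UNIV iota) R)"
      by (rule poly_eqI) (use range in \<open>simp add: coeff_map_poly inv0 f_inv_into_f\<close>)
    then show ?thesis by blast
  qed
  then obtain r where r: "R = map_poly iota r" by blast
  have "poly R \<beta> = 0" unfolding R_def
    by (auto simp: poly_prod intro!: bexI[of _ \<beta>] range_eqI[of _ _ 0])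
  have "h dvd r"
  proof (rule ccontr)
    assume "\<not> h dvd r"
    then obtain x y where xy: "x * h + y * r = 1" using irreducible_bezout h by blast
    have "poly (map_poly iota (x * h + y * r)) \<beta> = 1" unfolding xy by simp
    then have "poly (map_poly iota x) \<beta> * poly (map_poly iota h) \<beta>
        + poly (map_poly iota y) \<beta> * poly (map_poly iota r) \<beta> = 1"
      by (simp only: map_poly_iota_add map_poly_iota_mult poly_add poly_mult)
    then show False using \<beta> \<open>poly R \<beta> = 0\<close> unfolding r by (simp only: mult_zero_right add_0_left zero_neq_one)
  qed
  moreover have "r \<noteq> 0" using r unfolding R_def by auto
  ultimately have "degree h \<le> degree r" by (rule dvd_imp_degree_le)
  also have "degree r = card ?O" using degR r by simp
  finally have "degree h \<le> card ?O" .
  moreover have "card ?O \<le> card ?Z" by (rule card_mono) (use sub in auto)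
  ultimately show card: "card ?O = degree h" using cardZ by simp
  show "?Z = ?O" using card_seteq[of ?Z ?O] sub cardZ card by auto
qed

text \<open>The orbit has \<open>degree h\<close> elements, so there is no shorter period and the
  listed powers are distinct. The range starts at 1 to agree with Green's sum; the second part puts
  every root in the subfield with \<open>q ^ degree h\<close> elements.\<close>

lemma root_enumeration:
  assumes h: "irreducible h" and \<beta>: "poly (map_poly iota h) \<beta> = 0"
  shows "bij_betw (\<lambda>i. \<beta> ^ q ^ i) {1..degree h} {x. poly (map_poly iota h) x = 0}"
    and "\<beta> ^ q ^ degree h = \<beta>"
proof -
  let ?k = "degree h" and ?O = "range (\<lambda>i. \<beta> ^ q ^ i)"
  note orbit = root_orbit[OF assms]
  have add: "\<beta> ^ q ^ (i + j) = (\<beta> ^ q ^ i) ^ q ^ j" for i j by (simp add: power_add power_mult)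
  have period: "?k \<le> t" if t: "0 < t" "\<beta> ^ q ^ t = \<beta>" for t
  proof -
    have "\<beta> ^ q ^ (t * j) = \<beta>" for j
      by (induction j) (simp_all add: add t(2))
    then have "\<beta> ^ q ^ i = \<beta> ^ q ^ (i mod t)" for i
      using add[of "t * (i div t)" "i mod t"] by simp
    then have "?O \<subseteq> (\<lambda>i. \<beta> ^ q ^ i) ` {..<t}" using t(1) by (metis image_subsetI imageI lessThan_iff mod_less_divisor)
    then have "card ?O \<le> card {..<t}" by (meson card_image_le card_mono finite_imageI finite_lessThan le_trans)
    then show ?thesis using orbit by simp
  qed
  have eq: "?k \<le> j - i" if "i < j" "\<beta> ^ q ^ i = \<beta> ^ q ^ j" for i j
  proof (rule period)
    have "(\<beta> ^ q ^ (j - i)) ^ q ^ i = \<beta> ^ q ^ i" using that add[of "j - i" i] by simp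
    then show "\<beta> ^ q ^ (j - i) = \<beta>" by (rule frobenius_pow_inj)
  qed (use that in simp)
  have inj: "inj_on (\<lambda>i. \<beta> ^ q ^ i) {1..?k}"
  proof (rule inj_onI)
    fix i j assume "i \<in> {1..?k}" "j \<in> {1..?k}" "\<beta> ^ q ^ i = \<beta> ^ q ^ j"
    then show "i = j" using eq[of i j] eq[of j i] by (cases i j rule: linorder_cases) auto
  qed
  have "(\<lambda>i. \<beta> ^ q ^ i) ` {1..?k} = ?O"
    by (rule card_subset_eq) (use inj orbit in \<open>auto simp: card_image\<close>)
  with inj show "bij_betw (\<lambda>i. \<beta> ^ q ^ i) {1..?k} {x. poly (map_poly iota h) x = 0}"
    unfolding orbit by (simp add: bij_betw_def)
  \<comment> \<open>The root \<beta> itself occurs in the list at some index \<open>i\<close>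
    between 1 and \<open>?k\<close>; this \<open>i\<close> is a period, hence at least
    \<open>?k\<close>, hence equal to it.\<close>
  have "\<beta> \<in> ?O" by (rule range_eqI[of _ _ 0]) simp
  then obtain i where i: "i \<in> {1..?k}" "\<beta> = \<beta> ^ q ^ i"
    using \<open>(\<lambda>i. \<beta> ^ q ^ i) ` {1..?k} = ?O\<close> by (metis imageE)
  then have "?k \<le> i" using eq[of 0 i] by simp
  then show "\<beta> ^ q ^ ?k = \<beta>" using i by simp
qed

text \<open>Since \<open>theta\<close> is controlled only on nonzero arguments, the root 0 has to be
  excluded first, which is where \<open>h\<close> differs from \<open>z\<close>. Then
  \<open>theta\<close> turns Frobenius powers into powers, and the subfield condition holds for
  every root.\<close>

lemma sum_roots:
  fixes theta :: "'b \<Rightarrow> complex"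
  assumes theta: "\<And>x. x \<noteq> 0 \<Longrightarrow> theta x \<noteq> 0"
      "\<And>x y. x \<noteq> 0 \<Longrightarrow> y \<noteq> 0 \<Longrightarrow> theta (x * y) = theta x * theta y"
    and h: "h \<in> irr_polys" and \<beta>: "poly (map_poly iota h) \<beta> = 0"
  shows "(\<Sum>x\<in>{x \<in> subfield_of_order_pow q (degree h). poly (map_poly iota h) x = 0}. theta x powi b)
    = (\<Sum>i=1..degree h. theta \<beta> powi (int q ^ i * b))"
proof -
  have irr: "irreducible h" and mon: "lead_coeff h = 1" and ne: "h \<noteq> [:0, 1:]"
    using h by (auto simp: irr_polys_def)
  have "\<beta> \<noteq> 0"
  proof
    assume "\<beta> = 0"
    then have "iota (coeff h 0) = 0" using \<beta> by (simp add: poly_0_coeff_0)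
    then have "[:0, 1:] dvd h" using poly_eq_0_iff_dvd[of h 0] by (simp add: poly_0_coeff_0)
    moreover have "irreducible [:0, 1 :: 'a:]" by (rule irreducible_linear_field_poly) simp
    ultimately have "[:0, 1:] = h" using irr mon by (intro irreducible_monic_dvd_eq) auto
    then show False using ne by simp
  qed
  have "theta 1 = theta 1 * theta 1" using theta(2)[of 1 1] by simp
  then have theta_1: "theta 1 = 1" using theta(1)[of 1] by simp
  have theta_pow: "theta (\<beta> ^ k) = theta \<beta> ^ k" for k
    by (induction k) (auto simp: theta_1 theta(2) \<open>\<beta> \<noteq> 0\<close>)
  have "{x \<in> subfield_of_order_pow q (degree h). poly (map_poly iota h) x = 0}
      = {x. poly (map_poly iota h) x = 0}"
    using root_enumeration(2)[OF irr] by (auto simp: subfield_of_order_pow_def)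
  then have "(\<Sum>x\<in>{x \<in> subfield_of_order_pow q (degree h). poly (map_poly iota h) x = 0}. theta x powi b)
      = (\<Sum>i=1..degree h. theta (\<beta> ^ q ^ i) powi b)"
    using sum.reindex_bij_betw[OF root_enumeration(1)[OF irr \<beta>], of "\<lambda>x. theta x powi b"] by simp
  also have "\<dots> = (\<Sum>i=1..degree h. theta \<beta> powi (int q ^ i * b))"
    by (rule sum.cong) (simp_all add: theta_pow power_int_mult flip: of_nat_power)
  finally show ?thesis .
qed

end

subsection \<open>Arrangements and partitions\<close>

lemma monic_unit_eq_1:
  fixes p :: "'a::field poly"
  assumes "is_unit p" "lead_coeff p = 1"
  shows "p = 1"
proof -
  obtain c where "p = [:c:]" using assms(1) by (rule is_unit_polyE)
  then show ?thesis using assms(2) by (simp add: one_pCons)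
qed

lemma irreducible_monic_dvd_prod_imp_mem:
  fixes H :: "'a::field poly set"
  assumes "finite H" "\<And>h. h \<in> H \<Longrightarrow> irreducible h \<and> lead_coeff h = 1"
    and "irreducible k" "lead_coeff k = 1" "k dvd \<Prod>H"
  shows "k \<in> H"
proof -
  obtain h where "h \<in> H" "k dvd h"
    using irreducible_dvd_prod[OF assms(1,3), of "\<lambda>x. x"] assms(5) by blast
  then show ?thesis using irreducible_monic_dvd_eq[of k h] assms by blast
qed

text \<open>Unique factorisation in the squarefree case. Distinctness results because each entry,
  once matched, is removed from \<open>H\<close> in the induction.\<close>

lemma prod_list_irreducible_eq:
  fixes H :: "'a::field poly set"
  assumes "finite H" "\<And>h. h \<in> H \<Longrightarrow> irreducible h \<and> lead_coeff h = 1"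
    and "\<And>k. k \<in> set ks \<Longrightarrow> irreducible k \<and> lead_coeff k = 1" "prod_list ks = \<Prod>H"
  shows "distinct ks \<and> set ks = H"
  using assms
proof (induction ks arbitrary: H)
  case Nil
  have "H = {}"
  proof (rule ccontr)
    assume "H \<noteq> {}"
    then obtain h where h: "h \<in> H" by blast
    then have "h dvd \<Prod>H" using dvd_prodI[OF Nil.prems(1) h, of "\<lambda>x. x"] by simp
    then have "is_unit h" using Nil.prems(4) by simp
    then show False using Nil.prems(2)[OF h] irreducible_not_unit by blast
  qed
  then show ?case by simp
next
  case (Cons k ks)
  have k: "irreducible k" "lead_coeff k = 1" using Cons.prems(3) by auto
  have "k dvd \<Prod>H" using Cons.prems(4) by (metis dvd_triv_left prod_list.Cons)
  then have kH: "k \<in> H" using irreducible_monic_dvd_prod_imp_mem Cons.prems(1,2) k by blast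
  then have "k * prod_list ks = k * \<Prod>(H - {k})"
    using Cons.prems(1,4) prod.remove[of H k "\<lambda>x. x"] by simp
  moreover have "k \<noteq> 0" using k by auto
  ultimately have "prod_list ks = \<Prod>(H - {k})" by simp
  then have "distinct ks \<and> set ks = H - {k}"
    using Cons.prems by (intro Cons.IH) auto
  then show ?case using kH by auto
qed

text \<open>It makes the characteristic polynomial of a diagonal block squarefree again, since that
  polynomial divides the one of \<open>g\<close>.\<close>

lemma monic_dvd_prod_irreducible:
  fixes H :: "'a::field poly set"
  assumes "finite H" "\<And>h. h \<in> H \<Longrightarrow> irreducible h \<and> lead_coeff h = 1"
    and "lead_coeff p = 1" "p dvd \<Prod>H"
  shows "\<exists>H'\<subseteq>H. p = \<Prod>H'"
  using assms
proof (induction H arbitrary: p rule: finite_induct)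
  case empty
  then have "p = 1" by (intro monic_unit_eq_1) auto
  then show ?case by simp
next
  case (insert h H)
  have h: "irreducible h" "lead_coeff h = 1" using insert.prems by auto
  have dvd: "p dvd h * \<Prod>H" using insert by simp
  show ?case
  proof (cases "h dvd p")
    case True
    then obtain p' where p': "p = h * p'" by (rule dvdE)
    moreover have "h \<noteq> 0" using h by auto
    ultimately have "p' dvd \<Prod>H" using dvd by simp
    moreover have "lead_coeff p' = 1" using insert.prems(2) p' h by (simp add: lead_coeff_mult)
    ultimately obtain H' where "H' \<subseteq> H" "p' = \<Prod>H'" using insert.IH insert.prems(1) by blast
    moreover from this have "finite H'" "h \<notin> H'" using insert.hyps finite_subset by auto
    ultimately show ?thesis using p' by (intro exI[of _ "insert h H'"]) auto
  next
    case False
    \<comment> \<open>If \<open>h\<close> does not divide \<open>p\<close>, Bezout cancels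
      \<open>h\<close> from \<open>p dvd h * \<Prod>H\<close>.\<close>
    then obtain x y where "x * h + y * p = 1" using irreducible_bezout h(1) by blast
    then have "\<Prod>H = (x * h + y * p) * \<Prod>H" by simp
    also have "\<dots> = x * (h * \<Prod>H) + p * (y * \<Prod>H)" by (simp add: algebra_simps)
    finally have "p dvd \<Prod>H" using dvd_add[OF dvd_mult[OF dvd, of x] dvd_triv_left[of p "y * \<Prod>H"]] by simp
    then obtain H' where "H' \<subseteq> H" "p = \<Prod>H'" using insert.IH insert.prems by blast
    then show ?thesis by blast
  qed
qed

section \<open>Orders of a finite set with a prescribed sequence of keys\<close>

definition arrangements :: "'h set \<Rightarrow> ('h \<Rightarrow> 'k) \<Rightarrow> 'k list \<Rightarrow> 'h list set" where
  "arrangements H key ms = {ks. distinct ks \<and> set ks = H \<and> map key ks = ms}"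

text \<open>The head is chosen among the elements whose key is \<open>m\<close>, and the rest is
  arranged recursively. For each key the numbers of choices run down to 1, which yields the
  factorials.\<close>

lemma card_arrangements:
  assumes "finite H" "\<And>k. card {h \<in> H. key h = k} = count_list ms k"
  shows "card (arrangements H key ms) = (\<Prod>k\<in>set ms. fact (count_list ms k))"
  using assms
proof (induction ms arbitrary: H)
  case Nil
  have "H = {}"
  proof (rule ccontr)
    assume "H \<noteq> {}"
    then obtain h where "h \<in> H" by blast
    moreover have "{h' \<in> H. key h' = key h} = {}" using Nil.prems(1) Nil.prems(2)[of "key h"] by simp
    ultimately show False by blast
  qed
  then have "arrangements H key [] = {[]}" by (auto simp: arrangements_def)
  then show ?case by simp
next
  case (Cons m ms)
  let ?K = "{h \<in> H. key h = m}"
  have eq: "arrangements H key (m # ms) = (\<Union>h\<in>?K. (#) h ` arrangements (H - {h}) key ms)"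
  proof (rule Set.set_eqI)
    fix ks
    show "ks \<in> arrangements H key (m # ms) \<longleftrightarrow> ks \<in> (\<Union>h\<in>?K. (#) h ` arrangements (H - {h}) key ms)"
    proof (cases ks)
      case (Cons k ks')
      have "ks \<in> arrangements H key (m # ms) \<longleftrightarrow> k \<in> ?K \<and> ks' \<in> arrangements (H - {k}) key ms"
        unfolding Cons arrangements_def by auto
      also have "\<dots> \<longleftrightarrow> ks \<in> (\<Union>h\<in>?K. (#) h ` arrangements (H - {h}) key ms)"
        unfolding Cons by blast
      finally show ?thesis .
    next
      case Nil
      then show ?thesis unfolding arrangements_def by auto
    qed
  qed
  have fin: "finite (arrangements (H - {h}) key ms)" for h
  proof (rule finite_subset)
    show "arrangements (H - {h}) key ms \<subseteq> {ks. set ks \<subseteq> H \<and> length ks = length ms}"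
    proof
      fix ks assume "ks \<in> arrangements (H - {h}) key ms"
      then have "set ks = H - {h}" "ms = map key ks" by (simp_all add: arrangements_def)
      then show "ks \<in> {ks. set ks \<subseteq> H \<and> length ks = length ms}" by simp
    qed
  qed (rule finite_lists_length_eq[OF Cons.prems(1)])
  have IH: "card (arrangements (H - {h}) key ms) = (\<Prod>k\<in>set ms. fact (count_list ms k))" if h: "h \<in> ?K" for h
  proof (rule Cons.IH)
    fix k
    show "card {h' \<in> H - {h}. key h' = k} = count_list ms k"
    proof (cases "k = m")
      case True
      have "{h' \<in> H - {h}. key h' = k} = ?K - {h}" using True by auto
      then show ?thesis using h Cons.prems(1) Cons.prems(2)[of m] True by simp
    next
      case False
      then have "{h' \<in> H - {h}. key h' = k} = {h' \<in> H. key h' = k}" using h by auto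
      then show ?thesis using Cons.prems(2)[of k] False by simp
    qed
  qed (use Cons.prems in simp)
  have "card (arrangements H key (m # ms)) = (\<Sum>h\<in>?K. card ((#) h ` arrangements (H - {h}) key ms))"
    unfolding eq using Cons.prems(1) fin by (intro card_UN_disjoint) auto
  also have "\<dots> = (\<Sum>h\<in>?K. \<Prod>k\<in>set ms. fact (count_list ms k))"
  proof (rule sum.cong)
    fix h assume h: "h \<in> ?K"
    have "card ((#) h ` arrangements (H - {h}) key ms) = card (arrangements (H - {h}) key ms)"
      by (rule card_image) simp
    then show "card ((#) h ` arrangements (H - {h}) key ms) = (\<Prod>k\<in>set ms. fact (count_list ms k))"
      unfolding IH[OF h] .
  qed simp
  also have "\<dots> = Suc (count_list ms m) * (\<Prod>k\<in>set ms. fact (count_list ms k))"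
    using Cons.prems(2)[of m] by simp
  \<comment> \<open>If \<open>m\<close> does not occur in \<open>ms\<close>, enlarging the index set
    adds only the factor \<open>fact 0 = 1\<close>.\<close>
  also have "(\<Prod>k\<in>set ms. fact (count_list ms k)) = (\<Prod>k\<in>set (m # ms). fact (count_list ms k) :: nat)"
    by (rule prod.mono_neutral_left) (auto simp: count_list_0_iff)
  also have "\<dots> = fact (count_list ms m) * (\<Prod>k\<in>set ms - {m}. fact (count_list ms k))"
    by (simp add: prod.insert_remove)
  also have "Suc (count_list ms m) * \<dots> = fact (Suc (count_list ms m)) * (\<Prod>k\<in>set ms - {m}. fact (count_list ms k))"
    by (simp add: algebra_simps)
  also have "(\<Prod>k\<in>set ms - {m}. fact (count_list ms k)) = (\<Prod>k\<in>set ms - {m}. fact (count_list (m # ms) k) :: nat)"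
    by (rule prod.cong) auto
  also have "fact (Suc (count_list ms m)) * \<dots> = (\<Prod>k\<in>set (m # ms). fact (count_list (m # ms) k))"
    by (simp add: prod.insert_remove del: fact_Suc)
  finally show ?case .
qed

text \<open>Separates the multiplicity factorials, which will cancel against the number of
  arrangements, from the product of the parts, which stays in the final formula.\<close>

lemma z_part_eq:
  "z_part nu = prod_list nu * (\<Prod>k\<in>set nu. fact (count_list nu k))"
proof -
  have "prod_list nu = (\<Prod>k\<in>set nu. k ^ count_list nu k)"
    using prod_mset_multiplicity[of "mset nu"] by (simp add: prod_mset_prod_list count_mset)
  then show ?thesis by (simp add: z_part_def prod.distrib)
qed

lemma map_const_times_count:
  assumes "0 < (d :: nat)"
  shows "(\<Prod>k\<in>set (map ((*) d) nu). fact (count_list (map ((*) d) nu) k)) = (\<Prod>k\<in>set nu. fact (count_list nu k) :: nat)"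
proof -
  have inj: "inj ((*) d)" using assms by (auto intro: injI)
  have "count_list (map ((*) d) nu) (d * k) = count_list nu k" for k
    by (induction nu) (use assms in auto)
  moreover have "set (map ((*) d) nu) = (*) d ` set nu" by simp
  ultimately show ?thesis using inj by (simp add: prod.reindex inj_on_subset[OF inj])
qed

lemma finite_partitions: "finite (partitions n)"
proof (rule finite_subset)
  show "partitions n \<subseteq> {xs. set xs \<subseteq> {0..n} \<and> length xs \<le> n}"
  proof
    fix nu assume "nu \<in> partitions n"
    then have pos: "\<And>k. k \<in> set nu \<Longrightarrow> 0 < k" and sum: "sum_list nu = n" by (auto simp: partitions_def)
    have "length nu \<le> sum_list nu"
      using pos
    proof (induction nu)
      case (Cons k nu)
      then have "0 < k" "length nu \<le> sum_list nu" by auto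
      then show ?case by simp
    qed simp
    moreover have "k \<le> n" if "k \<in> set nu" for k using member_le_sum_list[OF that] sum by simp
    ultimately show "nu \<in> {xs. set xs \<subseteq> {0..n} \<and> length xs \<le> n}" using sum by auto
  qed
qed (rule finite_lists_length_le, simp)

subsection \<open>The basic characters at regular semisimple elements\<close>

text \<open>The factor \<open>z\<close> would produce a nonzero vector in the kernel of the
  invertible matrix \<open>g\<close>.\<close>

lemma dvd_char_poly_GL_irr_polys:
  assumes g: "g \<in> GL n" and h: "irreducible h" "lead_coeff h = 1" "h dvd char_poly g"
  shows "h \<in> irr_polys"
proof -
  have "h \<noteq> [:0, 1:]"
  proof
    assume z: "h = [:0, 1:]"
    have gc: "g \<in> carrier_mat n n" using g by (rule GL_closed)
    obtain v where v: "v \<in> carrier_vec n" "v \<noteq> 0\<^sub>v n" "poly_act n g h v = 0\<^sub>v n"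
      using poly_act_kernel_of_dvd_char_poly[OF gc h(3) irreducible_poly_degree_pos[OF h(1)]] .
    obtain y where y: "y \<in> carrier_mat n n" "y * g = 1\<^sub>m n" using g by (auto simp: GL_iff)
    have gv: "g *\<^sub>v v \<in> carrier_vec n" using gc v(1) by auto
    have "poly_act n g h v = 0 \<cdot>\<^sub>v v + poly_act n g 1 (g *\<^sub>v v)"
      unfolding z one_pCons using gc v(1) by (rule poly_act_pCons)
    also have "\<dots> = g *\<^sub>v v"
      unfolding poly_act_1[OF gc gv] using v(1) gc by (intro eq_vecI) auto
    finally have "g *\<^sub>v v = 0\<^sub>v n" using v(3) by simp
    then have "y *\<^sub>v 0\<^sub>v n = (y * g) *\<^sub>v v" using assoc_mult_mat_vec[OF y(1) gc v(1)] by simp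
    also have "\<dots> = v" unfolding y(2) using v(1) by simp
    finally have "v = y *\<^sub>v 0\<^sub>v n" by simp
    also have "\<dots> = 0\<^sub>v n" using y(1) by (intro eq_vecI) auto
    finally show False using v(2) by simp
  qed
  then show ?thesis using h by (simp add: irr_polys_def)
qed

lemma finite_arrangements:
  assumes "finite H"
  shows "finite (arrangements H key ms)"
proof (rule finite_subset)
  show "arrangements H key ms \<subseteq> {ks. set ks \<subseteq> H \<and> length ks = length ms}"
  proof
    fix ks assume "ks \<in> arrangements H key ms"
    then have "set ks = H" "ms = map key ks" by (simp_all add: arrangements_def)
    then show "ks \<in> {ks. set ks \<subseteq> H \<and> length ks = length ms}" by simp
  qed
qed (rule finite_lists_length_eq[OF assms])

text \<open>A primary value depends on its block only through the characteristic polynomial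
  \<open>h\<close>, the block size being \<open>degree h\<close>. Hence the product over all blocks
  does not see their order.\<close>

definition root_character_sum ::
  "('b::{field,finite} \<Rightarrow> complex) \<Rightarrow> 'b \<Rightarrow> ('a::{field,finite} poly \<Rightarrow> int)
    \<Rightarrow> (nat \<Rightarrow> int) \<Rightarrow> 'a poly \<Rightarrow> complex" where
  "root_character_sum theta eps ell alpha h =
     (\<Sum>i=1..degree h. theta (eps_sub (CARD('a)) eps (degree h) powi ell h)
        powi (int (CARD('a)) ^ i * alpha (degree h)))"

text \<open>If all block polynomials lie in \<open>irr_polys\<close>, unique factorisation makes
  their list an order of \<open>H\<close>; otherwise some factor is zero. The degree condition in
  \<open>arrangements\<close> is automatic for block polynomials.\<close>

lemma prod_primary_P_diag_blocks:
  fixes A :: "'a::{field,finite} mat" and eps :: "'b::{field,finite}"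
  assumes A: "A \<in> GL (sum_list nu)" "block_upper nu A"
    and pos: "\<And>k. k \<in> set nu \<Longrightarrow> 0 < k"
    and H: "finite H" "\<And>h. h \<in> H \<Longrightarrow> irreducible h \<and> lead_coeff h = 1" "char_poly A = \<Prod>H"
  shows "(\<Prod>i<length nu. (map (\<lambda>k. primary_P theta eps ell (alpha k) k) nu ! i) (diag_block nu i A)) =
    (if block_char_polys nu A \<in> arrangements H degree nu
     then \<Prod>h\<in>H. root_character_sum theta eps ell alpha h else 0)"
    (is "?L = (if ?ks \<in> _ then _ else 0)")
proof -
  let ?S = "root_character_sum theta eps ell alpha"
  have Ac: "A \<in> carrier_mat (sum_list nu) (sum_list nu)" using A(1) by (rule GL_closed)
  have prod: "char_poly A = (\<Prod>i<length nu. ?ks ! i)"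
    using char_poly_block_upper[OF Ac A(2)] by simp
  have val: "(map (\<lambda>k. primary_P theta eps ell (alpha k) k) nu ! i) (diag_block nu i A) =
      (if ?ks ! i \<in> irr_polys then ?S (?ks ! i) else 0)" if i: "i < length nu" for i
  proof -
    have deg: "degree (?ks ! i) = nu ! i" "lead_coeff (?ks ! i) = 1"
      using degree_monic_char_poly[OF diag_block_closed, of nu i A] i by auto
    have "?ks ! i dvd \<Prod>H"
      unfolding H(3)[symmetric] prod by (rule dvd_prodI) (use i in auto)
    then obtain H' where H': "H' \<subseteq> H" "?ks ! i = \<Prod>H'"
      using monic_dvd_prod_irreducible[OF H(1,2) deg(2)] by auto
    have "primary_P theta eps ell (alpha (nu ! i)) (nu ! i) (diag_block nu i A) =
      (if char_poly (diag_block nu i A) \<in> irr_polys then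
       \<Sum>j=1..nu ! i. theta (eps_sub (CARD('a)) eps (nu ! i) powi ell (char_poly (diag_block nu i A)))
         powi (int (CARD('a)) ^ j * alpha (nu ! i)) else 0)"
    proof (rule primary_P_squarefree[OF diag_block_closed])
      show "finite H'" using H' H(1) finite_subset by blast
      show "char_poly (diag_block nu i A) = \<Prod>H'" using H'(2) i by simp
    qed (use pos i H' H(2) in auto)
    then show ?thesis using i deg by (simp add: root_character_sum_def del: One_nat_def)
  qed
  have L: "?L = (\<Prod>i<length nu. if ?ks ! i \<in> irr_polys then ?S (?ks ! i) else 0)"
    by (rule prod.cong) (use val in auto)
  show ?thesis
  proof (cases "?ks \<in> arrangements H degree nu")
    case True
    then have ks: "distinct ?ks" "set ?ks = H" by (auto simp: arrangements_def)
    have "?ks ! i \<in> irr_polys" if i: "i < length nu" for i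
    proof (rule dvd_char_poly_GL_irr_polys[OF A(1)])
      have "?ks ! i \<in> H" using ks(2) i nth_mem[of i ?ks] by simp
      then show "irreducible (?ks ! i)" "lead_coeff (?ks ! i) = 1" using H(2) by auto
      show "?ks ! i dvd char_poly A" unfolding prod by (rule dvd_prodI) (use i in auto)
    qed
    then have "?L = (\<Prod>i<length nu. ?S (?ks ! i))" unfolding L by (intro prod.cong) auto
    also have "\<dots> = prod_list (map ?S ?ks)"
      by (simp add: prod.list_conv_set_nth atLeast0LessThan del: nth_block_char_polys)
    also have "\<dots> = (\<Prod>h\<in>H. ?S h)"
      using prod.distinct_set_conv_list[OF ks(1), of ?S] ks(2) by simp
    finally show ?thesis using True by simp
  next
    case False
    have "\<exists>i<length nu. ?ks ! i \<notin> irr_polys"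
    proof (rule ccontr)
      assume all: "\<not> (\<exists>i<length nu. ?ks ! i \<notin> irr_polys)"
      have irr: "irreducible k \<and> lead_coeff k = 1" if k: "k \<in> set ?ks" for k
      proof -
        obtain i where "i < length ?ks" "?ks ! i = k" using k unfolding in_set_conv_nth by blast
        then have "k \<in> irr_polys" using all by auto
        then show ?thesis by (simp add: irr_polys_def)
      qed
      have "distinct ?ks \<and> set ?ks = H"
      proof (rule prod_list_irreducible_eq[OF H(1,2) irr])
        show "prod_list ?ks = \<Prod>H" using char_poly_block_char_polys[OF Ac A(2)] H(3) by simp
      qed
      then show False using False by (simp add: arrangements_def)
    qed
    then have "?L = 0" unfolding L by (intro prod_zero) auto
    then show ?thesis using False by simp
  qed
qed

lemma basic_B_squarefree:
  fixes g :: "'a::{field,finite} mat" and eps :: "'b::{field,finite}"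
  assumes g: "g \<in> GL (sum_list nu)" and pos: "\<And>k. k \<in> set nu \<Longrightarrow> 0 < k"
    and H: "finite H" "\<And>h. h \<in> H \<Longrightarrow> irreducible h \<and> lead_coeff h = 1" "char_poly g = \<Prod>H"
  shows "basic_B theta eps ell alpha nu g =
    of_nat (card (arrangements H degree nu)) * (\<Prod>h\<in>H. root_character_sum theta eps ell alpha h)"
proof -
  let ?n = "sum_list nu"
  let ?X = "{x \<in> GL ?n. conjugate_by ?n x g \<in> parabolic nu}"
  let ?k = "\<lambda>x. block_char_polys nu (conjugate_by ?n x g)"
  let ?R = "arrangements H degree nu" and ?c = "\<Prod>h\<in>H. root_character_sum theta eps ell alpha h"
  let ?P = "parabolic nu :: 'a mat set"
  have finX: "finite ?X" by simp
  have finR: "finite ?R" using H(1) by (rule finite_arrangements)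
  have "(\<Sum>x\<in>?X. \<Prod>i<length nu. (map (\<lambda>k. primary_P theta eps ell (alpha k) k) nu ! i)
        (diag_block nu i (conjugate_by ?n x g))) = (\<Sum>x\<in>?X. if ?k x \<in> ?R then ?c else 0)"
  proof (rule sum.cong)
    fix x assume x: "x \<in> ?X"
    show "(\<Prod>i<length nu. (map (\<lambda>k. primary_P theta eps ell (alpha k) k) nu ! i)
        (diag_block nu i (conjugate_by ?n x g))) = (if ?k x \<in> ?R then ?c else 0)"
    proof (rule prod_primary_P_diag_blocks[OF _ _ pos H(1,2)])
      show "char_poly (conjugate_by ?n x g) = \<Prod>H" using x g H(3) by (simp add: char_poly_conjugate_by)
    qed (use x in \<open>auto simp: parabolic_eq\<close>)
  qed simp
  also have "\<dots> = (\<Sum>x\<in>{x \<in> ?X. ?k x \<in> ?R}. ?c)"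
    by (rule sum.inter_filter[OF finX, symmetric])
  also have "\<dots> = of_nat (card {x \<in> ?X. ?k x \<in> ?R}) * ?c" by simp
  \<comment> \<open>The conjugators are grouped by the order of factors they realise. Every group
    has the size of the parabolic subgroup, which cancels the averaging factor.\<close>
  also have "card {x \<in> ?X. ?k x \<in> ?R} = (\<Sum>ks\<in>?R. card {x \<in> ?X. ?k x = ks})"
  proof -
    have eq: "{x \<in> ?X. ?k x \<in> ?R} = (\<Union>ks\<in>?R. {x \<in> ?X. ?k x = ks})" by blast
    show ?thesis unfolding eq by (rule card_UN_disjoint[OF finR]) (use finX in auto)
  qed
  also have "\<dots> = (\<Sum>ks\<in>?R. card ?P)"
  proof (rule sum.cong)
    fix ks assume "ks \<in> ?R"
    then have ks: "distinct ks" "set ks = H" "map degree ks = nu" by (auto simp: arrangements_def)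
    have "char_poly g = prod_list ks"
      using H(3) ks prod.distinct_set_conv_list[of ks "\<lambda>x. x"] by simp
    then have "card {x \<in> GL ?n. conjugate_by ?n x g \<in> parabolic nu \<and> ?k x = ks} = card ?P"
      using ks H(2) by (intro card_conjugators[OF g]) auto
    moreover have "{x \<in> ?X. ?k x = ks} = {x \<in> GL ?n. conjugate_by ?n x g \<in> parabolic nu \<and> ?k x = ks}"
      by blast
    ultimately show "card {x \<in> ?X. ?k x = ks} = card ?P" by simp
  qed simp
  finally have sum: "(\<Sum>x\<in>?X. \<Prod>i<length nu. (map (\<lambda>k. primary_P theta eps ell (alpha k) k) nu ! i)
      (diag_block nu i (conjugate_by ?n x g))) = of_nat (card ?R * card ?P) * ?c" by simp
  have "card ?P \<noteq> 0" using card_parabolic_pos[of nu, where 'a = 'a] by simp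
  then show ?thesis unfolding basic_B_def parabolic_product_def sum by simp
qed

lemma sorted_desc_unique:
  fixes xs ys :: "nat list"
  assumes "sorted_wrt (\<ge>) xs" "sorted_wrt (\<ge>) ys" "mset xs = mset ys"
  shows "xs = ys"
proof -
  have "sorted (rev xs)" "sorted (rev ys)" using assms(1,2) by (simp_all add: sorted_wrt_rev)
  moreover have "mset (rev xs) = mset (rev ys)" using assms(3) by simp
  ultimately have "rev xs = rev ys" by (metis properties_for_sort)
  then show ?thesis by simp
qed

text \<open>A repeated entry in the factorisation would give a square divisor. Every monic
  irreducible divisor divides, hence equals, one of the entries, so \<open>hs\<close> misses nothing
  and adds nothing.\<close>

lemma char_poly_regular_semisimple:
  assumes "regular_semisimple g" "has_cycle_type g mu"
    and hs: "set hs = {h. irreducible h \<and> lead_coeff h = 1 \<and> h dvd char_poly g}"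
  shows "char_poly g = \<Prod>(set hs)"
proof -
  obtain ks where ks: "\<And>h. h \<in> set ks \<Longrightarrow> irreducible h \<and> lead_coeff h = 1" "prod_list ks = char_poly g"
    using assms(2) by (auto simp: has_cycle_type_def)
  have "distinct ks"
  proof (rule ccontr)
    assume "\<not> distinct ks"
    then obtain xs ys zs y where eq: "ks = xs @ [y] @ ys @ [y] @ zs" using not_distinct_decomp by blast
    then have "char_poly g = y\<^sup>2 * (prod_list xs * prod_list ys * prod_list zs)"
      using ks(2) by (simp add: power2_eq_square ac_simps)
    then have "y\<^sup>2 dvd char_poly g" by (metis dvd_triv_left)
    moreover have "irreducible y" using ks(1) eq by auto
    ultimately show False using assms(1) by (auto simp: regular_semisimple_def)
  qed
  then have prod: "char_poly g = \<Prod>(set ks)"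
    using ks(2) prod.distinct_set_conv_list[of ks "\<lambda>x. x"] by simp
  have "set ks = set hs"
  proof (rule equalityI)
    show "set ks \<subseteq> set hs"
    proof
      fix h assume h: "h \<in> set ks"
      then have "h dvd \<Prod>(set ks)" using dvd_prodI[of "set ks" h "\<lambda>x. x"] by simp
      then show "h \<in> set hs" using ks(1)[OF h] prod unfolding hs by simp
    qed
    show "set hs \<subseteq> set ks"
    proof
      fix h assume "h \<in> set hs"
      then have "irreducible h" "lead_coeff h = 1" "h dvd \<Prod>(set ks)" unfolding hs using prod by auto
      then show "h \<in> set ks" using irreducible_monic_dvd_prod_imp_mem[of "set ks" h] ks(1) by blast
    qed
  qed
  then show ?thesis using prod by simp
qed

text \<open>An arrangement makes the two lists of degrees equal as multisets; as both are weakly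
  decreasing, they are then equal as lists.\<close>

lemma card_arrangements_degree:
  assumes "distinct hs" "sorted_wrt (\<ge>) (map degree hs)" "sorted_wrt (\<ge>) nu"
  shows "card (arrangements (set hs) degree nu) =
    (if nu = map degree hs then \<Prod>k\<in>set nu. fact (count_list nu k) else 0)"
proof (cases "nu = map degree hs")
  case True
  have "card {h \<in> set hs. degree h = k} = count_list nu k" for k
  proof -
    have "{h \<in> set hs. degree h = k} = set (filter (\<lambda>h. degree h = k) hs)" by auto
    also have "card \<dots> = length (filter (\<lambda>h. degree h = k) hs)"
      using assms(1) by (intro distinct_card) simp
    also have "\<dots> = count_list nu k"
      unfolding True by (induction hs) auto
    finally show ?thesis .
  qed
  then show ?thesis using True card_arrangements[of "set hs" degree nu] by simp
next
  case False
  have "arrangements (set hs) degree nu = {}"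
  proof (rule ccontr)
    assume "arrangements (set hs) degree nu \<noteq> {}"
    then obtain ks where ks: "distinct ks" "set ks = set hs" "map degree ks = nu"
      by (auto simp: arrangements_def)
    then have "mset ks = mset hs" using assms(1) set_eq_iff_mset_eq_distinct by blast
    then have "mset nu = mset (map degree hs)" using ks(3) by (metis mset_map)
    then show False using False sorted_desc_unique assms(2,3) by blast
  qed
  then show ?thesis using False by simp
qed

lemma map_times_partitions:
  assumes "nu \<in> partitions m" "0 < d"
  shows "map ((*) d) nu \<in> partitions (d * m)"
proof -
  have "sum_list (map ((*) d) nu) = d * sum_list nu" by (simp add: sum_list_const_mult)
  moreover have "sorted_wrt (\<ge>) (map ((*) d) nu)"
    using assms(1) unfolding sorted_wrt_map partitions_def
    by (auto elim: sorted_wrt_mono_rel[rotated])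
  ultimately show ?thesis using assms by (auto simp: partitions_def)
qed

lemma map_div_partitions:
  assumes mu: "mu \<in> partitions n" and dvd: "\<forall>k\<in>set mu. d dvd k" and d: "0 < d"
  shows "map (\<lambda>k. k div d) mu \<in> partitions (n div d)" "map ((*) d) (map (\<lambda>k. k div d) mu) = mu"
proof -
  show eq: "map ((*) d) (map (\<lambda>k. k div d) mu) = mu"
    using dvd by (induction mu) auto
  have "d * sum_list (map (\<lambda>k. k div d) mu) = sum_list mu"
    using arg_cong[OF eq, of sum_list] by (simp add: sum_list_const_mult del: map_map)
  then have "sum_list (map (\<lambda>k. k div d) mu) = n div d"
    using mu d by (auto simp: partitions_def)
  moreover have "sorted_wrt (\<ge>) (map (\<lambda>k. k div d) mu)"
    using mu unfolding sorted_wrt_map partitions_def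
    by (auto elim: sorted_wrt_mono_rel[rotated] simp: div_le_mono)
  moreover have "0 < k div d" if "k \<in> set mu" for k
    using that mu dvd d by (auto simp: partitions_def dvd_imp_le div_greater_zero_iff)
  ultimately show "map (\<lambda>k. k div d) mu \<in> partitions (n div d)"
    by (auto simp: partitions_def)
qed

theorem theorem1p6:
  fixes q n d :: nat
    and lam mu :: "nat list"
    and iota :: "'a::{field,finite} \<Rightarrow> 'b::{field,finite}"
    and eps :: 'b
    and theta :: "'b \<Rightarrow> complex"
    and ell :: "'a poly \<Rightarrow> int"
    and f :: "'a poly"
    and g :: "'a mat"
    and hs :: "'a poly list"
  assumes q: "CARD('a) = q"
    and n: "1 \<le> n"
    and extension: "field_hom iota" "CARD('b) = q ^ fact n"
    and eps: "eps \<noteq> 0" "\<forall>x. x \<noteq> 0 \<longrightarrow> (\<exists>k::nat. x = eps ^ k)"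
    and theta: "\<forall>x. x \<noteq> 0 \<longrightarrow> theta x \<noteq> 0"
      "\<forall>x y. x \<noteq> 0 \<longrightarrow> y \<noteq> 0 \<longrightarrow> theta (x * y) = theta x * theta y"
      "inj_on theta {x. x \<noteq> 0}"
      "theta eps = exp (2 * of_real pi * \<i> / of_nat (q ^ fact n - 1))"
    and ell: "\<forall>h\<in>irr_polys. degree h \<le> n \<longrightarrow>
      poly (map_poly iota h) (eps_sub q eps (degree h) powi ell h) = 0"
    and d: "d dvd n"
    and lam: "lam \<in> partitions (n div d)"
    and f: "f \<in> irr_polys" "degree f = d"
    and mu: "mu \<in> partitions n"
    and g: "g \<in> reg_semisimple_of_type n mu"
    and hs: "distinct hs"
      "set hs = {h. irreducible h \<and> lead_coeff h = 1 \<and> h dvd char_poly g}"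
      "map degree hs = mu"
  shows "((\<exists>k\<in>set mu. \<not> d dvd k) \<longrightarrow> primary_char theta eps ell n f lam g = 0) \<and>
    ((\<forall>k\<in>set mu. d dvd k) \<longrightarrow>
      (\<exists>mt\<in>partitions (n div d). mu = map ((*) d) mt \<and>
         primary_char theta eps ell n f lam g =
           (- 1) ^ (n div d * (d - 1)) * sym_char lam mt *
           (\<Prod>i<length mu. 1 / of_nat (mt ! i) *
              (\<Sum>beta\<in>{beta \<in> subfield_of_order_pow q (mu ! i).
                         poly (map_poly iota (hs ! i)) beta = 0}.
                 theta beta powi (ell f * int (qbracket (q ^ d) (mt ! i)))))))"
proof -
  have d0: "0 < d" using f irreducible_poly_degree_pos by (auto simp: irr_polys_def)
  have nd: "d * (n div d) = n" using d by simp
  have gn: "g \<in> GL n" and rs: "regular_semisimple g" and ct: "has_cycle_type g mu"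
    using g by (auto simp: reg_semisimple_of_type_def)
  have char: "char_poly g = \<Prod>(set hs)" by (rule char_poly_regular_semisimple[OF rs ct hs(2)])
  have H: "irreducible h \<and> lead_coeff h = 1" if "h \<in> set hs" for h using that hs(2) by auto
  have H_irr: "h \<in> irr_polys" if "h \<in> set hs" for h
    using dvd_char_poly_GL_irr_polys[OF gn] that hs(2) by auto
  have mu_sorted: "sorted_wrt (\<ge>) (map degree hs)" and mu_sum: "sum_list mu = n"
    using mu hs(3) by (auto simp: partitions_def)
  let ?alpha = "\<lambda>m. ell f * int (qbracket (CARD('a) ^ d) (m div d))"
  let ?S = "root_character_sum theta eps ell ?alpha"
  have B: "basic_B theta eps ell ?alpha (map ((*) d) nu) g =
      (if map ((*) d) nu = mu then of_nat (\<Prod>k\<in>set nu. fact (count_list nu k)) * (\<Prod>h\<in>set hs. ?S h) else 0)"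
    if nu: "nu \<in> partitions (n div d)" for nu
  proof -
    let ?nu = "map ((*) d) nu"
    have part: "?nu \<in> partitions n" using map_times_partitions[OF nu d0] nd by simp
    then have sum: "sum_list ?nu = n" and pos: "\<And>k. k \<in> set ?nu \<Longrightarrow> 0 < k" and sorted: "sorted_wrt (\<ge>) ?nu"
      unfolding partitions_def by blast+
    have "basic_B theta eps ell ?alpha ?nu g =
        of_nat (card (arrangements (set hs) degree ?nu)) * (\<Prod>h\<in>set hs. ?S h)"
      using gn unfolding sum[symmetric] by (rule basic_B_squarefree) (use pos H char in auto)
    \<comment> \<open>Scaling by \<open>d\<close> is injective and keeps multiplicities, so the
      factorials may be taken over \<open>nu\<close> instead of \<open>?nu\<close>.\<close>
    also have "card (arrangements (set hs) degree ?nu) =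
        (if ?nu = mu then \<Prod>k\<in>set nu. fact (count_list nu k) else 0)"
      unfolding card_arrangements_degree[OF hs(1) mu_sorted sorted] hs(3)
      using map_const_times_count[OF d0, of nu] by (simp only:)
    finally show ?thesis by simp
  qed
  have char_eq: "primary_char theta eps ell n f lam g = (- 1) ^ (n div d * (d - 1)) *
      (\<Sum>nu\<in>partitions (n div d). 1 / of_nat (z_part nu) * sym_char lam nu *
        (if map ((*) d) nu = mu then of_nat (\<Prod>k\<in>set nu. fact (count_list nu k)) * (\<Prod>h\<in>set hs. ?S h) else 0))"
    unfolding primary_char_def Let_def f(2) by (simp add: B cong: sum.cong)
  show ?thesis
  proof (intro conjI impI)
    assume "\<exists>k\<in>set mu. \<not> d dvd k"
    then have "map ((*) d) nu \<noteq> mu" for nu by auto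
    then show "primary_char theta eps ell n f lam g = 0" unfolding char_eq by simp
  next
    assume dvd: "\<forall>k\<in>set mu. d dvd k"
    define mt where "mt = map (\<lambda>k. k div d) mu"
    have mt: "mt \<in> partitions (n div d)" "map ((*) d) mt = mu"
      using map_div_partitions[OF mu dvd d0] by (simp_all add: mt_def)
    have inj: "inj (map ((*) d))" using d0 by (intro inj_mapI injI) auto
    have unique: "map ((*) d) nu = mu \<longleftrightarrow> nu = mt" for nu
    proof
      assume "map ((*) d) nu = mu"
      then have "map ((*) d) nu = map ((*) d) mt" by (simp only: mt(2))
      then show "nu = mt" by (rule injD[OF inj])
    qed (simp only: mt(2))
    let ?F = "of_nat (\<Prod>k\<in>set mt. fact (count_list mt k)) :: complex"
    let ?roots = "\<lambda>i. \<Sum>beta\<in>{beta \<in> subfield_of_order_pow q (mu ! i). poly (map_poly iota (hs ! i)) beta = 0}.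
        theta beta powi (ell f * int (qbracket (q ^ d) (mt ! i)))"
    have "primary_char theta eps ell n f lam g = (- 1) ^ (n div d * (d - 1)) *
        (\<Sum>nu\<in>partitions (n div d). if nu = mt then
           1 / of_nat (z_part mt) * sym_char lam mt * (?F * (\<Prod>h\<in>set hs. ?S h)) else 0)"
      unfolding char_eq unique by (intro arg_cong2[of _ _ _ _ "(*)"] sum.cong) auto
    also have "\<dots> = (- 1) ^ (n div d * (d - 1)) *
        (1 / of_nat (z_part mt) * sym_char lam mt * (?F * (\<Prod>h\<in>set hs. ?S h)))"
      using mt(1) finite_partitions by simp
    also have "\<dots> = (- 1) ^ (n div d * (d - 1)) * sym_char lam mt *
        (1 / of_nat (prod_list mt) * (\<Prod>h\<in>set hs. ?S h))"
    proof -
      \<comment> \<open>Here \<open>c\<close> stands for the multiplicity factorials, which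
        \<open>z_part\<close> puts in the denominator and the number of arrangements in the
        numerator; \<open>p\<close> is the product of the parts.\<close>
      have cancel: "a * (1 / (p * c) * b * (c * e)) = a * b * (1 / p * e)" if "c \<noteq> 0" for a b c e p :: complex
        using that by (simp add: field_simps)
      have "?F \<noteq> 0" by simp
      then show ?thesis unfolding z_part_eq of_nat_mult by (rule cancel)
    qed
    also have "1 / of_nat (prod_list mt) * (\<Prod>h\<in>set hs. ?S h) = (\<Prod>i<length mu. 1 / of_nat (mt ! i) * ?roots i)"
    proof -
      have len: "length mt = length mu" "length hs = length mu" using hs(3) by (auto simp: mt_def)
      have "(\<Prod>h\<in>set hs. ?S h) = prod_list (map ?S hs)"
        using prod.distinct_set_conv_list[OF hs(1)] .
      also have "\<dots> = (\<Prod>i<length mu. ?S (hs ! i))"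
        using len by (simp add: prod.list_conv_set_nth atLeast0LessThan)
      also have "\<dots> = (\<Prod>i<length mu. ?roots i)"
      proof (rule prod.cong)
        fix i assume "i \<in> {..<length mu}"
        then have i: "i < length mu" by simp
        let ?h = "hs ! i"
        have h: "?h \<in> set hs" using i len by simp
        have deg: "mu ! i = degree ?h" using nth_map[of i hs degree] i len hs(3) by simp
        \<comment> \<open>The hypothesis on \<open>ell\<close> is restricted to degrees up to
          \<open>n\<close>; this degree is a part of \<open>mu\<close> and so bounded by the sum of
          the parts.\<close>
        have "degree ?h \<le> n"
          unfolding deg[symmetric] mu_sum[symmetric] using i by (simp add: elem_le_sum_list)
        then have root: "poly (map_poly iota ?h) (eps_sub q eps (degree ?h) powi ell ?h) = 0"
          using ell H_irr[OF h] by blast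
        interpret finite_field_extension iota q
          using extension(1) q by (simp add: finite_field_extension_def finite_field_extension_axioms_def)
        have mti: "mt ! i = degree ?h div d" unfolding mt_def using i deg by simp
        have "?roots i = (\<Sum>j=1..degree ?h. theta (eps_sub q eps (degree ?h) powi ell ?h)
            powi (int q ^ j * (ell f * int (qbracket (q ^ d) (mt ! i)))))"
          unfolding deg by (rule sum_roots[OF _ _ H_irr[OF h] root]) (use theta(1,2) in auto)
        also have "\<dots> = ?S ?h" unfolding root_character_sum_def mti q ..
        finally show "?S ?h = ?roots i" ..
      qed simp
      finally have "(\<Prod>h\<in>set hs. ?S h) = (\<Prod>i<length mu. ?roots i)" .
      moreover have "prod_list mt = (\<Prod>i<length mu. mt ! i)"
        using len by (simp add: prod.list_conv_set_nth atLeast0LessThan)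
      ultimately show ?thesis by (simp add: prod.distrib prod_dividef)
    qed
    finally show "\<exists>mt\<in>partitions (n div d). mu = map ((*) d) mt \<and>
        primary_char theta eps ell n f lam g = (- 1) ^ (n div d * (d - 1)) * sym_char lam mt *
          (\<Prod>i<length mu. 1 / of_nat (mt ! i) *
            (\<Sum>beta\<in>{beta \<in> subfield_of_order_pow q (mu ! i). poly (map_poly iota (hs ! i)) beta = 0}.
              theta beta powi (ell f * int (qbracket (q ^ d) (mt ! i)))))"
      using mt by (intro bexI[of _ mt]) auto
  qed
qed

end
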